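(* For $\mathcal L_2$-a.e. $\lambda\in\{z\in\mathbb C:\ 2^{-1/2}\le|z|\le2\cdot5^{-5/8}\}$, the measure $\nu_\lambda$ is absolutely continuous with density in $L^2(\mathbb R^2)$; in particular $\mathcal L_2(A_\lambda)>0$. Moreover, for any $2^{-1/2}<r<R<2\cdot5^{-5/8}$, $$\dim_H\{\lambda\in\mathbb C:\ r<|\lambda|<R,\ d\nu_\lambda/dx\notin L^2(\mathbb R^2)\}\le4-\frac{\log 2}{-\log r},$$ where $d\nu_\lambda/dx\notin L^2$ includes the case that $\nu_\lambda$ is not absolutely continuous.
   Context: $\mathcal L_2$ is area measure on $\mathbb C\cong\mathbb R^2$. $\nu_\lambda$ is the distribution of the random series $\sum_{n\ge0}\pm\lambda^n$ with independent fair signs; $A_\lambda=\{\sum_{n\ge0}a_n\lambda^n:a_n\in\{-1,1\}\}$ is its support. $\dim_H$ is Hausdorff dimension. *)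

theory Defs
  imports "HOL-Probability.Probability"
begin

definition coins :: "(nat \<Rightarrow> real) measure" where
  "coins = Pi\<^sub>M UNIV (\<lambda>_. measure_pmf (pmf_of_set {-1, 1}))"

definition ber_series :: "complex \<Rightarrow> (nat \<Rightarrow> real) \<Rightarrow> complex" where
  "ber_series lam a = (\<Sum>n. complex_of_real (a n) * lam ^ n)"

definition nu :: "complex \<Rightarrow> complex measure" where
  "nu lam = distr coins borel (ber_series lam)"

text \<open>A_lambda: support, the set of all sums with signs in {-1,1}.\<close>
definition A_set :: "complex \<Rightarrow> complex set" where
  "A_set lam = ber_series lam ` {a. \<forall>n. a n \<in> {-1, 1}}"

definition has_L2_density :: "complex measure \<Rightarrow> bool" where
  "has_L2_density mu \<longleftrightarrow>
     (\<exists>f :: complex \<Rightarrow> real. f \<in> borel_measurable lborel \<and> (\<forall>x. 0 \<le> f x) \<and>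
        mu = density lborel (\<lambda>x. ennreal (f x)) \<and>
        integrable lborel (\<lambda>x. (f x)\<^sup>2))"

definition hausdorff_content :: "real \<Rightarrow> real \<Rightarrow> 'a::metric_space set \<Rightarrow> ennreal" where
  "hausdorff_content s \<delta> E =
     (INF U \<in> {U :: nat \<Rightarrow> 'a set. E \<subseteq> (\<Union>i. U i) \<and> (\<forall>i. bounded (U i) \<and> diameter (U i) \<le> \<delta>)}.
        (\<Sum>i. ennreal (diameter (U i) powr s)))"

definition hausdorff_measure :: "real \<Rightarrow> 'a::metric_space set \<Rightarrow> ennreal" where
  "hausdorff_measure s E = (SUP \<delta> \<in> {0<..}. hausdorff_content s \<delta> E)"

definition hausdorff_dim :: "'a::metric_space set \<Rightarrow> ereal" where
  "hausdorff_dim E = Inf {ereal s | s. 0 \<le> s \<and> hausdorff_measure s E = 0}"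

end

theory Submission
  imports Defs
begin

text \<open>Two sign sequences first differing at index \<open>k\<close> have sums differing by \<open>2 z\<^sup>k f z\<close>, where \<open>f\<close>
  has coefficients in \<open>{-1, 0, 1}\<close> and constant term \<open>\<plusminus>1\<close>.  If such an \<open>f\<close> had a double zero at a
  nonreal \<open>z\<close>, it would have one at \<open>cnj z\<close> too, and Jensen's inequality on the circle of squared
  radius \<open>T\<close> would give \<open>T\<^sup>2 / \<bar>z\<bar>\<^sup>4 \<le> (1 - T) powr (-1/2)\<close>.  The best choice
  \<open>T = 4/5\<close> excludes exactly \<open>\<bar>z\<bar> < 2 * 5 powr (-5/8)\<close>; by compactness \<open>\<bar>f\<bar>\<close> and \<open>\<bar>f'\<bar>\<close> are not
  small simultaneously near a nonreal \<open>z\<close> inside that disc (transversality).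

  The density of \<open>nu z\<close> is built as the limit of its mollifications at scale \<open>2\<^sup>-\<^sup>j\<close>.  The difference
  of two consecutive mollifiers is a sum of derivatives of compactly supported kernels, so in the
  mean square over \<open>z\<close> each pair of sign sequences contributes an oscillating integral in which
  integration by parts against \<open>\<Phi> z = 2 z\<^sup>k f z\<close> gains powers of \<open>2\<^sup>-\<^sup>j / \<bar>\<Phi>'\<bar>\<close>.  Together with the
  measure of the sublevel sets of \<open>f\<close>, this bounds the energy of the increment, integrated over
  \<open>z\<close>, by \<open>O((2 powr (2 - \<beta>))\<^sup>j)\<close> whenever \<open>2 r powr \<beta> > 1\<close>.  A Sobolev inequality on the squares of
  the \<open>2\<^sup>-\<^sup>j\<close> grid upgrades the integral over \<open>z\<close> to a sum of one arbitrary sample per square,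
  so only \<open>O((2 powr (4 - \<beta> + \<epsilon>))\<^sup>j)\<close> squares meet the set where the energy exceeds \<open>(2 powr -\<epsilon>)\<^sup>j\<close>.
  Outside the limsup of these squares the energies are summable and the density is square
  integrable; the limsup set has dimension at most \<open>4 - \<beta>\<close>, and \<open>\<beta>\<close> tends to \<open>ln 2 / (- ln r)\<close>.
  The resulting dimension \<open>4 - ln 2 / (- ln r)\<close> is less than \<open>2\<close> for \<open>r > 2 powr (-1/2)\<close>, which
  gives the almost everywhere statement.\<close>

section \<open>Transversality\<close>

text \<open>An average over \<lambda> bounds the measure of the exceptional set but says nothing
  about single parameters, as a dimension bound must. Sampling closes the gap because a function
  mollified at scale \<open>2^-j\<close> also varies in \<lambda> at that scale, so a point value is
  controlled by an average over one square of side \<open>2^-j\<close>. A pair first differing at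
  \<open>k\<close> gains the cube of \<open>(k+1) 2^-j / r^k\<close>: one power from a single
  integration by parts, two from the area of the set where the kernel is nonzero. Below the critical
  radius \<open>ln 2 / (- ln r) < 3\<close>, so this cube suffices, and finitely differentiable
  kernels and cutoffs are enough. Real parameters cannot be reached: there the conjugate zero is the
  zero itself. They are put into the exceptional set as a whole, which is harmless because a segment
  has dimension 1 and \<open>4 - ln 2 / (- ln r) > 1\<close>. All estimates concern finite
  truncations, that is polynomials in \<lambda>, with constants that do not depend on the degree;
  the random series enters only through a limit at the end.\<close>

definition sign_quotients :: "complex poly set" where
  "sign_quotients = {f. coeff f 0 \<in> {-1, 1} \<and> (\<forall>i. coeff f i \<in> {-1, 0, 1})}"

text \<open>On the circle \<open>|z|^2 = T\<close> one has
  \<open>|T - cnj a z|^2 = T |z - a|^2\<close>. In terms of coefficients this is the identity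
  \<open>key\<close>, and since \<open>c\<close> is \<open>b\<close> shifted by one the weighted sum
  telescopes; only the boundary term at \<open>n\<close> survives. The argument is algebraic,
  without a contour integral.\<close>

lemma reflected_factor_sum:
  fixes b :: "nat \<Rightarrow> complex" and a :: complex and T :: real
  assumes "c = (\<lambda>i. case i of 0 \<Rightarrow> 0 | Suc j \<Rightarrow> b j)"
  shows "T * (\<Sum>i\<le>n. (cmod (c i - a * b i))\<^sup>2 * T ^ i)
       - (\<Sum>i\<le>n. (cmod (T * b i - cnj a * c i))\<^sup>2 * T ^ i)
       = - (T - (cmod a)\<^sup>2) * T ^ Suc n * (cmod (b n))\<^sup>2"
proof -
  have key: "T * (cmod (x - a * y))\<^sup>2 - (cmod (T * y - cnj a * x))\<^sup>2
      = (T - (cmod a)\<^sup>2) * ((cmod x)\<^sup>2 - T * (cmod y)\<^sup>2)" for x y :: complex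
    unfolding cmod_power2 by (simp add: power2_eq_square algebra_simps)
  show ?thesis
  proof (induction n)
    case 0
    show ?case using key[of 0 "b 0"] assms by (simp add: algebra_simps)
  next
    case (Suc n)
    have "T * (cmod (c (Suc n) - a * b (Suc n)))\<^sup>2 * T ^ Suc n
        - (cmod (T * b (Suc n) - cnj a * c (Suc n)))\<^sup>2 * T ^ Suc n
      = (T - (cmod a)\<^sup>2) * ((cmod (b n))\<^sup>2 - T * (cmod (b (Suc n)))\<^sup>2) * T ^ Suc n"
      using key[of "c (Suc n)" "b (Suc n)"] assms by (simp flip: left_diff_distrib)
    with Suc show ?case
      by (simp add: algebra_simps)
  qed
qed

text \<open>By Parseval this is the mean of \<open>|p|^2\<close> over the circle
  \<open>|z|^2 = T\<close>, as soon as \<open>n\<close> is at least the degree of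
  \<open>p\<close>.\<close>

definition weighted_norm2 :: "nat \<Rightarrow> real \<Rightarrow> complex poly \<Rightarrow> real" where
  "weighted_norm2 n T p = (\<Sum>i\<le>n. (cmod (coeff p i))\<^sup>2 * T ^ i)"

lemma weighted_norm2_reflect:
  assumes "degree p < n"
  shows "weighted_norm2 n T ([:T, - cnj a:] * p) = T * weighted_norm2 n T ([:-a, 1:] * p)"
proof -
  define c where "c = (\<lambda>i. case i of 0 \<Rightarrow> 0 | Suc j \<Rightarrow> coeff p j)"
  have 1: "coeff ([:T, - cnj a:] * p) i = T * coeff p i - cnj a * c i" for i
    by (cases i) (simp_all add: c_def)
  have 2: "coeff ([:-a, 1:] * p) i = c i - a * coeff p i" for i
    by (cases i) (simp_all add: c_def)
  \<comment> \<open>The strict bound on the degree removes the boundary term of the telescoping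
    sum.\<close>
  have "coeff p n = 0"
    using assms by (simp add: coeff_eq_0)
  then show ?thesis
    using reflected_factor_sum[OF c_def, where T = T and a = a and n = n]
    unfolding weighted_norm2_def 1 2 by simp
qed

text \<open>A Jensen inequality: reflecting the four zeros in the circle of radius \<open>sqrt T\<close> preserves
  the \<open>L\<^sup>2\<close> norm on that circle up to a power of \<open>T\<close>.\<close>

lemma jensen_double_conjugate_zeros:
  fixes g :: "complex poly" and T :: real
  assumes T: "0 < T" and a: "a \<noteq> 0"
    and F: "F = [:-a, 1:] * ([:-a, 1:] * ([:-cnj a, 1:] * ([:-cnj a, 1:] * g)))"
    and n: "degree F < n"
  shows "T ^ 4 * (cmod (coeff F 0))\<^sup>2 \<le> (cmod a) ^ 8 * weighted_norm2 n T F"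
proof (cases "g = 0")
  case True
  then show ?thesis using F by (simp add: weighted_norm2_def)
next
  case False
  let ?m = "\<lambda>z. [:- z, 1:] :: complex poly"
  let ?r = "\<lambda>z. [:T, - cnj z:] :: complex poly"
  have dm: "degree (?m z * p) = Suc (degree p)" if "p \<noteq> 0" for z p
    using that by (simp add: degree_mult_eq del: mult_pCons_left)
  have dr: "degree (?r z * p) \<le> Suc (degree p)" for z p
    by (rule order.trans[OF degree_mult_le]) simp
  have nz: "?m z * p \<noteq> 0" if "p \<noteq> 0" for z p
    using that by (metis mult_eq_0_iff pCons_eq_0_iff zero_neq_one)
  have degF: "degree F = Suc (Suc (Suc (Suc (degree g))))"
    unfolding F using False by (simp add: dm nz del: mult_pCons_left)
  \<comment> \<open>The cofactors of the successive reflections. Multiplying \<open>G1\<close> by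
    its reflected factor gives the same polynomial as multiplying \<open>G2\<close> by the next
    factor still to be reflected, and likewise for the others, so the four norm identities can be
    chained.\<close>
  define G1 where "G1 = ?m a * (?m (cnj a) * (?m (cnj a) * g))"
  define G2 where "G2 = ?m (cnj a) * (?m (cnj a) * (?r a * g))"
  define G3 where "G3 = ?m (cnj a) * (?r a * (?r a * g))"
  define G4 where "G4 = ?r (cnj a) * (?r a * (?r a * g))"
  have d: "degree (?r a * g) \<le> Suc (degree g)" "degree (?r a * (?r a * g)) \<le> Suc (Suc (degree g))"
    "degree (?r (cnj a) * (?r a * (?r a * g))) \<le> Suc (Suc (Suc (degree g)))"
    by (meson dr order.trans Suc_le_mono)+
  have mle: "degree (?m z * p) \<le> Suc (degree p)" for z p
    by (rule order.trans[OF degree_mult_le]) simp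
  have w1: "weighted_norm2 n T (?r a * G1) = T * weighted_norm2 n T F"
    unfolding F G1_def
    by (rule weighted_norm2_reflect) (use n degF False in \<open>simp add: dm nz del: mult_pCons_left\<close>)
  have "?r a * G1 = ?m a * G2"
    unfolding G1_def G2_def by (simp only: mult.left_commute)
  moreover have "degree G2 < n"
  proof -
    have "degree G2 \<le> Suc (Suc (degree (?r a * g)))"
      unfolding G2_def by (meson mle order.trans Suc_le_mono)
    then show ?thesis using d n degF by linarith
  qed
  ultimately have w2: "weighted_norm2 n T (?r a * G2) = T^2 * weighted_norm2 n T F"
    using weighted_norm2_reflect[of G2 n T a] w1 by (simp add: power2_eq_square del: mult_pCons_left)
  have "?r a * G2 = ?m (cnj a) * G3"
    unfolding G3_def G2_def by (simp only: mult.left_commute)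
  moreover have "degree G3 < n"
  proof -
    have "degree G3 \<le> Suc (degree (?r a * (?r a * g)))"
      unfolding G3_def by (meson mle order.trans Suc_le_mono)
    then show ?thesis using d n degF by linarith
  qed
  ultimately have w3: "weighted_norm2 n T (?r (cnj a) * G3) = T^3 * weighted_norm2 n T F"
    using weighted_norm2_reflect[of G3 n T "cnj a"] w2
    by (simp add: power2_eq_square power3_eq_cube del: mult_pCons_left)
  have "?r (cnj a) * G3 = ?m (cnj a) * G4"
    unfolding G3_def G4_def by (simp only: mult.left_commute)
  moreover have "degree G4 < n"
    using d n degF unfolding G4_def by linarith
  ultimately have w4: "weighted_norm2 n T (?r (cnj a) * G4) = T^4 * weighted_norm2 n T F"
    using weighted_norm2_reflect[of G4 n T "cnj a"] w3
    by (simp add: power3_eq_cube numeral_eq_Suc del: mult_pCons_left)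
  \<comment> \<open>Only the constant coefficient is kept. After the four reflections it is
    \<open>T^4 * coeff g 0\<close>, whereas the constant coefficient of \<open>F\<close> has modulus
    \<open>|a|^4 * |coeff g 0|\<close>; the quotient of the two is the gain.\<close>
  have "(cmod (coeff (?r (cnj a) * G4) 0))\<^sup>2 * T ^ 0 \<le> weighted_norm2 n T (?r (cnj a) * G4)"
    unfolding weighted_norm2_def
    by (rule member_le_sum) (use T in auto)
  also have "coeff (?r (cnj a) * G4) 0 = T ^ 4 * coeff g 0"
    unfolding G4_def by (simp add: mult_ac numeral_eq_Suc)
  finally have "T ^ 4 * (T ^ 4 * (cmod (coeff g 0))\<^sup>2) \<le> T ^ 4 * weighted_norm2 n T F"
    using T by (simp only: w4) (simp add: norm_mult norm_power power2_eq_square mult_ac)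
  then have "T ^ 4 * (cmod (coeff g 0))\<^sup>2 \<le> weighted_norm2 n T F"
    using T by (simp only: mult_le_cancel_left_pos zero_less_power)
  moreover have "coeff F 0 = a * (a * (cnj a * (cnj a * coeff g 0)))"
    unfolding F by (simp add: mult_ac)
  then have "cmod (coeff F 0) = cmod a ^ 4 * cmod (coeff g 0)"
    by (simp add: norm_mult numeral_eq_Suc mult_ac)
  then have "(cmod (coeff F 0))\<^sup>2 = cmod a ^ 8 * (cmod (coeff g 0))\<^sup>2"
    by (simp add: power_mult_distrib flip: power_mult)
  ultimately show ?thesis
    using mult_left_mono[of "T ^ 4 * (cmod (coeff g 0))\<^sup>2" "weighted_norm2 n T F" "cmod a ^ 8"]
    by (simp add: mult.left_commute)
qed

section \<open>Approximate double zeros of polynomials with coefficients -1, 0, 1\<close>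

lemma sign_quotients_cnj:
  assumes "f \<in> sign_quotients"
  shows "cnj (poly f z) = poly f (cnj z)" "cnj (poly (pderiv f) z) = poly (pderiv f) (cnj z)"
proof -
  have *: "cnj (coeff f i) = coeff f i" for i
    using assms unfolding sign_quotients_def by (auto dest!: spec[of _ i])
  show "cnj (poly f z) = poly f (cnj z)"
    by (simp add: poly_altdef *)
  show "cnj (poly (pderiv f) z) = poly (pderiv f) (cnj z)"
    by (simp add: poly_altdef coeff_pderiv *)
qed

text \<open>Newton's form of Hermite interpolation at the nodes \<open>a, a, b, b\<close>, by four
  synthetic divisions. It allows approximate double zeros: the last two equations can be solved for
  \<open>c2\<close> and \<open>c3\<close> once \<open>b - a\<close> is bounded away from 0, so small
  data give a small remainder.\<close>

lemma hermite_division: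
  fixes f :: "complex poly"
  obtains g c0 c1 c2 c3 where
    "f = [:-a, 1:] * ([:-a, 1:] * ([:-b, 1:] * ([:-b, 1:] * g)))
       + ([:c0:] + [:-a, 1:] * ([:c1:] + [:-a, 1:] * ([:c2:] + [:-b, 1:] * [:c3:])))"
    "poly f a = c0" "poly (pderiv f) a = c1"
    "poly f b = c0 + c1 * (b - a) + c2 * (b - a)\<^sup>2"
    "poly (pderiv f) b = c1 + 2 * c2 * (b - a) + c3 * (b - a)\<^sup>2"
proof -
  have sd: "\<exists>q c. p = [:c:] + [:-x, 1:] * q" for p :: "complex poly" and x
    using synthetic_div_correct'[of x p] by (metis add.commute)
  obtain f1 c0 where f1: "f = [:c0:] + [:-a, 1:] * f1" using sd by blast
  obtain f2 c1 where f2: "f1 = [:c1:] + [:-a, 1:] * f2" using sd by blast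
  obtain f3 c2 where f3: "f2 = [:c2:] + [:-b, 1:] * f3" using sd by blast
  obtain g c3 where g: "f3 = [:c3:] + [:-b, 1:] * g" using sd by blast
  have "f = [:-a, 1:] * ([:-a, 1:] * ([:-b, 1:] * ([:-b, 1:] * g)))
       + ([:c0:] + [:-a, 1:] * ([:c1:] + [:-a, 1:] * ([:c2:] + [:-b, 1:] * [:c3:])))"
    unfolding f1 f2 f3 g by (simp only: algebra_simps)
  moreover have val: "poly p z = c + (z - x) * poly q z"
    and der: "poly (pderiv p) z = poly q z + (z - x) * poly (pderiv q) z"
    if "p = [:c:] + [:-x, 1:] * q" for p q :: "complex poly" and c x z
    unfolding that
    by (simp add: algebra_simps)
       (simp only: pderiv_add pderiv_mult pderiv_pCons, simp add: pderiv_pCons algebra_simps)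
  note v = val[OF f1] val[OF f2] val[OF f3] val[OF g] der[OF f1] der[OF f2] der[OF f3] der[OF g]
  have "poly f a = c0" "poly (pderiv f) a = c1"
    "poly f b = c0 + c1 * (b - a) + c2 * (b - a)\<^sup>2"
    "poly (pderiv f) b = c1 + 2 * c2 * (b - a) + c3 * (b - a)\<^sup>2"
    by (simp_all add: v power2_eq_square algebra_simps)
  ultimately show ?thesis using that by blast
qed

lemma weighted_norm2_le:
  assumes "\<And>i. cmod (coeff p i) \<le> B" "0 \<le> T" "T < 1"
  shows "weighted_norm2 n T p \<le> B\<^sup>2 / (1 - T)"
proof -
  have "weighted_norm2 n T p \<le> (\<Sum>i\<le>n. B\<^sup>2 * T ^ i)"
    unfolding weighted_norm2_def using assms
    by (intro sum_mono mult_right_mono power_mono) auto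
  also have "\<dots> = B\<^sup>2 * (\<Sum>i\<le>n. T ^ i)"
    by (simp add: sum_distrib_left)
  also have "(\<Sum>i\<le>n. T ^ i) \<le> 1 / (1 - T)"
  proof -
    have "(1 - T) * (\<Sum>i\<le>n. T ^ i) \<le> 1"
      using sum_gp_basic[of T n] assms by simp
    then show ?thesis using assms by (simp add: pos_le_divide_eq mult.commute)
  qed
  finally show ?thesis by (simp add: mult_left_mono)
qed

text \<open>Subtracting the Hermite remainder at \<open>a\<close> and \<open>cnj a\<close> changes
  each coefficient of \<open>f\<close> by at most \<open>C * d\<close> and leaves a polynomial with
  genuine double zeros, to which the Jensen inequality applies. The value 4/5 maximizes
  \<open>T^4 * (1 - T)\<close>, and 5 is \<open>1 / (1 - T)\<close>. For \<open>d = 0\<close> the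
  conclusion reads \<open>|a|^8 \<ge> 4^4 / 5^5\<close>, and the right-hand side is the eighth power
  of the critical radius. The bound \<gamma> keeps the two nodes apart.\<close>

lemma double_zero_defect:
  assumes f: "f \<in> sign_quotients"
    and im: "0 < \<gamma>" "\<gamma> \<le> \<bar>Im a\<bar>" and a1: "cmod a \<le> 1"
    and small: "cmod (poly f a) \<le> d" "cmod (poly (pderiv f) a) \<le> d"
    and Cd: "C = 16 * (1 + 4 / (\<gamma>\<^sup>2) + (2 + 16 / \<gamma>\<^sup>2) / \<gamma>\<^sup>2)" "C * d \<le> 1"
  shows "(4/5) ^ 4 * (1 - C * d)\<^sup>2 \<le> (cmod a) ^ 8 * (5 * (1 + C * d)\<^sup>2)"
proof -
  obtain g c0 c1 c2 c3 where
    eq: "f = [:-a, 1:] * ([:-a, 1:] * ([:-cnj a, 1:] * ([:-cnj a, 1:] * g)))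
       + ([:c0:] + [:-a, 1:] * ([:c1:] + [:-a, 1:] * ([:c2:] + [:-cnj a, 1:] * [:c3:])))"
    and c: "poly f a = c0" "poly (pderiv f) a = c1"
    "poly f (cnj a) = c0 + c1 * (cnj a - a) + c2 * (cnj a - a)\<^sup>2"
    "poly (pderiv f) (cnj a) = c1 + 2 * c2 * (cnj a - a) + c3 * (cnj a - a)\<^sup>2"
    using hermite_division[of f a "cnj a"] by metis
  define F where "F = [:-a, 1:] * ([:-a, 1:] * ([:-cnj a, 1:] * ([:-cnj a, 1:] * g)))"
  define q where "q = [:c0:] + [:-a, 1:] * ([:c1:] + [:-a, 1:] * ([:c2:] + [:-cnj a, 1:] * [:c3:]))"
  have fF: "F = f - q" using eq F_def q_def by simp
  have d0: "0 \<le> d" using small(1) norm_ge_zero order.trans by blast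
  have dist: "cmod (cnj a - a) \<le> 2"
    using norm_triangle_ineq4[of "cnj a" a] a1 by simp
  have "cmod (cnj a - a) = 2 * \<bar>Im a\<bar>"
    by (simp add: cmod_def real_sqrt_mult)
  then have low: "\<gamma> \<le> cmod (cnj a - a)" using im by linarith
  then have low2: "\<gamma>\<^sup>2 \<le> cmod ((cnj a - a)\<^sup>2)" using im by (simp add: norm_power)
  have nz: "cnj a - a \<noteq> 0" using low im by auto
  have c0: "cmod c0 \<le> d" and c1: "cmod c1 \<le> d" using c small by auto
  have fc: "cmod (poly f (cnj a)) \<le> d" "cmod (poly (pderiv f) (cnj a)) \<le> d"
    using sign_quotients_cnj[OF f, of a] small by (metis complex_mod_cnj)+
  have "cmod (poly f (cnj a) - c0 - c1 * (cnj a - a)) \<le> d + d + d * 2"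
    by (intro order.trans[OF norm_triangle_ineq4] add_mono fc c0)
       (use c1 dist d0 in \<open>simp add: norm_mult mult_mono\<close>)
  moreover have "poly f (cnj a) - c0 - c1 * (cnj a - a) = c2 * (cnj a - a)\<^sup>2"
    using c by simp
  ultimately have "cmod c2 * cmod ((cnj a - a)\<^sup>2) \<le> 4 * d"
    by (simp add: norm_mult)
  then have "cmod c2 * \<gamma>\<^sup>2 \<le> 4 * d"
    using low2 mult_left_mono[OF low2, of "cmod c2"] by simp
  then have c2: "cmod c2 \<le> 4 / \<gamma>\<^sup>2 * d"
    using im by (simp add: field_simps)
  have "cmod (poly (pderiv f) (cnj a) - c1 - 2 * c2 * (cnj a - a)) \<le> d + d + 2 * (4 / \<gamma>\<^sup>2 * d) * 2"
    by (intro order.trans[OF norm_triangle_ineq4] add_mono fc c1)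
       (simp only: norm_mult, intro mult_mono c2 dist, use d0 in auto)
  moreover have "poly (pderiv f) (cnj a) - c1 - 2 * c2 * (cnj a - a) = c3 * (cnj a - a)\<^sup>2"
    using c by simp
  ultimately have "cmod c3 * cmod ((cnj a - a)\<^sup>2) \<le> (2 + 16 / \<gamma>\<^sup>2) * d"
    by (simp add: norm_mult algebra_simps)
  then have "cmod c3 * \<gamma>\<^sup>2 \<le> (2 + 16 / \<gamma>\<^sup>2) * d"
    using low2 mult_left_mono[OF low2, of "cmod c3"] by simp
  then have c3: "cmod c3 \<le> (2 + 16 / \<gamma>\<^sup>2) / \<gamma>\<^sup>2 * d"
    using im by (simp add: field_simps)
  \<comment> \<open>A common bound for the four Newton coefficients. Multiplying out the linear
    factors, whose roots have modulus at most 1, costs \<open>1 + 2 * (1 + 2 * 2) = 11\<close>,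
    which the 16 in \<open>C\<close> absorbs.\<close>
  define m where "m = C * d / 16"
  have m: "cmod c0 \<le> m" "cmod c1 \<le> m" "cmod c2 \<le> m" "cmod c3 \<le> m"
  proof -
    have "m = d + (4 / \<gamma>\<^sup>2 * d + (2 + 16 / \<gamma>\<^sup>2) / \<gamma>\<^sup>2 * d)"
      unfolding m_def Cd(1) by (simp add: algebra_simps)
    moreover have "0 \<le> 4 / \<gamma>\<^sup>2 * d" "0 \<le> (2 + 16 / \<gamma>\<^sup>2) / \<gamma>\<^sup>2 * d"
      using d0 by auto
    ultimately have "d \<le> m" "4 / \<gamma>\<^sup>2 * d \<le> m" "(2 + 16 / \<gamma>\<^sup>2) / \<gamma>\<^sup>2 * d \<le> m"
      using d0 by (simp_all only: le_add_same_cancel1 add_nonneg_nonneg add_increasing add_increasing2 order_refl)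
    then show "cmod c0 \<le> m" "cmod c1 \<le> m" "cmod c2 \<le> m" "cmod c3 \<le> m"
      using c0 c1 c2 c3 order.trans by blast+
  qed
  have step: "cmod (coeff ([:e:] + [:-x, 1:] * p) i) \<le> m + 2 * B"
    if "\<And>i. cmod (coeff p i) \<le> B" "cmod x \<le> 1" "cmod e \<le> m" for p e x i B
  proof -
    have B: "0 \<le> B" using that(1)[of 0] norm_ge_zero order.trans by blast
    have *: "cmod (x * coeff p i) \<le> B" for i
      using mult_mono[OF that(2) that(1)[of i]] B by (simp add: norm_mult)
    show ?thesis
    proof (cases i)
      case 0
      have "cmod (e - x * coeff p 0) \<le> m + B"
        by (rule order.trans[OF norm_triangle_ineq4]) (use *[of 0] that(3) in linarith)
      then show ?thesis using 0 B by simp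
    next
      case (Suc j)
      have "cmod (coeff p j - x * coeff p i) \<le> B + B"
        by (rule order.trans[OF norm_triangle_ineq4]) (use *[of i] that(1)[of j] in linarith)
      moreover have "0 \<le> m" using m(1) norm_ge_zero order.trans by blast
      ultimately show ?thesis using Suc by simp
    qed
  qed
  have m0: "0 \<le> m" using m(1) norm_ge_zero order.trans by blast
  have q3: "cmod (coeff [:c3:] i) \<le> m" for i
    using m m0 by (cases i) auto
  have "cmod (coeff ([:c2:] + [:-cnj a, 1:] * [:c3:]) i) \<le> 2 * m" for i
  proof (cases i)
    case 0
    have "cmod (c2 - cnj a * c3) \<le> m + m"
      by (intro order.trans[OF norm_triangle_ineq4] add_mono m)
         (use m(4) a1 mult_mono[OF a1 m(4)] in \<open>simp add: norm_mult\<close>)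
    then show ?thesis using 0 by (simp add: mult.commute)
  next
    case (Suc j) then show ?thesis using m m0 by (cases j) auto
  qed
  note q2 = this
  have q1: "cmod (coeff ([:c1:] + [:-a, 1:] * ([:c2:] + [:-cnj a, 1:] * [:c3:])) i) \<le> m + 2 * (2 * m)" for i
    by (rule step[OF q2]) (use a1 m in auto)
  have "cmod (coeff q i) \<le> m + 2 * (m + 2 * (2 * m))" for i
    unfolding q_def by (rule step[OF q1]) (use a1 m in auto)
  then have q: "cmod (coeff q i) \<le> 11 * m" for i by simp
  have Cd0: "0 \<le> C * d" and mC: "11 * m \<le> C * d"
    using m0 by (simp_all add: m_def)
  have fi: "cmod (coeff f i) \<le> 1" and f0: "cmod (coeff f 0) = 1" for i
    using f unfolding sign_quotients_def by (auto dest!: spec[of _ i])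
  have Fi: "cmod (coeff F i) \<le> 1 + C * d" for i
    unfolding fF coeff_diff using norm_triangle_ineq4[of "coeff f i" "coeff q i"] fi[of i] q[of i] mC
    by linarith
  have "1 - C * d \<le> cmod (coeff F 0)"
    unfolding fF coeff_diff using norm_triangle_ineq2[of "coeff f 0" "coeff q 0"] f0 q[of 0] mC
    by linarith
  then have "(4/5) ^ 4 * (1 - C * d)\<^sup>2 \<le> (4/5) ^ 4 * (cmod (coeff F 0))\<^sup>2"
    using Cd(2) by (intro mult_left_mono power_mono) auto
  also have "\<dots> \<le> (cmod a) ^ 8 * weighted_norm2 (Suc (degree F)) (4/5) F"
    using jensen_double_conjugate_zeros[of "4/5" a F g "Suc (degree F)"] F_def im by fastforce
  also have "\<dots> \<le> (cmod a) ^ 8 * ((1 + C * d)\<^sup>2 / (1 - 4/5))"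
    by (intro mult_left_mono weighted_norm2_le Fi) auto
  finally show ?thesis by simp
qed

text \<open>At defect \<open>0\<close> and any radius \<open>R\<close> below the critical one the
  inequality of \<open>double_zero_defect\<close> is strictly violated, and by continuity in the
  defect it stays violated for a small positive one. No limit over \<open>f\<close> is taken, so
  \<delta> comes from \<open>z0\<close> alone, uniformly in the degree.\<close>

lemma transversality:
  assumes im: "Im z0 \<noteq> 0" and z0: "cmod z0 < 2 * 5 powr (-5/8)"
  obtains \<eta> \<delta> where "0 < \<eta>" "0 < \<delta>"
    "\<And>z f. cmod (z - z0) < \<eta> \<Longrightarrow> f \<in> sign_quotients \<Longrightarrow> cmod (poly f z) < \<delta> \<Longrightarrow>
      \<delta> < cmod (poly (pderiv f) z)"
proof -
  define crit :: real where "crit = 2 * 5 powr (-5/8)"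
  have crit8: "crit ^ 8 = 256 / 5 ^ 5"
  proof -
    have "((5::real) powr (-5/8)) ^ 8 = 5 powr (-5)"
      by (simp add: powr_power)
    also have "\<dots> = 1 / 5 ^ 5"
      by (simp add: powr_minus_divide flip: powr_numeral)
    finally show ?thesis
      unfolding crit_def by (simp add: power_mult_distrib)
  qed
  have crit0: "0 < crit" by (simp add: crit_def)
  have crit1: "crit < 1"
  proof (rule ccontr)
    assume "\<not> crit < 1"
    then have "1 \<le> crit ^ 8" by (simp add: one_le_power)
    then show False by (simp add: crit8)
  qed
  define R where "R = (cmod z0 + crit) / 2"
  have R: "cmod z0 < R" "R < crit" "0 < R"
    using z0 crit0 add_pos_nonneg[OF crit0 norm_ge_zero[of z0]]
    unfolding R_def crit_def[symmetric] by (simp_all add: field_simps)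
  define \<gamma> where "\<gamma> = \<bar>Im z0\<bar> / 2"
  have \<gamma>: "0 < \<gamma>" using im by (simp add: \<gamma>_def)
  define \<eta> where "\<eta> = min \<gamma> (R - cmod z0)"
  have \<eta>: "0 < \<eta>" using \<gamma> R by (simp add: \<eta>_def)
  define C where "C = 16 * (1 + 4 / (\<gamma>\<^sup>2) + (2 + 16 / \<gamma>\<^sup>2) / \<gamma>\<^sup>2)"
  have C: "0 < C" unfolding C_def using \<gamma> by (intro mult_pos_pos add_pos_pos divide_pos_pos) auto
  have "((\<lambda>t. R ^ 8 * (5 * (1 + C * t)\<^sup>2) - (4/5) ^ 4 * (1 - C * t)\<^sup>2) \<longlongrightarrow>
      R ^ 8 * (5 * (1 + C * 0)\<^sup>2) - (4/5) ^ 4 * (1 - C * 0)\<^sup>2) (at_right 0)"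
    by (intro tendsto_intros)
  moreover have "R ^ 8 < crit ^ 8"
    using R by (intro power_strict_mono) auto
  then have "R ^ 8 * (5 * (1 + C * 0)\<^sup>2) - (4/5) ^ 4 * (1 - C * 0)\<^sup>2 < 0"
    by (simp add: crit8 field_simps)
  ultimately have "\<forall>\<^sub>F t in at_right 0. R ^ 8 * (5 * (1 + C * t)\<^sup>2) - (4/5) ^ 4 * (1 - C * t)\<^sup>2 < 0"
    by (rule order_tendstoD)
  moreover have "\<forall>\<^sub>F t in at_right 0. t < 1 / C"
    using C by (intro order_tendstoD(2)[OF tendsto_ident_at]) simp
  moreover have "\<forall>\<^sub>F t in at_right (0::real). 0 < t"
    by (simp add: eventually_at_right_less)
  ultimately have "\<forall>\<^sub>F t in at_right 0. 0 < t \<and> t < 1 / C \<and>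
      R ^ 8 * (5 * (1 + C * t)\<^sup>2) - (4/5) ^ 4 * (1 - C * t)\<^sup>2 < 0"
    by eventually_elim auto
  then obtain d where d: "0 < d" "d < 1 / C"
    "R ^ 8 * (5 * (1 + C * d)\<^sup>2) - (4/5) ^ 4 * (1 - C * d)\<^sup>2 < 0"
    by (auto dest!: eventually_happens)
  have "d < cmod (poly (pderiv f) z)"
    if z: "cmod (z - z0) < \<eta>" and f: "f \<in> sign_quotients" and small: "cmod (poly f z) < d" for z f
  proof (rule ccontr)
    assume n: "\<not> d < cmod (poly (pderiv f) z)"
    have zR: "cmod z \<le> R"
      using z norm_triangle_ineq2[of z z0] unfolding \<eta>_def by linarith
    have "\<bar>Im z - Im z0\<bar> \<le> cmod (z - z0)"
      using abs_Im_le_cmod[of "z - z0"] by simp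
    then have "\<gamma> \<le> \<bar>Im z\<bar>"
      using z unfolding \<eta>_def \<gamma>_def by linarith
    then have "(4/5) ^ 4 * (1 - C * d)\<^sup>2 \<le> (cmod z) ^ 8 * (5 * (1 + C * d)\<^sup>2)"
    proof (rule double_zero_defect[OF f \<gamma> _ _ _ _ C_def])
      show "C * d \<le> 1" using d C by (simp add: field_simps)
    qed (use zR R crit1 small n in auto)
    also have "\<dots> \<le> R ^ 8 * (5 * (1 + C * d)\<^sup>2)"
      using zR by (intro mult_right_mono power_mono) auto
    finally show False using d by simp
  qed
  then show ?thesis using that \<eta> d by blast
qed

section \<open>Hausdorff measure\<close>

lemma hausdorff_content_mono:
  assumes "E \<subseteq> F"
  shows "hausdorff_content s \<delta> E \<le> hausdorff_content s \<delta> F"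
  unfolding hausdorff_content_def by (rule INF_superset_mono) (use assms in auto)

lemma hausdorff_content_le_diameter:
  assumes "bounded Q" "diameter Q \<le> \<delta>" "0 \<le> \<delta>"
  shows "hausdorff_content s \<delta> Q \<le> ennreal (diameter Q powr s)"
proof -
  \<comment> \<open>Covers are infinite sequences, so \<open>Q\<close> is padded with empty sets.
    They cost nothing: \<open>diameter {} = 0\<close> and \<open>0 powr s = 0\<close>, even for
    \<open>s = 0\<close>.\<close>
  define U where "U = (\<lambda>i::nat. if i = 0 then Q else {})"
  have "hausdorff_content s \<delta> Q \<le> (\<Sum>i. ennreal (diameter (U i) powr s))"
    unfolding hausdorff_content_def
    by (rule INF_lower) (use assms in \<open>auto simp: U_def split: if_splits\<close>)
  also have "\<dots> = (\<Sum>i\<in>{0}. ennreal (diameter (U i) powr s))"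
    by (rule suminf_finite) (auto simp: U_def)
  finally show ?thesis by (simp add: U_def)
qed

lemma hausdorff_content_UN_le:
  fixes E :: "nat \<Rightarrow> 'a::metric_space set"
  shows "hausdorff_content s \<delta> (\<Union>i. E i) \<le> (\<Sum>i. hausdorff_content s \<delta> (E i))"
proof (rule ennreal_le_epsilon)
  fix e :: real
  assume sum: "(\<Sum>i. hausdorff_content s \<delta> (E i)) < top" and e: "0 < e"
  have fin: "hausdorff_content s \<delta> (E i) < top" for i
    by (rule ennreal_suminf_lessD[OF sum])
  define P where "P i U \<longleftrightarrow> E i \<subseteq> (\<Union>k. U k) \<and> (\<forall>k. bounded (U k) \<and> diameter (U k) \<le> \<delta>) \<and>
     (\<Sum>k. ennreal (diameter (U k) powr s)) \<le> hausdorff_content s \<delta> (E i) + ennreal (e * (1/2) ^ Suc i)"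
    for i and U :: "nat \<Rightarrow> 'a set"
  have "\<exists>U. P i U" for i
  proof -
    have "hausdorff_content s \<delta> (E i) < hausdorff_content s \<delta> (E i) + ennreal (e * (1/2) ^ Suc i)"
      using fin[of i] e
      by (cases "hausdorff_content s \<delta> (E i)") (auto simp flip: ennreal_plus intro!: ennreal_lessI add_nonneg_pos)
    then obtain U where "E i \<subseteq> (\<Union>k. U k) \<and> (\<forall>k. bounded (U k) \<and> diameter (U k) \<le> \<delta>)"
      "(\<Sum>k. ennreal (diameter (U k) powr s)) < hausdorff_content s \<delta> (E i) + ennreal (e * (1/2) ^ Suc i)"
      unfolding hausdorff_content_def[of s \<delta> "E i"] INF_less_iff by blast
    then show ?thesis unfolding P_def using less_imp_le by blast
  qed
  then obtain U where "\<And>i. P i (U i)" by metis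
  then have U: "E i \<subseteq> (\<Union>k. U i k)" "bounded (U i k)" "diameter (U i k) \<le> \<delta>"
    "(\<Sum>k. ennreal (diameter (U i k) powr s)) \<le> hausdorff_content s \<delta> (E i) + ennreal (e * (1/2) ^ Suc i)"
    for i k
    unfolding P_def by simp_all
  define V where "V = (\<lambda>n. case prod_decode n of (i, k) \<Rightarrow> U i k)"
  have "hausdorff_content s \<delta> (\<Union>i. E i) \<le> (\<Sum>n. ennreal (diameter (V n) powr s))"
    unfolding hausdorff_content_def
  proof (rule INF_lower, clarify, intro conjI allI)
    show "(\<Union>i. E i) \<subseteq> (\<Union>n. V n)"
    proof
      fix x assume "x \<in> (\<Union>i. E i)"
      then obtain i k where "x \<in> U i k" using U(1) by blast
      then have "x \<in> V (prod_encode (i, k))" by (simp add: V_def)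
      then show "x \<in> (\<Union>n. V n)" by blast
    qed
  qed (auto simp: V_def U split: prod.splits)
  also have "\<dots> = (\<Sum>i. \<Sum>k. ennreal (diameter (U i k) powr s))"
  proof -
    have "(\<Sum>n. (\<lambda>(i, k). ennreal (diameter (U i k) powr s)) (prod_decode n))
        = (\<Sum>i. \<Sum>k. ennreal (diameter (U i k) powr s))"
      by (rule suminf_ennreal_2dimen) simp
    then show ?thesis by (simp add: V_def case_prod_unfold)
  qed
  also have "\<dots> \<le> (\<Sum>i. hausdorff_content s \<delta> (E i) + ennreal (e * (1/2) ^ Suc i))"
    by (rule suminf_le[OF U(4)]) auto
  also have "\<dots> = (\<Sum>i. hausdorff_content s \<delta> (E i)) + (\<Sum>i. ennreal (e * (1/2) ^ Suc i))"
    by (intro suminf_add[symmetric]) auto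
  also have "(\<Sum>i. ennreal (e * (1/2) ^ Suc i)) = ennreal e"
    using e sums_mult[OF power_half_series, of e]
    by (intro suminf_ennreal_eq) auto
  finally show "hausdorff_content s \<delta> (\<Union>i. E i) \<le> (\<Sum>i. hausdorff_content s \<delta> (E i)) + ennreal e" .
qed

lemma hausdorff_content_empty: "0 \<le> \<delta> \<Longrightarrow> hausdorff_content s \<delta> {} = 0"
  using hausdorff_content_le_diameter[of "{}" \<delta> s] by simp

lemma hausdorff_content_UN_finite_le:
  assumes "finite I" "0 \<le> \<delta>"
  shows "hausdorff_content s \<delta> (\<Union>i\<in>I. E i) \<le> (\<Sum>i\<in>I. hausdorff_content s \<delta> (E i))"
proof -
  obtain g :: "nat \<Rightarrow> 'a" where g: "bij_betw g {..<card I} I"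
    using ex_bij_betw_nat_finite[OF assms(1)] by (auto simp: atLeast0LessThan)
  define F where "F = (\<lambda>k. if k < card I then E (g k) else {})"
  have "(\<Union>i\<in>I. E i) = (\<Union>k. F k)"
  proof (intro equalityI UN_least)
    fix i assume "i \<in> I"
    then obtain k where "k < card I" "g k = i"
      using bij_betw_imp_surj_on[OF g] by (metis imageE lessThan_iff)
    then show "E i \<subseteq> (\<Union>k. F k)" by (auto simp: F_def intro!: exI[of _ k])
  qed (use bij_betw_apply[OF g] in \<open>auto simp: F_def\<close>)
  then have "hausdorff_content s \<delta> (\<Union>i\<in>I. E i) \<le> (\<Sum>k. hausdorff_content s \<delta> (F k))"
    using hausdorff_content_UN_le by metis
  also have "\<dots> = (\<Sum>k<card I. hausdorff_content s \<delta> (F k))"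
    by (rule suminf_finite) (auto simp: F_def hausdorff_content_empty assms)
  also have "\<dots> = (\<Sum>i\<in>I. hausdorff_content s \<delta> (E i))"
    using sum.reindex_bij_betw[OF g, of "\<lambda>i. hausdorff_content s \<delta> (E i)"] by (simp add: F_def)
  finally show ?thesis .
qed

lemma hausdorff_measure_eq_0_iff:
  "hausdorff_measure s E = 0 \<longleftrightarrow> (\<forall>\<delta>>0. hausdorff_content s \<delta> E = 0)"
  unfolding hausdorff_measure_def
  using SUP_bot_conv(1)[of "\<lambda>\<delta>. hausdorff_content s \<delta> E" "{0<..}"] by (auto simp: bot_ennreal)

lemma hausdorff_null_subset:
  "hausdorff_measure s F = 0 \<Longrightarrow> E \<subseteq> F \<Longrightarrow> hausdorff_measure s E = 0"
  unfolding hausdorff_measure_eq_0_iff using hausdorff_content_mono by (metis le_zero_eq)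

lemma hausdorff_null_UN:
  fixes E :: "'i \<Rightarrow> 'a::metric_space set"
  assumes "countable I" "\<And>i. i \<in> I \<Longrightarrow> hausdorff_measure s (E i) = 0"
  shows "hausdorff_measure s (\<Union>i\<in>I. E i) = 0"
proof -
  have null: "hausdorff_measure s (\<Union>n. F n) = 0" if "\<And>n. hausdorff_measure s (F n) = 0"
    for F :: "nat \<Rightarrow> 'a set"
    unfolding hausdorff_measure_eq_0_iff
  proof (intro allI impI)
    fix \<delta> :: real assume "0 < \<delta>"
    with that have "hausdorff_content s \<delta> (F n) = 0" for n
      unfolding hausdorff_measure_eq_0_iff by blast
    with hausdorff_content_UN_le[of s \<delta> F] show "hausdorff_content s \<delta> (\<Union>n. F n) = 0" by simp
  qed
  have "hausdorff_measure s {} = 0"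
    by (simp add: hausdorff_measure_eq_0_iff hausdorff_content_empty)
  moreover have "(\<Union>n. E (from_nat_into I n)) = (\<Union>i\<in>I. E i)" if "I \<noteq> {}"
    using range_from_nat_into[OF that assms(1)] by (metis image_image)
  ultimately show ?thesis
    using null[of "\<lambda>n. E (from_nat_into I n)"] assms
    by (cases "I = {}") (simp_all add: from_nat_into)
qed

lemma hausdorff_dim_le:
  assumes "\<And>s. t < s \<Longrightarrow> hausdorff_measure s E = 0" "0 \<le> t"
  shows "hausdorff_dim E \<le> ereal t"
proof (rule ereal_le_epsilon2)
  fix e :: real assume "0 < e"
  then have "hausdorff_dim E \<le> ereal (t + e)"
    unfolding hausdorff_dim_def using assms by (intro Inf_lower) auto
  then show "hausdorff_dim E \<le> ereal t + ereal e" by simp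
qed

text \<open>The set covered infinitely often by families of \<open>O(x\<^sup>j)\<close> sets of diameter \<open>O(2\<^sup>-\<^sup>j)\<close>
  is null in every dimension \<open>s > log\<^sub>2 x\<close>.\<close>

lemma hausdorff_null_limsup:
  fixes Q :: "nat \<Rightarrow> 'a::metric_space set set"
  assumes cov: "\<And>x. x \<in> E \<Longrightarrow> \<exists>\<^sub>\<infinity>j. x \<in> \<Union>(Q j)"
    and Q: "\<And>j A. J \<le> j \<Longrightarrow> A \<in> Q j \<Longrightarrow> bounded A \<and> diameter A \<le> D * (1/2) ^ j"
    and fin: "\<And>j. J \<le> j \<Longrightarrow> finite (Q j)"
    and card: "\<And>j. J \<le> j \<Longrightarrow> real (card (Q j)) \<le> C * x ^ j"
    and s: "0 < s" "x < 2 powr s" "0 \<le> x" "0 < D"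
  shows "hausdorff_measure s E = 0"
  unfolding hausdorff_measure_eq_0_iff
proof (intro allI impI)
  fix \<delta> :: real assume \<delta>: "0 < \<delta>"
  \<comment> \<open>At level \<open>j\<close> at most \<open>C * x ^ j\<close> sets cost
    \<open>(D * (1/2) ^ j) powr s\<close> each, a geometric sequence of ratio \<open>q\<close>; the
    condition \<open>x < 2 powr s\<close> is \<open>q < 1\<close>. Each tail of the levels covers
    \<open>E\<close>, and the cost of the tails tends to 0.\<close>
  define q where "q = x * (1/2) powr s"
  have half: "((1/2) ^ j) powr s = ((1/2::real) powr s) ^ j" for j :: nat
    by (simp add: powr_powr mult.commute flip: powr_realpow)
  have q: "0 \<le> q" "q < 1"
    using s by (auto simp: q_def powr_divide field_simps)
  have C: "0 \<le> C * x ^ j" if "J \<le> j" for j using card[OF that] by linarith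
  have "(\<lambda>j. D * (1/2::real) ^ j) \<longlonglongrightarrow> D * 0"
    by (intro tendsto_intros LIMSEQ_power_zero) auto
  then have "\<forall>\<^sub>F j in sequentially. D * (1/2) ^ j < \<delta>"
    using \<delta> by (intro order_tendstoD) auto
  then obtain J1 where J1: "\<And>j. J1 \<le> j \<Longrightarrow> D * (1/2) ^ j < \<delta>"
    unfolding eventually_sequentially by blast
  have bound: "hausdorff_content s \<delta> (\<Union>(Q j)) \<le> ennreal (C * D powr s * q ^ j)"
    if j: "max J J1 \<le> j" for j
  proof -
    have "hausdorff_content s \<delta> (\<Union>A\<in>Q j. A) \<le> (\<Sum>A\<in>Q j. hausdorff_content s \<delta> A)"
      using fin j \<delta> by (intro hausdorff_content_UN_finite_le) auto
    also have "\<dots> \<le> (\<Sum>A\<in>Q j. ennreal ((D * (1/2) ^ j) powr s))"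
    proof (rule sum_mono)
      fix A assume A: "A \<in> Q j"
      have "hausdorff_content s \<delta> A \<le> ennreal (diameter A powr s)"
        using Q[OF _ A] j J1[of j] \<delta> by (intro hausdorff_content_le_diameter) auto
      also have "\<dots> \<le> ennreal ((D * (1/2) ^ j) powr s)"
        using Q[OF _ A] j s by (intro ennreal_leI powr_mono2) (auto intro!: diameter_ge_0)
      finally show "hausdorff_content s \<delta> A \<le> ennreal ((D * (1/2) ^ j) powr s)" .
    qed
    also have "\<dots> = ennreal (card (Q j) * (D * (1/2) ^ j) powr s)"
      by (simp add: ennreal_mult' ennreal_of_nat_eq_real_of_nat)
    also have "\<dots> \<le> ennreal (C * x ^ j * (D * (1/2) ^ j) powr s)"
      using card j by (intro ennreal_leI mult_right_mono) auto
    also have "C * x ^ j * (D * (1/2) ^ j) powr s = C * D powr s * q ^ j"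
      using s by (simp add: q_def powr_mult half power_mult_distrib)
    finally show ?thesis by simp
  qed
  have "hausdorff_content s \<delta> E \<le> ennreal (C * D powr s * q ^ m / (1 - q))" if m: "max J J1 \<le> m" for m
  proof -
    have "E \<subseteq> (\<Union>i. \<Union>(Q (i + m)))"
    proof
      fix y assume "y \<in> E"
      then obtain j where "m \<le> j" "y \<in> \<Union>(Q j)"
        using cov unfolding INFM_nat_le by blast
      then show "y \<in> (\<Union>i. \<Union>(Q (i + m)))"
        by (metis UN_I UNIV_I le_add_diff_inverse2)
    qed
    then have "hausdorff_content s \<delta> E \<le> hausdorff_content s \<delta> (\<Union>i. \<Union>(Q (i + m)))"
      by (rule hausdorff_content_mono)
    also have "\<dots> \<le> (\<Sum>i. hausdorff_content s \<delta> (\<Union>(Q (i + m))))"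
      by (rule hausdorff_content_UN_le)
    also have "\<dots> \<le> (\<Sum>i. ennreal (C * D powr s * q ^ (i + m)))"
      by (rule suminf_le) (use bound m in auto)
    also have "\<dots> = ennreal (C * D powr s * q ^ m * (1 / (1 - q)))"
    proof (rule suminf_ennreal_eq)
      show "0 \<le> C * D powr s * q ^ (i + m)" for i
      proof -
        have "0 \<le> (C * x ^ (i + m)) * (D powr s * ((1/2) powr s) ^ (i + m))"
          using C[of "i + m"] m by (intro mult_nonneg_nonneg[of "C * x ^ (i + m)"]) auto
        then show ?thesis by (simp only: q_def power_mult_distrib mult_ac)
      qed
      show "(\<lambda>i. C * D powr s * q ^ (i + m)) sums (C * D powr s * q ^ m * (1 / (1 - q)))"
        using sums_mult[OF geometric_sums[of q], of "C * D powr s * q ^ m"] q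
        by (simp add: power_add mult_ac)
    qed
    finally show ?thesis by simp
  qed
  moreover have "(\<lambda>m. ennreal (C * D powr s * q ^ m / (1 - q))) \<longlonglongrightarrow> ennreal (C * D powr s * 0 / (1 - q))"
    using q by (intro tendsto_ennrealI tendsto_intros LIMSEQ_power_zero) auto
  ultimately have "hausdorff_content s \<delta> E \<le> ennreal (C * D powr s * 0 / (1 - q))"
    by (intro LIMSEQ_le_const) (auto simp del: ennreal_0 intro!: exI[of _ "max J J1"])
  then show "hausdorff_content s \<delta> E = 0" by simp
qed

text \<open>A set of diameter \<open>d\<close> lies in the disc of radius \<open>d\<close> about any
  of its points, whose area is at most \<open>4 d^2\<close>; hence cheap covers have small area. The
  null set is only required to contain \<open>E\<close>, because \<open>E\<close> need not be
  Borel.\<close>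

lemma hausdorff_2_null_imp_null_sets:
  fixes E :: "complex set"
  assumes "hausdorff_measure 2 E = 0"
  shows "\<exists>N \<in> null_sets lborel. E \<subseteq> N"
proof -
  have "\<exists>U. E \<subseteq> U \<and> U \<in> sets borel \<and> emeasure lborel U \<le> ennreal e" if e: "0 < e" for e :: real
  proof -
    have "hausdorff_content 2 1 E < ennreal (e / 4)"
      using assms e by (simp add: hausdorff_measure_eq_0_iff)
    then obtain U where U: "E \<subseteq> (\<Union>i. U i)" "\<And>i. bounded (U i)"
      "(\<Sum>i. ennreal (diameter (U i) powr 2)) < ennreal (e / 4)"
      unfolding hausdorff_content_def INF_less_iff by auto
    define d where "d i = diameter (U i)" for i
    have d0: "0 \<le> d i" for i using U(2) by (simp add: d_def diameter_ge_0)
    define V where "V i = (if U i = {} then {} else cball (SOME x. x \<in> U i) (d i))" for i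
    have UV: "U i \<subseteq> V i" for i
    proof (cases "U i = {}")
      case False
      then have "(SOME x. x \<in> U i) \<in> U i" by (simp add: some_in_eq)
      then show ?thesis
        using diameter_bounded_bound[OF U(2)[of i]] False by (auto simp: V_def d_def)
    qed (simp add: V_def)
    have "emeasure lborel (V i) \<le> ennreal 4 * ennreal (d i powr 2)" for i
    proof -
      have "emeasure lborel (cball z (d i)) = ennreal (pi * d i ^ 2)" for z :: complex
        using emeasure_cball[OF d0, of z i] by (simp add: unit_ball_vol_2)
      then have "emeasure lborel (V i) \<le> ennreal (pi * d i ^ 2)"
        by (simp add: V_def)
      also have "\<dots> \<le> ennreal (4 * d i ^ 2)"
        using pi_less_4 by (intro ennreal_leI mult_right_mono) auto
      finally show ?thesis using d0[of i] by (simp add: ennreal_mult' powr_numeral)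
    qed
    then have "emeasure lborel (\<Union>i. V i) \<le> (\<Sum>i. ennreal 4 * ennreal (d i powr 2))"
      by (intro order.trans[OF emeasure_subadditive_countably] suminf_le) (auto simp: V_def)
    also have "\<dots> = ennreal 4 * (\<Sum>i. ennreal (d i powr 2))"
      by simp
    also have "\<dots> \<le> ennreal 4 * ennreal (e / 4)"
      using U(3) unfolding d_def by (intro mult_left_mono) auto
    also have "\<dots> = ennreal (4 * (e / 4))"
      using e by (intro ennreal_mult'[symmetric]) simp
    also have "4 * (e / 4) = e" by simp
    finally show ?thesis
    proof (intro exI[of _ "\<Union>i. V i"] conjI)
      show "E \<subseteq> (\<Union>i. V i)" using U(1) UV by blast
    qed (auto simp: V_def)
  qed
  then have "\<exists>U. E \<subseteq> U \<and> U \<in> sets borel \<and> emeasure lborel U \<le> ennreal (1 / real (Suc n))" for n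
    by simp
  then obtain U where U: "\<And>n. E \<subseteq> U n" "\<And>n. U n \<in> sets borel"
    "\<And>n. emeasure lborel (U n) \<le> ennreal (1 / real (Suc n))"
    by metis
  have le: "emeasure lborel (\<Inter>n. U n) \<le> ennreal (1 / real (Suc n))" for n
    by (rule order.trans[OF emeasure_mono U(3)[of n]]) (use U in auto)
  have lim0: "(\<lambda>n. ennreal (1 / real (Suc n))) \<longlonglongrightarrow> ennreal 0"
    using LIMSEQ_inverse_real_of_nat by (intro tendsto_ennrealI) (simp add: inverse_eq_divide)
  have "emeasure lborel (\<Inter>n. U n) \<le> ennreal 0"
    by (rule LIMSEQ_le_const[OF lim0 exI[of _ 0]]) (use le in blast)
  then show ?thesis
    using U by (intro bexI[of _ "\<Inter>n. U n"]) (auto simp: null_sets_def)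
qed

lemma hausdorff_null_real_segment:
  assumes s: "1 < s"
  shows "hausdorff_measure s {z::complex. Im z = 0 \<and> cmod z < 1} = 0"
proof -
  define I where "I j m = {z::complex. Im z = 0 \<and> \<bar>Re z * 2 ^ j - real_of_int m\<bar> \<le> 1}" for j :: nat and m :: int
  define Q where "Q j = I j ` {- (2 ^ j)..2 ^ j}" for j
  have bd: "A \<subseteq> cball (complex_of_real (m / 2 ^ j)) ((1/2) ^ j)" if "A = I j m" for A j m
  proof
    fix z assume z: "z \<in> A"
    then have im: "Im z = 0" and le: "\<bar>Re z * 2 ^ j - real_of_int m\<bar> \<le> 1"
      using that by (auto simp: I_def)
    have "m / 2 ^ j - Re z = - ((Re z * 2 ^ j - m) / 2 ^ j)" by (simp add: field_simps)
    then have "\<bar>m / 2 ^ j - Re z\<bar> = \<bar>Re z * 2 ^ j - m\<bar> / 2 ^ j"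
      by (simp only: abs_minus_cancel abs_divide) simp
    also have "\<dots> \<le> 1 / 2 ^ j" using le by (rule divide_right_mono) simp
    finally have "\<bar>m / 2 ^ j - Re z\<bar> \<le> (1/2) ^ j" by (simp only: power_one_over)
    moreover have "complex_of_real (m / 2 ^ j) - z = complex_of_real (m / 2 ^ j - Re z)"
      using im by (simp add: complex_eq_iff)
    ultimately show "z \<in> cball (complex_of_real (m / 2 ^ j)) ((1/2) ^ j)"
      by (simp only: mem_cball dist_norm norm_of_real)
  qed
  show ?thesis
  proof (rule hausdorff_null_limsup[where Q = Q and J = 0 and D = 2 and C = 3 and x = 2])
    fix z :: complex assume z: "z \<in> {z. Im z = 0 \<and> cmod z < 1}"
    have "z \<in> \<Union>(Q j)" for j
    proof -
      have r: "\<bar>Re z\<bar> \<le> 1" using z abs_Re_le_cmod[of z] by auto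
      have "\<bar>Re z * 2 ^ j\<bar> \<le> 2 ^ j" using r by (simp add: abs_mult)
      then have b: "- (2 ^ j) \<le> Re z * 2 ^ j" "Re z * 2 ^ j \<le> 2 ^ j" by (simp_all only: abs_le_iff) simp_all
      have "- (2 ^ j) \<le> \<lfloor>Re z * 2 ^ j\<rfloor>" using b(1) by (simp add: le_floor_iff)
      moreover have "real_of_int \<lfloor>Re z * 2 ^ j\<rfloor> \<le> real_of_int (2 ^ j)"
        by (rule order.trans[OF of_int_floor_le]) (use b(2) in \<open>simp only: of_int_power of_int_numeral\<close>)
      then have "\<lfloor>Re z * 2 ^ j\<rfloor> \<le> 2 ^ j" by (simp only: of_int_le_iff)
      moreover have "z \<in> I j \<lfloor>Re z * 2 ^ j\<rfloor>"
      proof -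
        have "\<bar>x - real_of_int \<lfloor>x\<rfloor>\<bar> \<le> 1" for x by linarith
        then show ?thesis using z by (simp add: I_def)
      qed
      ultimately show ?thesis
        unfolding Q_def by (intro UnionI[of "I j \<lfloor>Re z * 2 ^ j\<rfloor>"] imageI) simp_all
    qed
    then show "\<exists>\<^sub>\<infinity>j. z \<in> \<Union>(Q j)" by (simp add: INFM_nat_le)
  next
    fix j A assume "A \<in> Q j"
    then obtain m where "A = I j m" unfolding Q_def by blast
    note b = bd[OF this]
    have "diameter A \<le> diameter (cball (complex_of_real (m / 2 ^ j)) ((1/2) ^ j))"
      by (rule diameter_subset[OF b]) simp
    then show "bounded A \<and> diameter A \<le> 2 * (1/2) ^ j"
      using bounded_subset[OF bounded_cball b] by (simp add: diameter_cball)
  next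
    fix j
    have "card (Q j) \<le> card {- (2 ^ j)..2 ^ j :: int}"
      unfolding Q_def by (rule card_image_le) simp
    also have "\<dots> = nat (int (2 * 2 ^ j + 1))"
      unfolding card_atLeastAtMost_int by (rule arg_cong[of _ _ nat]) simp
    also have "\<dots> = 2 * 2 ^ j + 1" by (rule nat_int)
    also have "\<dots> \<le> 3 * 2 ^ j" by simp
    finally have "real (card (Q j)) \<le> real (3 * 2 ^ j)" by (simp only: of_nat_le_iff)
    then show "real (card (Q j)) \<le> 3 * 2 ^ j" by simp
  next
    have "(2::real) powr 1 < 2 powr s" using s by (intro powr_less_mono) auto
    then show "2 < (2::real) powr s" by simp
  qed (use s in \<open>auto simp: Q_def\<close>)
qed

section \<open>Square integrable densities\<close>

lemma nn_integral_lborel_affine: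
  fixes f :: "'a::euclidean_space \<Rightarrow> ennreal" and c :: real
  assumes [measurable]: "f \<in> borel_measurable borel" and "c \<noteq> 0"
  shows "(\<integral>\<^sup>+x. f x \<partial>lborel) = ennreal (\<bar>c\<bar> ^ DIM('a)) * (\<integral>\<^sup>+x. f (t + c *\<^sub>R x) \<partial>lborel)"
  by (subst lborel_affine[OF assms(2), of t])
     (simp add: nn_integral_density nn_integral_distr nn_integral_cmult)

text \<open>Outer regularity carries the inequality from open sets to all Borel sets. Applied to a
  set and to its complement, it leaves no room for strictness once the total masses agree. Thus
  lower bounds on open sets and a bound on the mass replace a full proof of weak
  convergence.\<close>

lemma finite_borel_measure_eqI_open:
  fixes M N :: "'a::polish_space measure"
  assumes M: "finite_measure M" "sets M = sets borel" and N: "finite_measure N" "sets N = sets borel"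
    and le: "\<And>U. open U \<Longrightarrow> emeasure M U \<le> emeasure N U"
    and total: "emeasure N UNIV \<le> emeasure M UNIV"
  shows "M = N"
proof (rule measure_eqI)
  interpret M: finite_measure M by fact
  interpret N: finite_measure N by fact
  have sp: "space M = UNIV" "space N = UNIV"
    using M(2) N(2) by (metis sets_eq_imp_space_eq space_borel)+
  have *: "emeasure M B \<le> emeasure N B" if "B \<in> sets borel" for B
  proof -
    have fin: "emeasure M (space M) \<noteq> \<infinity>" "emeasure N (space N) \<noteq> \<infinity>" by simp_all
    show ?thesis
      unfolding outer_regular[OF M(2) fin(1) that] outer_regular[OF N(2) fin(2) that]
      by (rule INF_mono) (use le in auto)
  qed
  fix B assume "B \<in> sets M"
  then have B: "B \<in> sets M" "B \<in> sets N" "B \<in> sets borel" using M N by auto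
  have "measure N UNIV \<le> measure M UNIV"
    using total unfolding M.emeasure_eq_measure N.emeasure_eq_measure by simp
  moreover have "measure M B \<le> measure N B" "measure M (UNIV - B) \<le> measure N (UNIV - B)"
    using *[of B] *[of "UNIV - B"] B unfolding M.emeasure_eq_measure N.emeasure_eq_measure by auto
  moreover have "measure M (UNIV - B) = measure M UNIV - measure M B"
    "measure N (UNIV - B) = measure N UNIV - measure N B"
    using M.finite_measure_compl[OF B(1)] N.finite_measure_compl[OF B(2)] by (simp_all add: sp)
  ultimately show "emeasure M B = emeasure N B"
    unfolding M.emeasure_eq_measure N.emeasure_eq_measure by simp
qed (use M N in simp)

text \<open>The weights \<open>v\<^sup>j\<close> with \<open>v\<^sup>4 = q\<close> split the decay of the increments evenly in Cauchy-Schwarz, which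
  produces a square integrable majorant of the whole sequence.\<close>

lemma L2_majorant:
  fixes f :: "nat \<Rightarrow> 'a \<Rightarrow> real"
  assumes [measurable]: "\<And>j. f j \<in> borel_measurable M"
    and q: "0 < q" "q < 1" and C: "0 \<le> C"
    and decay: "\<And>j. (\<integral>\<^sup>+x. ennreal ((f (Suc j) x - f j x)\<^sup>2) \<partial>M) \<le> ennreal (C * q ^ j)"
  obtains G where "G \<in> borel_measurable M" "(\<integral>\<^sup>+x. ennreal ((G x)\<^sup>2) \<partial>M) < \<infinity>" "\<And>x. 0 \<le> G x"
    "AE x in M. convergent (\<lambda>j. f j x) \<and> (\<forall>j. \<bar>f j x\<bar> \<le> \<bar>f 0 x\<bar> + G x)"
proof -
  define v where "v = q powr (1/4)"
  have v: "0 < v" using q by (simp add: v_def)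
  have v4: "v ^ 4 = q" using q by (simp add: v_def powr_powr flip: powr_realpow)
  have v1: "v < 1"
  proof (rule ccontr)
    assume "\<not> v < 1"
    then have "1 \<le> v ^ 4" by (intro one_le_power) simp
    then show False using v4 q by simp
  qed
  have v21: "v\<^sup>2 < 1" using v v1 by (simp add: power_less_one_iff)
  define d where "d j x = f (Suc j) x - f j x" for j x
  have [measurable]: "d j \<in> borel_measurable M" for j unfolding d_def by measurable
  define H where "H x = (\<Sum>j. ennreal ((d j x)\<^sup>2 / (v\<^sup>2) ^ j))" for x
  have [measurable]: "H \<in> borel_measurable M" unfolding H_def by measurable
  define K where "K = 1 / (1 - v\<^sup>2)"
  have K: "0 < K" using v21 by (simp add: K_def)
  have int: "(\<integral>\<^sup>+x. ennreal ((d j x)\<^sup>2 / (v\<^sup>2) ^ j) \<partial>M) \<le> ennreal (C * (v\<^sup>2) ^ j)" for j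
  proof -
    have "(\<integral>\<^sup>+x. ennreal ((d j x)\<^sup>2 / (v\<^sup>2) ^ j) \<partial>M)
        = (\<integral>\<^sup>+x. ennreal (1 / (v\<^sup>2) ^ j) * ennreal ((d j x)\<^sup>2) \<partial>M)"
      using v by (intro nn_integral_cong) (simp flip: ennreal_mult)
    also have "\<dots> = ennreal (1 / (v\<^sup>2) ^ j) * (\<integral>\<^sup>+x. ennreal ((d j x)\<^sup>2) \<partial>M)"
      by (rule nn_integral_cmult) simp
    also have "\<dots> \<le> ennreal (1 / (v\<^sup>2) ^ j) * ennreal (C * q ^ j)"
      using decay[of j] by (intro mult_left_mono) (auto simp: d_def)
    also have "\<dots> = ennreal (1 / (v\<^sup>2) ^ j * (C * q ^ j))"
      using v q C by (intro ennreal_mult[symmetric]) auto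
    also have "q ^ j = (v\<^sup>2) ^ j * (v\<^sup>2) ^ j"
      by (simp flip: v4 power_mult power_add)
    then have "1 / (v\<^sup>2) ^ j * (C * q ^ j) = C * (v\<^sup>2) ^ j"
      using v by simp
    finally show ?thesis .
  qed
  have "(\<integral>\<^sup>+x. H x \<partial>M) = (\<Sum>j. \<integral>\<^sup>+x. ennreal ((d j x)\<^sup>2 / (v\<^sup>2) ^ j) \<partial>M)"
    unfolding H_def by (rule nn_integral_suminf) measurable
  also have "\<dots> \<le> (\<Sum>j. ennreal (C * (v\<^sup>2) ^ j))"
    by (intro suminf_le int) auto
  also have "\<dots> = ennreal (C * K)"
    unfolding K_def using v21 C by (intro suminf_ennreal_eq sums_mult geometric_sums) auto
  finally have Hfin: "(\<integral>\<^sup>+x. H x \<partial>M) < \<infinity>"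
    by (rule order.strict_trans1) simp
  then have AEH: "AE x in M. H x \<noteq> \<infinity>"
    by (intro nn_integral_noteq_infinite) auto
  define G where "G x = sqrt (K * enn2real (H x))" for x
  have Gm: "G \<in> borel_measurable M" unfolding G_def by measurable
  have G0: "0 \<le> G x" for x using K by (simp add: G_def)
  have "(\<integral>\<^sup>+x. ennreal ((G x)\<^sup>2) \<partial>M) = (\<integral>\<^sup>+x. ennreal K * ennreal (enn2real (H x)) \<partial>M)"
    using K by (intro nn_integral_cong) (simp add: G_def flip: ennreal_mult)
  also have "\<dots> \<le> (\<integral>\<^sup>+x. ennreal K * H x \<partial>M)"
    by (intro nn_integral_mono mult_left_mono) (auto simp: ennreal_enn2real_if)
  also have "\<dots> = ennreal K * (\<integral>\<^sup>+x. H x \<partial>M)"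
    by (rule nn_integral_cmult) simp
  also have "\<dots> < \<infinity>" using Hfin by (simp add: ennreal_mult_less_top)
  finally have Gfin: "(\<integral>\<^sup>+x. ennreal ((G x)\<^sup>2) \<partial>M) < \<infinity>" .
  have "AE x in M. convergent (\<lambda>j. f j x) \<and> (\<forall>j. \<bar>f j x\<bar> \<le> \<bar>f 0 x\<bar> + G x)"
    using AEH
  proof eventually_elim
    case (elim x)
    define h where "h = enn2real (H x)"
    have h: "H x = ennreal h" "0 \<le> h" using elim by (simp_all add: h_def less_top)
    have part: "(\<Sum>j<N. (d j x)\<^sup>2 / (v\<^sup>2) ^ j) \<le> h" for N
    proof -
      have "ennreal (\<Sum>j<N. (d j x)\<^sup>2 / (v\<^sup>2) ^ j) = (\<Sum>j<N. ennreal ((d j x)\<^sup>2 / (v\<^sup>2) ^ j))"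
        by simp
      also have "\<dots> \<le> H x" unfolding H_def by (rule sum_le_suminf) auto
      finally show ?thesis using h by simp
    qed
    have sumd: "(\<Sum>j<N. \<bar>d j x\<bar>) \<le> G x" for N
    proof -
      have "(\<Sum>j<N. \<bar>d j x\<bar>)\<^sup>2 = (\<Sum>j<N. v ^ j * (\<bar>d j x\<bar> / v ^ j))\<^sup>2"
        using v by simp
      also have "\<dots> \<le> (\<Sum>j<N. (v ^ j)\<^sup>2) * (\<Sum>j<N. (\<bar>d j x\<bar> / v ^ j)\<^sup>2)"
        by (rule Cauchy_Schwarz_ineq_sum)
      also have "(\<Sum>j<N. (\<bar>d j x\<bar> / v ^ j)\<^sup>2) = (\<Sum>j<N. (d j x)\<^sup>2 / (v\<^sup>2) ^ j)"
        by (simp add: power_divide power_mult_distrib flip: power_mult) (simp add: mult.commute)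
      also have "(\<Sum>j<N. (v ^ j)\<^sup>2) = (\<Sum>j<N. (v\<^sup>2) ^ j)"
        by (simp flip: power_mult) (simp add: mult.commute)
      also have "(\<Sum>j<N. (v\<^sup>2) ^ j) \<le> K"
        unfolding K_def suminf_geometric[symmetric, of "v\<^sup>2"]
        using v21 by (subst suminf_geometric[symmetric]) (auto intro!: sum_le_suminf)
      then have "(\<Sum>j<N. (v\<^sup>2) ^ j) * (\<Sum>j<N. (d j x)\<^sup>2 / (v\<^sup>2) ^ j) \<le> K * h"
        using part K by (intro mult_mono) (auto intro!: sum_nonneg)
      finally show ?thesis
        unfolding G_def h_def[symmetric] by (rule real_le_rsqrt)
    qed
    have "summable (\<lambda>j. \<bar>d j x\<bar>)"
      by (rule bounded_imp_summable[of _ "G x"]) (use sumd[of "Suc _"] in \<open>auto simp: lessThan_Suc_atMost\<close>)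
    then have "summable (\<lambda>j. d j x)" by (rule summable_rabs_cancel)
    then have "convergent (\<lambda>n. \<Sum>j<n. d j x)" by (simp add: summable_iff_convergent)
    moreover have tel: "(\<Sum>j<n. d j x) = f n x - f 0 x" for n
      unfolding d_def by (rule sum_lessThan_telescope)
    ultimately have "convergent (\<lambda>n. f n x - f 0 x + f 0 x)"
      by (intro convergent_add convergent_const) simp
    then have 1: "convergent (\<lambda>n. f n x)" by simp
    have "\<bar>f n x - f 0 x\<bar> \<le> G x" for n
      unfolding tel[symmetric] using sum_abs[of "\<lambda>j. d j x" "{..<n}"] sumd[of n] by linarith
    then have "\<bar>f n x\<bar> \<le> \<bar>f 0 x\<bar> + G x" for n
      using order.trans[OF abs_triangle_ineq2, of "f n x" "f 0 x" "G x"] by simp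
    with 1 show ?case by blast
  qed
  then show ?thesis using that Gm Gfin G0 by blast
qed

text \<open>The square integrable majorant gives an almost everywhere limit \<open>F\<close>.
  Because all \<open>f j\<close> live in one ball, the majorant is also integrable there, so masses
  of open sets pass to the limit. Then \<open>weak\<close> shows that the measure with density
  \<open>F\<close> dominates \<open>mu\<close> on open sets, while \<open>mass\<close> bounds its
  total mass by 1; together these force equality.\<close>

lemma has_L2_density_if_increments_decay:
  fixes mu :: "complex measure" and f :: "nat \<Rightarrow> complex \<Rightarrow> real"
  assumes mu: "prob_space mu" "sets mu = sets borel"
    and [measurable]: "\<And>j. f j \<in> borel_measurable borel"
    and f0: "\<And>j x. 0 \<le> f j x" and supp: "\<And>j x. L < cmod x \<Longrightarrow> f j x = 0"
    and bound: "\<And>x. f 0 x \<le> B"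
    and mass: "\<And>j. (\<integral>\<^sup>+x. ennreal (f j x) \<partial>lborel) \<le> 1"
    and weak: "\<And>U. open U \<Longrightarrow>
      emeasure mu U \<le> liminf (\<lambda>j. \<integral>\<^sup>+x. ennreal (f j x) * indicator U x \<partial>lborel)"
    and q: "0 < q" "q < 1" and C: "0 \<le> C"
    and decay: "\<And>j. (\<integral>\<^sup>+x. ennreal ((f (Suc j) x - f j x)\<^sup>2) \<partial>lborel) \<le> ennreal (C * q ^ j)"
  shows "has_L2_density mu"
proof -
  interpret mu: prob_space mu by fact
  have [measurable]: "f j \<in> borel_measurable lborel" for j by simp
  obtain G where Gm[measurable]: "G \<in> borel_measurable lborel"
    and Gfin: "(\<integral>\<^sup>+x. ennreal ((G x)\<^sup>2) \<partial>lborel) < \<infinity>" and G0: "\<And>x. 0 \<le> G x"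
    and AE: "AE x in lborel. convergent (\<lambda>j. f j x) \<and> (\<forall>j. \<bar>f j x\<bar> \<le> \<bar>f 0 x\<bar> + G x)"
    using L2_majorant[of f lborel q C] q C decay by auto
  \<comment> \<open>Where the sequence diverges, \<open>lim\<close> has no controlled value;
    \<open>max 0\<close> makes \<open>F\<close> nonnegative everywhere, as
    \<open>has_L2_density\<close> demands, and does not change it where the sequence
    converges.\<close>
  define F where "F x = max 0 (lim (\<lambda>j. f j x))" for x
  have Fm[measurable]: "F \<in> borel_measurable borel" unfolding F_def by measurable
  have AEF: "AE x in lborel. (\<lambda>j. f j x) \<longlonglongrightarrow> F x"
    using AE
  proof eventually_elim
    case (elim x)
    then have c: "(\<lambda>j. f j x) \<longlonglongrightarrow> lim (\<lambda>j. f j x)" by (simp add: convergent_LIMSEQ_iff)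
    then have "0 \<le> lim (\<lambda>j. f j x)" using f0 by (intro LIMSEQ_le_const) auto
    with c show ?case by (simp add: F_def)
  qed
  have B: "0 \<le> B" using f0[of 0 0] bound[of 0] by simp
  have [measurable]: "cball (0::complex) L \<in> sets borel" by simp
  define w where "w x = (B + G x) * indicator (cball 0 L) x" for x :: complex
  have [measurable]: "w \<in> borel_measurable lborel" unfolding w_def by measurable
  have fw: "AE x in lborel. \<forall>j. f j x \<le> w x"
    using AE
  proof eventually_elim
    case (elim x)
    show ?case
    proof
      fix j show "f j x \<le> w x"
        using elim supp[of x j] f0[of j x] bound[of x] f0[of 0 x]
        by (cases "cmod x \<le> L") (auto simp: w_def dest!: spec[of _ j])
    qed
  qed
  have ball: "emeasure lborel (cball (0::complex) L) < \<infinity>"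
    by (rule emeasure_bounded_finite) simp
  have "(\<integral>\<^sup>+x. ennreal (w x) \<partial>lborel)
      \<le> (\<integral>\<^sup>+x. ennreal (B + 1) * indicator (cball 0 L) x + ennreal ((G x)\<^sup>2) \<partial>lborel)"
  proof (rule nn_integral_mono)
    fix x :: complex
    have "G x \<le> 1 + (G x)\<^sup>2"
      using sum_squares_bound[of "G x" 1] G0[of x] by (simp add: power2_eq_square)
    then have "w x \<le> (B + 1) * indicator (cball 0 L) x + (G x)\<^sup>2"
      by (auto simp: w_def indicator_def)
    then show "ennreal (w x) \<le> ennreal (B + 1) * indicator (cball 0 L) x + ennreal ((G x)\<^sup>2)"
      using B by (auto simp: indicator_def w_def simp flip: ennreal_plus intro!: ennreal_leI split: if_splits)
  qed
  also have "\<dots> = ennreal (B + 1) * emeasure lborel (cball (0::complex) L) + (\<integral>\<^sup>+x. ennreal ((G x)\<^sup>2) \<partial>lborel)"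
    by (simp add: nn_integral_add nn_integral_cmult_indicator)
  also have "\<dots> < \<infinity>" using ball Gfin by (simp add: ennreal_mult_less_top)
  finally have wfin: "(\<integral>\<^sup>+x. ennreal (w x) \<partial>lborel) < \<infinity>" .
  have lim: "(\<lambda>j. \<integral>\<^sup>+x. ennreal (f j x) * indicator U x \<partial>lborel)
      \<longlonglongrightarrow> (\<integral>\<^sup>+x. ennreal (F x) * indicator U x \<partial>lborel)" if [measurable]: "U \<in> sets borel" for U
  proof (rule nn_integral_dominated_convergence[where w = "\<lambda>x. ennreal (w x)"])
    show "AE x in lborel. ennreal (f j x) * indicator U x \<le> ennreal (w x)" for j
      using fw by eventually_elim (auto simp: indicator_def intro!: ennreal_leI)
    show "AE x in lborel. (\<lambda>j. ennreal (f j x) * indicator U x) \<longlonglongrightarrow> ennreal (F x) * indicator U x"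
      using AEF by eventually_elim (auto simp: indicator_def intro!: tendsto_ennrealI)
  qed (use wfin in auto)
  define N where "N = density lborel (\<lambda>x. ennreal (F x))"
  have [simp]: "sets N = sets borel" by (simp add: N_def)
  have N: "emeasure N U = (\<integral>\<^sup>+x. ennreal (F x) * indicator U x \<partial>lborel)" if "U \<in> sets borel" for U
    unfolding N_def using that by (subst emeasure_density) auto
  have mass_N: "emeasure N UNIV \<le> 1"
  proof -
    have "(\<lambda>j. \<integral>\<^sup>+x. ennreal (f j x) * indicator UNIV x \<partial>lborel) \<longlonglongrightarrow> emeasure N UNIV"
      using lim[of UNIV] N[of UNIV] by simp
    then show ?thesis by (rule LIMSEQ_le_const2) (use mass in auto)
  qed
  have sp: "space mu = UNIV" using mu(2) by (metis sets_eq_imp_space_eq space_borel)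
  have "mu = N"
  proof (rule finite_borel_measure_eqI_open)
    show "finite_measure N"
      by (rule finite_measureI) (use mass_N in \<open>auto simp: N_def top_unique\<close>)
    show "emeasure mu U \<le> emeasure N U" if "open U" for U
      using weak[OF that] lim[of U] N[of U] that by (simp add: lim_imp_Liminf)
    show "emeasure N UNIV \<le> emeasure mu UNIV"
      using mass_N mu.emeasure_space_1 sp by simp
  qed (use mu mu.finite_measure_axioms in auto)
  moreover have "integrable lborel (\<lambda>x. (F x)\<^sup>2)"
  proof (rule integrableI_bounded)
    have "(\<integral>\<^sup>+x. ennreal (norm ((F x)\<^sup>2)) \<partial>lborel)
        \<le> (\<integral>\<^sup>+x. ennreal (2 * B\<^sup>2) * indicator (cball 0 L) x + ennreal 2 * ennreal ((G x)\<^sup>2) \<partial>lborel)"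
    proof (rule nn_integral_mono_AE)
      show "AE x in lborel. ennreal (norm ((F x)\<^sup>2))
          \<le> ennreal (2 * B\<^sup>2) * indicator (cball 0 L) x + ennreal 2 * ennreal ((G x)\<^sup>2)"
        using AEF fw
      proof eventually_elim
        case (elim x)
        then have "F x \<le> w x" by (intro LIMSEQ_le_const2) auto
        moreover have "0 \<le> F x" by (simp add: F_def)
        ultimately have "(F x)\<^sup>2 \<le> (w x)\<^sup>2" by (intro power_mono)
        also have "(w x)\<^sup>2 \<le> 2 * B\<^sup>2 * indicator (cball 0 L) x + 2 * (G x)\<^sup>2"
          using sum_squares_bound[of B "G x"] by (auto simp: w_def indicator_def power2_sum)
        finally have "ennreal ((F x)\<^sup>2) \<le> ennreal (2 * B\<^sup>2 * indicator (cball 0 L) x + 2 * (G x)\<^sup>2)"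
          by (rule ennreal_leI)
        then show ?case
          by (cases "cmod x \<le> L") (simp_all add: ennreal_plus ennreal_mult')
      qed
    qed
    also have "\<dots> = ennreal (2 * B\<^sup>2) * emeasure lborel (cball (0::complex) L)
        + ennreal 2 * (\<integral>\<^sup>+x. ennreal ((G x)\<^sup>2) \<partial>lborel)"
      by (subst nn_integral_add) (auto simp: nn_integral_cmult nn_integral_cmult_indicator)
    also have "\<dots> < \<infinity>" using ball Gfin by (auto simp: ennreal_mult_less_top)
    finally show "(\<integral>\<^sup>+x. ennreal (norm ((F x)\<^sup>2)) \<partial>lborel) < \<infinity>" .
  qed simp
  ultimately show ?thesis
    unfolding has_L2_density_def N_def by (intro exI[of _ F]) (auto simp: F_def)
qed

section \<open>The random series\<close>

text \<open>The partial sums of the series, kept as polynomials in the parameter: differentiation in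
  \<lambda> is then \<open>pderiv\<close>, and an expectation becomes a finite average.\<close>

definition sign_polys :: "nat \<Rightarrow> complex poly set" where
  "sign_polys n = {p. (\<forall>i<n. coeff p i \<in> {-1, 1}) \<and> (\<forall>i\<ge>n. coeff p i = 0)}"

lemma sign_polys_0: "sign_polys 0 = {0}"
  by (auto simp: sign_polys_def poly_eq_iff)

lemma sign_polys_Suc: "sign_polys (Suc n) = (\<lambda>(a, p). pCons a p) ` ({-1, 1} \<times> sign_polys n)"
proof (intro equalityI subsetI)
  fix p assume p: "p \<in> sign_polys (Suc n)"
  obtain a q where [simp]: "p = pCons a q" by (rule pCons_cases)
  have "a \<in> {-1, 1}" using p by (auto simp: sign_polys_def dest: spec[of _ 0])
  moreover have "q \<in> sign_polys n"
    unfolding sign_polys_def mem_Collect_eq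
  proof (intro conjI allI impI)
    fix i
    show "i < n \<Longrightarrow> coeff q i \<in> {-1, 1}"
      using p by (auto simp: sign_polys_def coeff_pCons dest: spec[of _ "Suc i"])
    show "n \<le> i \<Longrightarrow> coeff q i = 0"
      using p by (auto simp: sign_polys_def coeff_pCons dest!: conjunct2 spec[of _ "Suc i"])
  qed
  ultimately show "p \<in> (\<lambda>(a, p). pCons a p) ` ({-1, 1} \<times> sign_polys n)" by force
qed (auto simp: sign_polys_def coeff_pCons split: nat.splits)

lemma inj_on_pCons: "inj_on (\<lambda>(a, p). pCons a p) A"
  by (auto simp: inj_on_def)

lemma finite_sign_polys: "finite (sign_polys n)"
  by (induction n) (auto simp: sign_polys_0 sign_polys_Suc)

lemma card_sign_polys: "card (sign_polys n) = 2 ^ n"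
  by (induction n) (auto simp: sign_polys_0 sign_polys_Suc card_image inj_on_pCons card_cartesian_product)

lemma sum_sign_polys_Suc:
  "(\<Sum>p\<in>sign_polys (Suc n). g p) = (\<Sum>a\<in>{-1, 1}. \<Sum>p\<in>sign_polys n. g (pCons a p))"
  unfolding sign_polys_Suc
  by (subst sum.reindex[OF inj_on_pCons])
     (simp only: sum.cartesian_product, simp add: case_prod_unfold comp_def)

lemma poly_sign_polys:
  assumes "p \<in> sign_polys n"
  shows "poly p z = (\<Sum>i<n. coeff p i * z ^ i)"
  unfolding poly_altdef
  by (rule sum.mono_neutral_cong)
     (use assms in \<open>auto simp: sign_polys_def not_less not_le coeff_eq_0\<close>)

section \<open>Coin tossing and the laws of the partial sums\<close>

interpretation coins: product_prob_space "\<lambda>_::nat. measure_pmf (pmf_of_set {-1, 1::real})" UNIV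
  by unfold_locales

lemma prob_space_coins: "prob_space coins"
  unfolding coins_def by (rule coins.P.prob_space_axioms)

lemma space_coins: "space coins = UNIV"
  by (simp add: coins_def space_PiM)

lemma measurable_coins_coordinate [measurable]: "(\<lambda>a. a n) \<in> borel_measurable coins"
proof -
  have "(\<lambda>a. a n) \<in> measurable coins (measure_pmf (pmf_of_set {-1, 1}))"
    unfolding coins_def by (rule measurable_component_singleton) simp
  moreover have "id \<in> measurable (measure_pmf (pmf_of_set {-1, 1::real})) borel" by simp
  ultimately have "id \<circ> (\<lambda>a. a n) \<in> measurable coins borel" by (rule measurable_comp)
  then show ?thesis by simp
qed

lemma AE_coins_signs: "AE a in coins. \<forall>n. a n \<in> {-1, 1}"
proof (subst AE_all_countable, intro allI)
  fix n
  have "AE x in measure_pmf (pmf_of_set {-1, 1::real}). x \<in> {-1, 1}"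
    by (simp add: AE_measure_pmf_iff)
  then show "AE a in coins. a n \<in> {-1, 1}"
    unfolding coins_def by (intro AE_PiM_component) (auto intro: measure_pmf.prob_space_axioms)
qed

lemma ber_series_measurable [measurable]: "ber_series lam \<in> borel_measurable coins"
proof -
  have "ber_series lam = (\<lambda>a. lim (\<lambda>n. \<Sum>i<n. complex_of_real (a i) * lam ^ i))"
    by (simp add: fun_eq_iff ber_series_def suminf_eq_lim)
  then show ?thesis by simp
qed

lemma sign_series_summable:
  assumes "\<forall>n. a n \<in> {-1, 1::real}" "cmod z < 1"
  shows "summable (\<lambda>n. cmod (complex_of_real (a n) * z ^ n))"
proof -
  have "\<bar>a n\<bar> = 1" for n using assms(1) by (auto dest!: spec[of _ n])
  then have "(\<lambda>n. cmod (complex_of_real (a n) * z ^ n)) = (\<lambda>n. cmod z ^ n)"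
    by (simp add: norm_mult norm_power)
  then show ?thesis using assms(2) by (simp add: summable_geometric)
qed

lemma cmod_ber_series_le:
  assumes "\<forall>n. a n \<in> {-1, 1::real}" "cmod z < 1"
  shows "cmod (ber_series z a) \<le> 1 / (1 - cmod z)"
proof -
  have "\<bar>a n\<bar> = 1" for n using assms(1) by (auto dest!: spec[of _ n])
  then have "(\<Sum>n. cmod (complex_of_real (a n) * z ^ n)) = 1 / (1 - cmod z)"
    using assms(2) by (simp add: norm_mult norm_power suminf_geometric)
  then show ?thesis
    unfolding ber_series_def using summable_norm[OF sign_series_summable[OF assms]] by simp
qed

text \<open>Up to a null set the cylinders \<open>E p\<close> partition the sign sequences, each
  with probability \<open>1 / 2 ^ n\<close>, and on \<open>E p\<close> the partial sum is
  \<open>poly p z\<close>.\<close>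

lemma coins_integral_partial_sum:
  fixes \<phi> :: "complex \<Rightarrow> real"
  assumes [measurable]: "\<phi> \<in> borel_measurable borel"
  shows "(\<integral>a. \<phi> (\<Sum>i<n. complex_of_real (a i) * z ^ i) \<partial>coins) = (\<Sum>p\<in>sign_polys n. \<phi> (poly p z)) / 2 ^ n"
proof -
  interpret C: prob_space coins by (rule prob_space_coins)
  define E where "E p = {a \<in> space coins. \<forall>i\<in>{..<n}. a i \<in> {Re (coeff p i)}}" for p :: "complex poly"
  have E: "E p \<in> sets coins" for p unfolding E_def by measurable
  have mE: "measure coins (E p) = 1 / 2 ^ n" if "p \<in> sign_polys n" for p
  proof -
    have half: "emeasure (measure_pmf (pmf_of_set {-1, 1::real})) {Re (coeff p i)} = ennreal (1/2)" if "i < n" for i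
    proof -
      have "Re (coeff p i) \<in> {-1, 1}"
        using \<open>p \<in> sign_polys n\<close> that by (auto simp: sign_polys_def dest!: spec[of _ i])
      then have "{-1, 1} \<inter> {Re (coeff p i)} = {Re (coeff p i)}" by auto
      then show ?thesis by (subst emeasure_pmf_of_set) auto
    qed
    have "emeasure coins (E p) = (\<Prod>i\<in>{..<n}. emeasure (measure_pmf (pmf_of_set {-1, 1::real})) {Re (coeff p i)})"
      unfolding E_def coins_def by (rule coins.emeasure_PiM_Collect) auto
    also have "\<dots> = ennreal ((1/2) ^ n)"
      using half by (simp add: ennreal_power prod.cong[OF refl half, of "{..<n}"] del: ennreal_half)
    finally show ?thesis by (simp add: measure_def power_one_over)
  qed
  have "(\<integral>a. \<phi> (\<Sum>i<n. complex_of_real (a i) * z ^ i) \<partial>coins)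
      = (\<integral>a. (\<Sum>p\<in>sign_polys n. indicator (E p) a *\<^sub>R \<phi> (poly p z)) \<partial>coins)"
  proof (rule integral_cong_AE)
    show "AE a in coins. \<phi> (\<Sum>i<n. complex_of_real (a i) * z ^ i)
        = (\<Sum>p\<in>sign_polys n. indicator (E p) a *\<^sub>R \<phi> (poly p z))"
      using AE_coins_signs
    proof eventually_elim
      case (elim a)
      define q where "q = Poly (map (\<lambda>i. complex_of_real (a i)) [0..<n])"
      have cq: "coeff q i = (if i < n then complex_of_real (a i) else 0)" for i
        by (simp add: q_def nth_default_def)
      have q: "q \<in> sign_polys n"
      proof -
        have "complex_of_real (a i) \<in> {-1, 1}" for i
          using spec[OF elim, of i] by auto
        then show ?thesis by (simp add: sign_polys_def cq)
      qed
      have Eq: "a \<in> E p \<longleftrightarrow> p = q" if p: "p \<in> sign_polys n" for p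
      proof
        assume "a \<in> E p"
        then have "a i = Re (coeff p i)" if "i < n" for i using that by (auto simp: E_def)
        moreover have "coeff p i = complex_of_real (Re (coeff p i))" if "i < n" for i
          using p that by (auto simp: sign_polys_def dest!: spec[of _ i])
        moreover have "coeff p i = 0" if "\<not> i < n" for i using p that by (auto simp: sign_polys_def)
        ultimately show "p = q" by (metis cq poly_eqI)
      qed (auto simp: E_def cq space_coins)
      have "(\<Sum>p\<in>sign_polys n. indicator (E p) a *\<^sub>R \<phi> (poly p z))
          = (\<Sum>p\<in>sign_polys n. if p = q then \<phi> (poly p z) else 0)"
        by (rule sum.cong) (auto simp: Eq)
      also have "\<dots> = \<phi> (poly q z)" using q finite_sign_polys by simp
      also have "poly q z = (\<Sum>i<n. complex_of_real (a i) * z ^ i)"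
        by (subst poly_sign_polys[OF q]) (simp add: cq)
      finally show ?case by simp
    qed
  qed (use E in measurable)
  also have "\<dots> = (\<Sum>p\<in>sign_polys n. measure coins (E p) * \<phi> (poly p z))"
    using E by (subst Bochner_Integration.integral_sum) (auto simp: C.emeasure_eq_measure)
  also have "\<dots> = (\<Sum>p\<in>sign_polys n. \<phi> (poly p z)) / 2 ^ n"
    by (simp add: mE sum_divide_distrib)
  finally show ?thesis .
qed

lemma sets_nu [simp, measurable_cong]: "sets (nu lam) = sets borel"
  by (simp add: nu_def)

lemma prob_space_nu: "prob_space (nu lam)"
  unfolding nu_def by (rule prob_space.prob_space_distr[OF prob_space_coins]) simp

lemma AE_nu_bounded: "cmod z < 1 \<Longrightarrow> AE x in nu z. cmod x \<le> 1 / (1 - cmod z)"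
  unfolding nu_def using AE_coins_signs
  by (subst AE_distr_iff) (auto elim!: eventually_mono intro: cmod_ber_series_le)

text \<open>Dominated convergence over the coins. This is the passage by which estimates for finite
  averages over polynomials reach \<open>nu z\<close>.\<close>

lemma nu_integral_limit:
  fixes \<phi> :: "complex \<Rightarrow> real"
  assumes cont: "continuous_on UNIV \<phi>" and bd: "\<And>x. \<bar>\<phi> x\<bar> \<le> B" and z: "cmod z < 1"
  shows "(\<lambda>n. (\<Sum>p\<in>sign_polys n. \<phi> (poly p z)) / 2 ^ n) \<longlonglongrightarrow> (\<integral>x. \<phi> x \<partial>nu z)"
proof -
  interpret C: prob_space coins by (rule prob_space_coins)
  have [measurable]: "\<phi> \<in> borel_measurable borel"
    using cont by (rule borel_measurable_continuous_onI)
  have "(\<lambda>n. \<integral>a. \<phi> (\<Sum>i<n. complex_of_real (a i) * z ^ i) \<partial>coins) \<longlonglongrightarrow> (\<integral>a. \<phi> (ber_series z a) \<partial>coins)"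
  proof (rule integral_dominated_convergence[where w = "\<lambda>_. B"])
    show "AE a in coins. (\<lambda>n. \<phi> (\<Sum>i<n. complex_of_real (a i) * z ^ i)) \<longlonglongrightarrow> \<phi> (ber_series z a)"
      using AE_coins_signs
    proof eventually_elim
      case (elim a)
      have "(\<lambda>n. \<Sum>i<n. complex_of_real (a i) * z ^ i) \<longlonglongrightarrow> ber_series z a"
        unfolding ber_series_def
        by (rule summable_LIMSEQ) (rule summable_norm_cancel[OF sign_series_summable[OF elim z]])
      then show ?case
        using cont by (intro continuous_on_tendsto_compose[of UNIV \<phi>]) auto
    qed
  qed (use bd in auto)
  then show ?thesis
    by (simp add: coins_integral_partial_sum nu_def integral_distr)
qed

text \<open>By Tychonoff the sign sequences form a compact set, and the Weierstrass test makes the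
  series continuous on it. Compactness is what makes the set Borel.\<close>

lemma compact_A_set:
  assumes z: "cmod z < 1"
  shows "compact (A_set z)"
proof -
  define S where "S = {a :: nat \<Rightarrow> real. \<forall>n. a n \<in> {-1, 1}}"
  have "S = PiE UNIV (\<lambda>_. {-1, 1})" by (auto simp: S_def PiE_def)
  then have S: "compact S"
    using compactin_PiE[of "\<lambda>_::nat. euclidean :: real topology" UNIV "\<lambda>_. {-1, 1}"]
    by (simp add: euclidean_product_topology compactin_euclidean_iff)
  have "uniform_limit S (\<lambda>n a. \<Sum>i<n. complex_of_real (a i) * z ^ i) (\<lambda>a. \<Sum>i. complex_of_real (a i) * z ^ i) sequentially"
  proof (rule Weierstrass_m_test)
    show "summable (\<lambda>n. cmod z ^ n)" using z by (simp add: summable_geometric)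
    fix n a assume "a \<in> S"
    then have "\<bar>a n\<bar> = 1" by (auto simp: S_def dest!: spec[of _ n])
    then show "cmod (complex_of_real (a n) * z ^ n) \<le> cmod z ^ n" by (simp add: norm_mult norm_power)
  qed
  then have "continuous_on S (\<lambda>a. \<Sum>i. complex_of_real (a i) * z ^ i)"
    by (rule uniform_limit_theorem[rotated])
       (auto intro!: always_eventually continuous_intros continuous_on_subset[OF continuous_on_product_coordinates])
  then have "compact ((\<lambda>a. \<Sum>i. complex_of_real (a i) * z ^ i) ` S)"
    using S by (rule compact_continuous_image)
  then show ?thesis by (simp add: A_set_def S_def ber_series_def image_def)
qed

text \<open>Almost every sign sequence has its sum in the set, so \<open>nu z\<close> gives it mass
  1; an absolutely continuous measure cannot do so on a null set.\<close>

lemma emeasure_A_set_pos: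
  assumes z: "cmod z < 1" and L2: "has_L2_density (nu z)"
  shows "emeasure lborel (A_set z) > 0"
proof (rule ccontr)
  assume "\<not> emeasure lborel (A_set z) > 0"
  then have "emeasure lborel (A_set z) = 0" by simp
  moreover have A: "A_set z \<in> sets borel"
    using compact_A_set[OF z] by (simp add: borel_compact)
  ultimately have null: "A_set z \<in> null_sets lborel" by (simp add: null_sets_def)
  obtain f where f: "f \<in> borel_measurable lborel" "nu z = density lborel (\<lambda>x. ennreal (f x))"
    using L2 unfolding has_L2_density_def by blast
  have "absolutely_continuous lborel (nu z)"
    unfolding f(2) by (rule absolutely_continuousI_density) (use f in measurable)
  then have "emeasure (nu z) (A_set z) = 0"
    using null unfolding absolutely_continuous_def by auto
  moreover have "AE x in nu z. x \<in> A_set z"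
    unfolding nu_def
  proof (subst AE_distr_iff)
    show "{x \<in> space borel. x \<in> A_set z} \<in> sets borel" using A by simp
    show "AE a in coins. ber_series z a \<in> A_set z"
      using AE_coins_signs by eventually_elim (auto simp: A_set_def)
  qed simp
  then have "emeasure (nu z) (A_set z) = 1"
    using A prob_space.emeasure_eq_1_AE[OF prob_space_nu, of "A_set z" z] by simp
  ultimately show False by simp
qed

declare measurable_coins_coordinate [measurable del]

text \<open>Of the \<open>4 ^ n\<close> pairs a fraction \<open>1 / 2 ^ Suc k\<close> first differs
  at index \<open>k\<close>, and a fraction \<open>1 / 2 ^ n\<close> is diagonal. The induction
  strips the leading signs: equal ones shift \<open>b\<close> by one index, distinct ones contribute
  \<open>b 0\<close>. Hence both \<open>T\<close> and \<open>b\<close> must vary in the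
  induction.\<close>

lemma sum_sign_poly_pairs_le:
  fixes T :: "complex poly \<Rightarrow> complex poly \<Rightarrow> real"
  assumes "\<And>p. p \<in> sign_polys n \<Longrightarrow> T p p \<le> D"
    and "\<And>p q k f. p \<in> sign_polys n \<Longrightarrow> q \<in> sign_polys n \<Longrightarrow> f \<in> sign_quotients \<Longrightarrow>
      p - q = smult 2 (monom 1 k * f) \<Longrightarrow> T p q \<le> b k"
  shows "(\<Sum>p\<in>sign_polys n. \<Sum>q\<in>sign_polys n. T p q) \<le> 4 ^ n * ((\<Sum>k<n. b k / 2 ^ Suc k) + D / 2 ^ n)"
  using assms
proof (induction n arbitrary: T b)
  case 0
  then show ?case by (simp add: sign_polys_0)
next
  case (Suc n)
  have mem: "pCons a p \<in> sign_polys (Suc n)" if "a \<in> {-1, 1}" "p \<in> sign_polys n" for a p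
    unfolding sign_polys_Suc using that by force
  have same: "(\<Sum>p\<in>sign_polys n. \<Sum>q\<in>sign_polys n. T (pCons a p) (pCons a q))
      \<le> 4 ^ n * ((\<Sum>k<n. b (Suc k) / 2 ^ Suc k) + D / 2 ^ n)" if a: "a \<in> {-1, 1}" for a
  proof (rule Suc.IH)
    fix p q f k
    assume pq: "p \<in> sign_polys n" "q \<in> sign_polys n" "f \<in> sign_quotients"
      and eq: "p - q = smult 2 (monom 1 k * f)"
    have "pCons a p - pCons a q = pCons 0 (p - q)" by simp
    also have "\<dots> = smult 2 (monom 1 (Suc k) * f)" unfolding eq by (simp add: monom_Suc)
    finally show "T (pCons a p) (pCons a q) \<le> b (Suc k)"
      by (rule Suc.prems(2)[OF mem[OF a pq(1)] mem[OF a pq(2)] pq(3)])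
  qed (rule Suc.prems(1)[OF mem[OF a]])
  have diff: "(\<Sum>p\<in>sign_polys n. \<Sum>q\<in>sign_polys n. T (pCons a p) (pCons a' q)) \<le> 4 ^ n * b 0"
    if a: "a \<in> {-1, 1}" "a' \<in> {-1, 1}" "a \<noteq> a'" for a a'
  proof -
    have "T (pCons a p) (pCons a' q) \<le> b 0" if pq: "p \<in> sign_polys n" "q \<in> sign_polys n" for p q
    proof -
      \<comment> \<open>For distinct signs \<open>a - a' = 2 * a\<close>, so half of the difference
        has constant term \<open>a\<close>; the later coefficients are half differences of signs, or
        zero.\<close>
      define f where "f = pCons a (smult (1/2) (p - q))"
      have sgn: "coeff p i \<in> {-1, 1} \<and> coeff q i \<in> {-1, 1} \<or> coeff p i = 0 \<and> coeff q i = 0" for i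
        using pq by (cases "i < n") (auto simp: sign_polys_def)
      have h: "(coeff p i - coeff q i) / 2 \<in> {-1, 0, 1}" for i
        using sgn[of i] by auto
      have "f \<in> sign_quotients"
        unfolding sign_quotients_def mem_Collect_eq
      proof (intro conjI allI)
        show "coeff f i \<in> {-1, 0, 1}" for i
          using a h[of "i - 1"] by (cases i) (auto simp: f_def diff_divide_distrib)
      qed (use a in \<open>simp add: f_def\<close>)
      moreover have "a - a' = 2 * a" using a by auto
      then have "pCons a p - pCons a' q = smult 2 (monom 1 0 * f)"
        by (simp add: f_def monom_0)
      ultimately show ?thesis
        by (rule Suc.prems(2)[OF mem[OF a(1) pq(1)] mem[OF a(2) pq(2)]])
    qed
    then have "(\<Sum>p\<in>sign_polys n. \<Sum>q\<in>sign_polys n. T (pCons a p) (pCons a' q))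
        \<le> (\<Sum>p\<in>sign_polys n. \<Sum>q\<in>sign_polys n. b 0)"
      by (intro sum_mono) auto
    also have "\<dots> = 4 ^ n * b 0"
      by (simp add: card_sign_polys flip: power_mult_distrib)
    finally show ?thesis .
  qed
  have "(\<Sum>p\<in>sign_polys (Suc n). \<Sum>q\<in>sign_polys (Suc n). T p q)
      = (\<Sum>a\<in>{-1, 1}. \<Sum>p\<in>sign_polys n. \<Sum>a'\<in>{-1, 1}. \<Sum>q\<in>sign_polys n. T (pCons a p) (pCons a' q))"
    by (simp only: sum_sign_polys_Suc)
  also have "\<dots> = (\<Sum>a\<in>{-1, 1}. \<Sum>a'\<in>{-1, 1}. \<Sum>p\<in>sign_polys n. \<Sum>q\<in>sign_polys n. T (pCons a p) (pCons a' q))"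
    by (rule sum.cong[OF refl], rule sum.swap)
  also have "\<dots> = (\<Sum>p\<in>sign_polys n. \<Sum>q\<in>sign_polys n. T (pCons (-1) p) (pCons (-1) q))
      + (\<Sum>p\<in>sign_polys n. \<Sum>q\<in>sign_polys n. T (pCons (-1) p) (pCons 1 q))
      + (\<Sum>p\<in>sign_polys n. \<Sum>q\<in>sign_polys n. T (pCons 1 p) (pCons (-1) q))
      + (\<Sum>p\<in>sign_polys n. \<Sum>q\<in>sign_polys n. T (pCons 1 p) (pCons 1 q))"
    by simp
  also have "\<dots> \<le> 4 ^ n * ((\<Sum>k<n. b (Suc k) / 2 ^ Suc k) + D / 2 ^ n) + 4 ^ n * b 0 + 4 ^ n * b 0
      + 4 ^ n * ((\<Sum>k<n. b (Suc k) / 2 ^ Suc k) + D / 2 ^ n)"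
    by (intro add_mono same diff) auto
  also have "\<dots> = 4 ^ Suc n * ((\<Sum>k<Suc n. b k / 2 ^ Suc k) + D / 2 ^ Suc n)"
  proof -
    have "(\<Sum>k<Suc n. b k / 2 ^ Suc k) = b 0 / 2 + (\<Sum>k<n. b (Suc k) / 2 ^ Suc k) / 2"
      by (subst sum.lessThan_Suc_shift) (simp add: sum_divide_distrib)
    then show ?thesis by (simp only:) (simp add: algebra_simps)
  qed
  finally show ?case .
qed

section \<open>Oscillatory integrals\<close>

text \<open>Difference quotients integrate to zero because Lebesgue measure is translation
  invariant, and they converge boundedly on a bounded set. A bounded pointwise directional
  derivative therefore suffices, which spares any proof that the vector field used below is
  continuously differentiable.\<close>

lemma integral_directional_derivative_eq_0:
  fixes W :: "complex \<Rightarrow> complex"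
  assumes der: "\<And>z. ((\<lambda>t. W (z + t *\<^sub>R e)) has_vector_derivative W' z) (at 0)"
    and W[measurable]: "W \<in> borel_measurable borel" and B: "\<And>z. cmod (W z) \<le> B"
    and M: "\<And>z. cmod (W' z) \<le> M" and L: "\<And>z. L < cmod z \<Longrightarrow> W z = 0" and e: "cmod e \<le> 1"
  shows "integrable lborel W'" "(\<integral>z. W' z \<partial>lborel) = 0"
proof -
  have der': "((\<lambda>t. W (z + t *\<^sub>R e)) has_vector_derivative W' (z + s *\<^sub>R e)) (at s)" for z s
  proof -
    have "((\<lambda>t. W ((z + s *\<^sub>R e) + t *\<^sub>R e)) \<circ> (\<lambda>t. t - s) has_vector_derivative 1 *\<^sub>R W' (z + s *\<^sub>R e)) (at s)"
    proof (rule vector_diff_chain_at)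
      show "((\<lambda>t. t - s) has_vector_derivative 1) (at s)"
        by (auto intro!: derivative_eq_intros)
    qed (use der[of "z + s *\<^sub>R e"] in simp)
    then show ?thesis by (simp add: o_def algebra_simps)
  qed
  have lip: "cmod (W (z + t *\<^sub>R e) - W z) \<le> M * t" if "0 \<le> t" for z t
  proof -
    have "norm (W (z + t *\<^sub>R e) - W (z + 0 *\<^sub>R e)) \<le> M * norm (t - 0)"
    proof (rule differentiable_bound[of UNIV "\<lambda>t. W (z + t *\<^sub>R e)" "\<lambda>s t. t *\<^sub>R W' (z + s *\<^sub>R e)"])
      show "onorm (\<lambda>t. t *\<^sub>R W' (z + s *\<^sub>R e)) \<le> M" for s
      proof (rule onorm_le)
        show "norm (t *\<^sub>R W' (z + s *\<^sub>R e)) \<le> M * norm t" for t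
          using mult_left_mono[OF M[of "z + s *\<^sub>R e"], of "\<bar>t\<bar>"] by (simp add: mult.commute)
      qed
    qed (use der'[unfolded has_vector_derivative_def] in simp_all)
    then show ?thesis using that by simp
  qed
  define q where "q n z = real (Suc n) *\<^sub>R (W (z + inverse (real (Suc n)) *\<^sub>R e) - W z)" for n z
  have qm: "q n \<in> borel_measurable lborel" for n unfolding q_def by measurable
  have lim: "(\<lambda>n. q n z) \<longlonglongrightarrow> W' z" for z
  proof -
    have "((\<lambda>t. norm (W (z + t *\<^sub>R e) - W z - t *\<^sub>R W' z) / norm t) \<longlongrightarrow> 0) (at 0)"
      using der[of z] unfolding has_vector_derivative_def has_derivative_at by simp
    moreover have "filterlim (\<lambda>n. inverse (real (Suc n))) (at 0) sequentially"
      unfolding filterlim_at using LIMSEQ_inverse_real_of_nat by auto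
    ultimately have "(\<lambda>n. norm (W (z + inverse (real (Suc n)) *\<^sub>R e) - W z - inverse (real (Suc n)) *\<^sub>R W' z)
        / norm (inverse (real (Suc n)))) \<longlonglongrightarrow> 0"
      by (rule filterlim_compose)
    also have "(\<lambda>n. norm (W (z + inverse (real (Suc n)) *\<^sub>R e) - W z - inverse (real (Suc n)) *\<^sub>R W' z)
        / norm (inverse (real (Suc n)))) = (\<lambda>n. norm (q n z - W' z))"
    proof
      fix n
      have "q n z - W' z = real (Suc n) *\<^sub>R (W (z + inverse (real (Suc n)) *\<^sub>R e) - W z - inverse (real (Suc n)) *\<^sub>R W' z)"
        by (simp add: q_def scaleR_right_diff_distrib)
      then show "norm (W (z + inverse (real (Suc n)) *\<^sub>R e) - W z - inverse (real (Suc n)) *\<^sub>R W' z)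
        / norm (inverse (real (Suc n))) = norm (q n z - W' z)"
        by (simp add: divide_inverse mult.commute)
    qed
    finally show ?thesis by (simp add: tendsto_norm_zero_iff LIM_zero_iff)
  qed
  have Wi: "integrable lborel W"
  proof (rule integrableI_bounded_set[where A = "cball 0 L" and B = B])
    show "emeasure lborel (cball (0::complex) L) < \<infinity>" by (rule emeasure_bounded_finite) simp
  qed (use B L in \<open>auto simp: not_le\<close>)
  have ci: "integrable lborel (\<lambda>z. M * indicator (cball (0::complex) (L + 1)) z)"
  proof -
    have "emeasure lborel (cball (0::complex) (L + 1)) < \<infinity>" by (rule emeasure_bounded_finite) simp
    then show ?thesis by simp
  qed
  have bd: "cmod (q n z) \<le> M * indicator (cball 0 (L + 1)) z" for n z
  proof (cases "cmod z \<le> L + 1")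
    case True
    have "cmod (q n z) \<le> real (Suc n) * (M * inverse (real (Suc n)))"
      unfolding q_def norm_scaleR using lip[of "inverse (real (Suc n))" z]
      by (intro mult_mono) auto
    also have "\<dots> = M" by simp
    finally show ?thesis using True by simp
  next
    case False
    have "cmod (inverse (real (Suc n)) *\<^sub>R e) \<le> 1 * 1"
      unfolding norm_scaleR by (intro mult_mono e) (auto simp: field_simps)
    then have "L < cmod (z + inverse (real (Suc n)) *\<^sub>R e)"
      using norm_triangle_ineq2[of z "- (inverse (real (Suc n)) *\<^sub>R e)"] False by simp
    then show ?thesis using False L[of z] L[of "z + inverse (real (Suc n)) *\<^sub>R e"] by (simp add: q_def)
  qed
  have int0: "(\<integral>z. q n z \<partial>lborel) = 0" for n
  proof -
    let ?c = "inverse (real (Suc n)) *\<^sub>R e"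
    have tr: "(\<integral>z. W (z + ?c) \<partial>lborel) = (\<integral>z. W z \<partial>lborel)" "integrable lborel (\<lambda>z. W (z + ?c))"
      using integral_distr[of "(+) ?c" lborel borel W] integrable_distr_eq[of "(+) ?c" lborel borel W] Wi
      by (simp_all add: lborel_distr_plus add.commute)
    show ?thesis unfolding q_def using tr Wi by simp
  qed
  have W'm: "W' \<in> borel_measurable lborel"
    by (rule borel_measurable_LIMSEQ_metric[OF qm lim])
  show "integrable lborel W'"
  proof (rule integrable_dominated_convergence[where s = q, OF W'm _ ci])
    show "q n \<in> borel_measurable lborel" for n by (rule qm)
  qed (use lim bd in auto)
  have "(\<lambda>n. \<integral>z. q n z \<partial>lborel) \<longlonglongrightarrow> (\<integral>z. W' z \<partial>lborel)"
  proof (rule integral_dominated_convergence[where s = q, OF W'm _ ci])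
    show "q n \<in> borel_measurable lborel" for n by (rule qm)
  qed (use lim bd in auto)
  then show "(\<integral>z. W' z \<partial>lborel) = 0" by (simp add: int0 LIMSEQ_const_iff)
qed

text \<open>The indices count derivatives: \<open>K i l\<close> is the derivative of order
  \<open>i\<close> in the real and \<open>l\<close> in the imaginary direction of a product kernel.
  Order three is enough because the increments use kernels with \<open>i + l = 1\<close> and
  sampling on the grid differentiates at most twice more.\<close>

locale smooth_kernel =
  fixes u v :: "nat \<Rightarrow> real \<Rightarrow> real"
  assumes du: "\<And>i t. i < 3 \<Longrightarrow> (u i has_real_derivative u (Suc i) t) (at t)"
    and dv: "\<And>i t. i < 3 \<Longrightarrow> (v i has_real_derivative v (Suc i) t) (at t)"
    and cu: "\<And>i. i \<le> 3 \<Longrightarrow> continuous_on UNIV (u i)"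
    and cv: "\<And>i. i \<le> 3 \<Longrightarrow> continuous_on UNIV (v i)"
    and su: "\<And>i t. i \<le> 3 \<Longrightarrow> 1 \<le> \<bar>t\<bar> \<Longrightarrow> u i t = 0"
    and sv: "\<And>i t. i \<le> 3 \<Longrightarrow> 1 \<le> \<bar>t\<bar> \<Longrightarrow> v i t = 0"
begin

definition K :: "nat \<Rightarrow> nat \<Rightarrow> complex \<Rightarrow> real" where
  "K i l z = u i (Re z) * v l (Im z)"

lemma K_continuous:
  assumes "i \<le> 3" "l \<le> 3"
  shows "continuous_on UNIV (K i l)"
proof -
  have "continuous_on UNIV (\<lambda>z. u i (Re z))"
    by (rule continuous_on_compose2[OF cu[OF assms(1)] continuous_on_Re[OF continuous_on_id]]) simp
  moreover have "continuous_on UNIV (\<lambda>z. v l (Im z))"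
    by (rule continuous_on_compose2[OF cv[OF assms(2)] continuous_on_Im[OF continuous_on_id]]) simp
  ultimately show ?thesis unfolding K_def by (rule continuous_on_mult)
qed

lemma K_measurable [measurable]: "i \<le> 3 \<Longrightarrow> l \<le> 3 \<Longrightarrow> K i l \<in> borel_measurable borel"
  by (intro borel_measurable_continuous_onI K_continuous)

lemma K_eq_0:
  assumes "i \<le> 3" "l \<le> 3" "2 < cmod z"
  shows "K i l z = 0"
proof (rule ccontr)
  assume "K i l z \<noteq> 0"
  then have "\<bar>Re z\<bar> < 1" "\<bar>Im z\<bar> < 1"
    using su[of i "Re z"] sv[of l "Im z"] assms unfolding K_def by (metis mult_eq_0_iff not_le)+
  then show False using cmod_le[of z] assms by linarith
qed

lemma bounded_1d:
  fixes w :: "real \<Rightarrow> real"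
  assumes "continuous_on UNIV w" "\<And>t. 1 \<le> \<bar>t\<bar> \<Longrightarrow> w t = 0"
  shows "\<exists>B\<ge>0. \<forall>t. \<bar>w t\<bar> \<le> B"
proof -
  have "compact (w ` {-1..1})"
    by (intro compact_continuous_image continuous_on_subset[OF assms(1)]) auto
  then have "bounded (w ` {-1..1})" by (rule compact_imp_bounded)
  then obtain B where B: "\<And>t. t \<in> {-1..1} \<Longrightarrow> \<bar>w t\<bar> \<le> B"
    unfolding bounded_iff real_norm_def by blast
  have "\<bar>w t\<bar> \<le> max 0 B" for t
  proof (cases "1 \<le> \<bar>t\<bar>")
    case False
    then have "t \<in> {-1..1}" by auto
    then show ?thesis using B by (simp add: le_max_iff_disj)
  qed (use assms(2) in simp)
  then show ?thesis by (intro exI[of _ "max 0 B"]) auto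
qed

lemma K_bounded: "\<exists>B>0. \<forall>i\<le>3. \<forall>l\<le>3. \<forall>z. \<bar>K i l z\<bar> \<le> B"
proof -
  have "\<exists>b. \<forall>i\<in>{..3}. \<forall>t. \<bar>w i t\<bar> \<le> b" if w: "\<And>i. i \<le> 3 \<Longrightarrow> continuous_on UNIV (w i)"
    "\<And>i t. i \<le> 3 \<Longrightarrow> 1 \<le> \<bar>t\<bar> \<Longrightarrow> w i t = 0" for w :: "nat \<Rightarrow> real \<Rightarrow> real"
  proof -
    have "\<forall>i\<in>{..3}. \<exists>B. 0 \<le> B \<and> (\<forall>t. \<bar>w i t\<bar> \<le> B)" using bounded_1d w by (metis atMost_iff)
    then obtain B where B: "\<And>i. i \<le> 3 \<Longrightarrow> 0 \<le> B i \<and> (\<forall>t. \<bar>w i t\<bar> \<le> B i)" by (metis atMost_iff)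
    have "\<bar>w i t\<bar> \<le> (\<Sum>j\<le>3. B j)" if i: "i \<le> 3" for i t
    proof -
      have "B i \<le> (\<Sum>j\<le>3. B j)" using i B by (intro member_le_sum) auto
      then show ?thesis using B[OF i] order.trans by blast
    qed
    then show ?thesis by blast
  qed
  from this[of u] this[of v] obtain b b' where
    b: "\<And>i t. i \<le> 3 \<Longrightarrow> \<bar>u i t\<bar> \<le> b" "\<And>i t. i \<le> 3 \<Longrightarrow> \<bar>v i t\<bar> \<le> b'"
    using cu su cv sv by (metis atMost_iff)
  have "\<bar>K i l z\<bar> \<le> \<bar>b\<bar> * \<bar>b'\<bar> + 1" if "i \<le> 3" "l \<le> 3" for i l z
  proof -
    have "\<bar>K i l z\<bar> \<le> \<bar>b\<bar> * \<bar>b'\<bar>"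
      unfolding K_def abs_mult
      by (intro mult_mono order.trans[OF b(1)[OF that(1)] abs_ge_self] order.trans[OF b(2)[OF that(2)] abs_ge_self])
        auto
    then show ?thesis by simp
  qed
  then show ?thesis by (intro exI[of _ "\<bar>b\<bar> * \<bar>b'\<bar> + 1"]) (auto simp: add_nonneg_pos)
qed

lemma K_has_derivative:
  assumes "i < 3" "l < 3"
  shows "(K i l has_derivative (\<lambda>h. K (Suc i) l z * Re h + K i (Suc l) z * Im h)) (at z)"
proof -
  have "((\<lambda>z. u i (Re z)) has_derivative (\<lambda>h. u (Suc i) (Re z) * Re h)) (at z)"
    using DERIV_compose_FDERIV[OF du[OF assms(1)] bounded_linear.has_derivative[OF bounded_linear_Re has_derivative_ident]]
    by (simp add: mult.commute)
  moreover have "((\<lambda>z. v l (Im z)) has_derivative (\<lambda>h. v (Suc l) (Im z) * Im h)) (at z)"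
    using DERIV_compose_FDERIV[OF dv[OF assms(2)] bounded_linear.has_derivative[OF bounded_linear_Im has_derivative_ident]]
    by (simp add: mult.commute)
  ultimately show ?thesis
    unfolding K_def by (rule has_derivative_eq_rhs[OF has_derivative_mult]) (simp add: algebra_simps)
qed

end

text \<open>Cutoffs live on radius \<eta>, the estimates on radius \<open>2 * \<eta>\<close>, so
  that amplitudes are differentiable in a neighbourhood of the support. The condition
  \<open>small\<close> lets the derivative of a quotient vary by at most \<open>\<delta> / 2\<close>
  over the disc. Third derivatives are bounded because second derivatives of polynomials occur as
  amplitudes, and amplitudes are differentiated once.\<close>

locale transversal_disc =
  fixes z0 :: complex and \<eta> r \<delta> M :: real
  assumes pos: "0 < \<eta>" "0 < r" "0 < \<delta>" "0 < M"
    and r_le: "\<And>z. z \<in> ball z0 (2 * \<eta>) \<Longrightarrow> r \<le> cmod z"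
    and lt_1: "\<And>z. z \<in> ball z0 (2 * \<eta>) \<Longrightarrow> cmod z < 1"
    and transv: "\<And>z f. z \<in> ball z0 (2 * \<eta>) \<Longrightarrow> f \<in> sign_quotients \<Longrightarrow> cmod (poly f z) < \<delta> \<Longrightarrow>
      \<delta> < cmod (poly (pderiv f) z)"
    and bound0: "\<And>z p. z \<in> ball z0 (2 * \<eta>) \<Longrightarrow> (\<And>i. cmod (coeff p i) \<le> 1) \<Longrightarrow> cmod (poly p z) \<le> M"
    and bound1: "\<And>z p. z \<in> ball z0 (2 * \<eta>) \<Longrightarrow> (\<And>i. cmod (coeff p i) \<le> 1) \<Longrightarrow> cmod (poly (pderiv p) z) \<le> M"
    and bound2: "\<And>z p. z \<in> ball z0 (2 * \<eta>) \<Longrightarrow> (\<And>i. cmod (coeff p i) \<le> 1) \<Longrightarrow>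
      cmod (poly (pderiv (pderiv p)) z) \<le> M"
    and bound3: "\<And>z p. z \<in> ball z0 (2 * \<eta>) \<Longrightarrow> (\<And>i. cmod (coeff p i) \<le> 1) \<Longrightarrow>
      cmod (poly (pderiv (pderiv (pderiv p))) z) \<le> M"
    and small: "8 * \<eta> * M \<le> \<delta>"
begin

lemma r_lt_1: "r < 1"
  using r_le[of z0] lt_1[of z0] pos by simp

lemma sign_quotient_coeff_le: "f \<in> sign_quotients \<Longrightarrow> cmod (coeff f i) \<le> 1"
  unfolding sign_quotients_def by (auto dest!: spec[of _ i])

text \<open>At a point of the sublevel set the slope exceeds \<delta>, and over the disc it changes
  by at most \<open>\<delta> / 2\<close>. Hence \<open>f\<close> stretches distances from that point
  by at least \<open>\<delta> / 2\<close>, so two points of the set are at most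
  \<open>4 * \<epsilon> / \<delta>\<close> apart and the set fits into one small disc.\<close>

lemma sublevel_measure_le:
  assumes f: "f \<in> sign_quotients" and \<epsilon>: "0 \<le> \<epsilon>" "\<epsilon> < \<delta>"
  shows "{z \<in> ball z0 (2 * \<eta>). cmod (poly f z) \<le> \<epsilon>} \<in> sets lborel"
    and "measure lborel {z \<in> ball z0 (2 * \<eta>). cmod (poly f z) \<le> \<epsilon>} \<le> pi * (4 * \<epsilon> / \<delta>)\<^sup>2"
proof -
  let ?S = "{z \<in> ball z0 (2 * \<eta>). cmod (poly f z) \<le> \<epsilon>}"
  have "closed {z. cmod (poly f z) \<le> \<epsilon>}"
    by (intro closed_Collect_le continuous_intros)
  then have "ball z0 (2 * \<eta>) \<inter> {z. cmod (poly f z) \<le> \<epsilon>} \<in> sets borel"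
    by (intro sets.Int) auto
  then show meas: "?S \<in> sets lborel" by (simp add: Int_def)
  have dist: "cmod (z - w) \<le> 4 * \<epsilon> / \<delta>" if z: "z \<in> ?S" and w: "w \<in> ?S" for z w
  proof -
    define f' where "f' = poly (pderiv f)"
    have lip1: "cmod (f' x - f' w) \<le> \<delta> / 2" if x: "x \<in> ball z0 (2 * \<eta>)" for x
    proof -
      have "cmod (f' x - f' w) \<le> M * cmod (x - w)"
        unfolding f'_def
      proof (rule field_differentiable_bound[of "ball z0 (2 * \<eta>)"])
        show "(poly (pderiv f) has_field_derivative poly (pderiv (pderiv f)) y) (at y within ball z0 (2 * \<eta>))" for y
          by (rule DERIV_subset[OF poly_DERIV]) simp
      qed (use x w f bound2 sign_quotient_coeff_le in auto)
      also have "cmod (x - w) \<le> 4 * \<eta>"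
        using x w norm_triangle_ineq4[of "x - z0" "w - z0"] by (auto simp: dist_norm norm_minus_commute)
      then have "M * cmod (x - w) \<le> M * (4 * \<eta>)" using pos by (intro mult_left_mono) auto
      finally show ?thesis using small by (simp add: algebra_simps)
    qed
    have "cmod ((poly f z - f' w * z) - (poly f w - f' w * w)) \<le> \<delta> / 2 * cmod (z - w)"
    proof (rule field_differentiable_bound[of "ball z0 (2 * \<eta>)"])
      show "((\<lambda>x. poly f x - f' w * x) has_field_derivative f' y - f' w) (at y within ball z0 (2 * \<eta>))" for y
        unfolding f'_def by (auto intro!: derivative_eq_intros DERIV_subset[OF poly_DERIV])
    qed (use z w lip1 in auto)
    moreover have "(poly f z - f' w * z) - (poly f w - f' w * w) = (poly f z - poly f w) - f' w * (z - w)"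
      by (simp add: algebra_simps)
    ultimately have "cmod (f' w * (z - w)) \<le> \<delta> / 2 * cmod (z - w) + cmod (poly f z - poly f w)"
      using norm_triangle_ineq2[of "f' w * (z - w)" "poly f z - poly f w"]
      by (simp add: norm_minus_commute)
    moreover have "\<delta> * cmod (z - w) \<le> cmod (f' w * (z - w))"
      using transv[of w f] w f \<epsilon> unfolding f'_def norm_mult by (intro mult_right_mono) auto
    moreover have "cmod (poly f z - poly f w) \<le> 2 * \<epsilon>"
      using z w norm_triangle_ineq4[of "poly f z" "poly f w"] by auto
    ultimately have "\<delta> * cmod (z - w) \<le> 4 * \<epsilon>" by simp
    then show ?thesis using pos by (simp add: field_simps)
  qed
  show "measure lborel ?S \<le> pi * (4 * \<epsilon> / \<delta>)\<^sup>2"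
  proof (cases "?S = {}")
    case False
    then obtain w where w: "w \<in> ?S" by blast
    have r0: "0 \<le> 4 * \<epsilon> / \<delta>" using \<epsilon> pos by simp
    have sub: "?S \<subseteq> cball w (4 * \<epsilon> / \<delta>)" using dist w by (auto simp: dist_norm norm_minus_commute)
    have em: "emeasure lborel (cball w (4 * \<epsilon> / \<delta>)) = ennreal (pi * (4 * \<epsilon> / \<delta>)\<^sup>2)"
      using emeasure_cball[OF r0, of w] by (simp add: unit_ball_vol_2)
    have "emeasure lborel ?S \<le> ennreal (pi * (4 * \<epsilon> / \<delta>)\<^sup>2)"
      unfolding em[symmetric] by (rule emeasure_mono[OF sub]) simp
    then have "enn2real (emeasure lborel ?S) \<le> enn2real (ennreal (pi * (4 * \<epsilon> / \<delta>)\<^sup>2))"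
      by (intro enn2real_mono) auto
    then show ?thesis by (simp add: measure_def)
  next
    case True
    then have "measure lborel ?S = 0" by (simp only: measure_empty)
    then show ?thesis by simp
  qed
qed

text \<open>The factors \<open>z\<close> and \<open>z^2\<close> keep the common power
  \<open>z ^ k\<close> intact and avoid the exponents \<open>k - 1\<close> and \<open>k - 2\<close>
  on the right.\<close>

lemma scaled_quotient_derivatives:
  assumes "f \<in> sign_quotients" and P: "P = smult 2 (monom 1 k * f)"
  shows "cmod (poly P z) = 2 * cmod z ^ k * cmod (poly f z)"
    and "z * poly (pderiv P) z = 2 * z ^ k * (of_nat k * poly f z + z * poly (pderiv f) z)"
    and "z\<^sup>2 * poly (pderiv (pderiv P)) z = 2 * z ^ k * (of_nat (k * (k - 1)) * poly f z
      + 2 * of_nat k * z * poly (pderiv f) z + z\<^sup>2 * poly (pderiv (pderiv f)) z)"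
proof -
  show "cmod (poly P z) = 2 * cmod z ^ k * cmod (poly f z)"
    unfolding P by (simp add: poly_monom norm_mult norm_power)
  show "z * poly (pderiv P) z = 2 * z ^ k * (of_nat k * poly f z + z * poly (pderiv f) z)"
    unfolding P pderiv_smult pderiv_mult pderiv_monom
    by (cases k) (simp_all add: poly_monom algebra_simps)
  show "z\<^sup>2 * poly (pderiv (pderiv P)) z = 2 * z ^ k * (of_nat (k * (k - 1)) * poly f z
      + 2 * of_nat k * z * poly (pderiv f) z + z\<^sup>2 * poly (pderiv (pderiv f)) z)"
  proof -
    consider "k = 0" | "k = 1" | j where "k = Suc (Suc j)" by (metis One_nat_def not0_implies_Suc)
    then show ?thesis
      unfolding P pderiv_smult pderiv_mult pderiv_monom pderiv_add
      by cases (simp_all add: poly_monom power2_eq_square algebra_simps)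
  qed
qed

end

section \<open>Integration by parts against a transversal phase\<close>

lemma has_derivative_imp_directional:
  assumes "(g has_derivative D) (at z)"
  shows "((\<lambda>t. g (z + t *\<^sub>R e)) has_vector_derivative D e) (at 0)"
proof -
  interpret bounded_linear D by (rule has_derivative_bounded_linear[OF assms])
  have "((\<lambda>t. z + t *\<^sub>R e) has_derivative (\<lambda>t. t *\<^sub>R e)) (at 0)"
    by (auto intro!: derivative_eq_intros)
  then have "((\<lambda>t. g (z + t *\<^sub>R e)) has_derivative (\<lambda>t. D (t *\<^sub>R e))) (at 0)"
    by (rule has_derivative_compose) (use assms in simp)
  then show ?thesis by (simp add: has_vector_derivative_def scaleR)
qed

lemma directional_0_if_locally_0:
  fixes g :: "complex \<Rightarrow> complex"
  assumes "open S" "z \<in> S" "\<And>w. w \<in> S \<Longrightarrow> g w = 0"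
  shows "((\<lambda>t. g (z + t *\<^sub>R e)) has_vector_derivative 0) (at 0)"
proof -
  have "((\<lambda>_. 0) has_derivative (\<lambda>_. 0)) (at z)" by simp
  then have "(g has_derivative (\<lambda>_. 0)) (at z)"
    by (rule has_derivative_transform_within_open[OF _ assms(1,2)]) (use assms(3) in simp)
  then show ?thesis using has_derivative_imp_directional[of g "\<lambda>_. 0" z e] by simp
qed

locale oscillation = smooth_kernel u v + transversal_disc z0 \<eta> r \<delta> M
  for u v z0 \<eta> r \<delta> M
begin

text \<open>Integration by parts: with \<open>\<Phi> = poly P\<close> holomorphic and \<open>g = K i l\<close>, the operator
  \<open>\<partial>\<^sub>x + i \<partial>\<^sub>y\<close> maps \<open>g (y + \<Phi> / \<rho>)\<close> to \<open>cnj \<Phi>' / \<rho>\<close> times \<open>(g\<^sub>x + i g\<^sub>y) (y + \<Phi> / \<rho>)\<close>.  Hence the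
  integral of \<open>B (g\<^sub>x + i g\<^sub>y) (y + \<Phi> / \<rho>)\<close> gains a factor \<open>\<rho> / \<Phi>'\<close>.\<close>

lemma oscillatory_integral_aux:
  assumes il: "i + l \<le> 2" and f: "f \<in> sign_quotients" and P: "P = smult 2 (monom 1 k * f)"
    and \<rho>: "0 < \<rho>" and y: "cmod y \<le> 2"
    and fine: "real (k + 1) * \<rho> / r ^ k \<le> r * \<delta> / 4"
    and Bm[measurable]: "B \<in> borel_measurable borel"
    and dB: "\<And>z. z \<in> ball z0 (2 * \<eta>) \<Longrightarrow> (B has_derivative B' z) (at z)"
    and Bb: "\<And>z. z \<in> ball z0 (2 * \<eta>) \<Longrightarrow> \<bar>B z\<bar> \<le> b"
    and B'b: "\<And>z e. z \<in> ball z0 (2 * \<eta>) \<Longrightarrow> \<bar>B' z e\<bar> \<le> b * cmod e"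
    and B0: "\<And>z. \<eta> \<le> cmod (z - z0) \<Longrightarrow> B z = 0"
    and MK: "\<And>i l z. i \<le> 3 \<Longrightarrow> l \<le> 3 \<Longrightarrow> \<bar>K i l z\<bar> \<le> MK"
  defines "F \<equiv> (\<lambda>z. B z *\<^sub>R Complex (K (Suc i) l (y + poly P z / of_real \<rho>))
      (K i (Suc l) (y + poly P z / of_real \<rho>)))"
  shows "integrable lborel F"
    and "cmod (\<integral>z. F z \<partial>lborel)
      \<le> b * (MK * (4 * M / (r ^ 4 * \<delta>\<^sup>2) + 2 / (r * \<delta>)) * 64 * pi / \<delta>\<^sup>2) * (real (k + 1) * \<rho> / r ^ k) ^ 3"
proof -
  have ils: "i < 3" "l < 3" "i \<le> 3" "l \<le> 3" "Suc i \<le> 3" "Suc l \<le> 3" using il by auto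
  define D where "D = ball z0 (2 * \<eta>)"
  have z0D: "z0 \<in> D" using pos by (simp add: D_def)
  have b: "0 \<le> b" using Bb[of z0] z0D by (auto simp: D_def)
  have MK0: "0 \<le> MK" using MK[of 0 0 0] by auto
  note KM[measurable] = K_measurable[OF ils(3,4)] K_measurable[OF ils(5,4)] K_measurable[OF ils(3,6)]
  define Q where "Q = pderiv P"
  define Q' where "Q' = pderiv Q"
  define arg where "arg z = y + poly P z / of_real \<rho>" for z
  have arg_m[measurable]: "arg \<in> borel_measurable borel"
    unfolding arg_def by (intro borel_measurable_continuous_onI continuous_intros) (use \<rho> in auto)
  have Q_m[measurable]: "poly Q \<in> borel_measurable borel"
    by (intro borel_measurable_continuous_onI continuous_intros)
  \<comment> \<open>Since \<open>|y| \<le> 2\<close> and the kernels live in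
    \<open>|w| \<le> 2\<close>, they vanish where \<open>|P| > 4 * \<rho>\<close>. On
    \<open>S\<close> the inequality \<open>2 |z|^k |f| \<le> 4 * \<rho>\<close> gives
    \<open>|f| \<le> \<epsilon>\<close>, so transversality is at hand there.\<close>
  define S where "S = {z \<in> D. cmod (poly P z) \<le> 4 * \<rho>}"
  define \<epsilon> where "\<epsilon> = 2 * \<rho> / r ^ k"
  have \<epsilon>k: "real (k + 1) * \<epsilon> \<le> r * \<delta> / 2" using fine by (simp add: \<epsilon>_def field_simps)
  have \<epsilon>0: "0 \<le> \<epsilon>" using \<rho> pos by (simp add: \<epsilon>_def)
  have \<epsilon>k': "real k * \<epsilon> \<le> r * \<delta> / 2" "\<epsilon> \<le> r * \<delta> / 2"
  proof -
    have "0 \<le> real k * \<epsilon>" using \<epsilon>0 by simp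
    moreover have "real k * \<epsilon> + \<epsilon> \<le> r * \<delta> / 2" using \<epsilon>k by (simp add: distrib_right)
    ultimately show "real k * \<epsilon> \<le> r * \<delta> / 2" "\<epsilon> \<le> r * \<delta> / 2" using \<epsilon>0 by linarith+
  qed
  have "r * \<delta> / 2 < \<delta>" using r_lt_1 pos mult_strict_right_mono[of r 1 \<delta>] by simp
  then have \<epsilon>\<delta>: "\<epsilon> < \<delta>" using \<epsilon>k' by linarith
  have fS: "cmod (poly f z) \<le> \<epsilon>" if z: "z \<in> S" for z
  proof -
    have rk: "r ^ k \<le> cmod z ^ k" using r_le[of z] z pos by (intro power_mono) (auto simp: S_def D_def)
    have "2 * (r ^ k * cmod (poly f z)) \<le> 2 * (cmod z ^ k * cmod (poly f z))"
      using rk by (intro mult_left_mono mult_right_mono) auto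
    also have "\<dots> \<le> 4 * \<rho>"
      using z scaled_quotient_derivatives(1)[OF f P, of z] by (simp add: S_def)
    finally show ?thesis using pos by (simp add: \<epsilon>_def field_simps)
  qed
  \<comment> \<open>Here \<open>z P' = 2 z^k (k f + z f')\<close>. Transversality gives
    \<open>|z f'| \<ge> r * \<delta>\<close>, while \<open>fine\<close> keeps \<open>k |f|\<close>
    below \<open>r * \<delta> / 2\<close>, so the factor \<open>z^k\<close> cannot spoil the
    derivative by cancellation.\<close>
  have dQ: "r * \<delta> * cmod z ^ k \<le> cmod (poly Q z)" if z: "z \<in> S" for z
  proof -
    have zD: "z \<in> ball z0 (2 * \<eta>)" using z by (simp add: S_def D_def)
    have z1: "cmod z \<le> 1" "r \<le> cmod z" using lt_1[OF zD] r_le[OF zD] by auto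
    have "r * \<delta> \<le> cmod z * cmod (poly (pderiv f) z)"
      using transv[OF zD f] fS[OF z] \<epsilon>\<delta> z1 pos by (intro mult_mono) auto
    moreover have "real k * cmod (poly f z) \<le> r * \<delta> / 2"
      using mult_left_mono[OF fS[OF z], of "real k"] \<epsilon>k' by linarith
    moreover have "cmod (z * poly (pderiv f) z) - cmod (of_nat k * poly f z) \<le> cmod (of_nat k * poly f z + z * poly (pderiv f) z)"
      by (metis add.commute norm_diff_ineq)
    ultimately have "r * \<delta> / 2 \<le> cmod (of_nat k * poly f z + z * poly (pderiv f) z)"
      by (simp add: norm_mult)
    then have "2 * cmod z ^ k * (r * \<delta> / 2) \<le> 2 * cmod z ^ k * cmod (of_nat k * poly f z + z * poly (pderiv f) z)"
      by (intro mult_left_mono) auto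
    also have "\<dots> = cmod (z * poly Q z)"
      unfolding Q_def scaled_quotient_derivatives(2)[OF f P] by (simp add: norm_mult norm_power)
    also have "\<dots> \<le> cmod (poly Q z)"
      using z1 by (simp add: norm_mult mult_left_le_one_le)
    finally show ?thesis by (simp add: mult_ac)
  qed
  have dQ': "cmod (poly Q' z) \<le> 2 * cmod z ^ k * (M * (real (k + 1))\<^sup>2) / r\<^sup>2" if z: "z \<in> S" for z
  proof -
    have zD: "z \<in> ball z0 (2 * \<eta>)" using z by (simp add: S_def D_def)
    have z1: "cmod z \<le> 1" "r \<le> cmod z" using lt_1[OF zD] r_le[OF zD] by auto
    note c = sign_quotient_coeff_le[OF f]
    note bb = bound0[OF zD c] bound1[OF zD c] bound2[OF zD c]
    have "cmod (of_nat (k * (k - 1)) * poly f z + 2 * of_nat k * z * poly (pderiv f) z + z\<^sup>2 * poly (pderiv (pderiv f)) z)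
        \<le> real (k * (k - 1)) * M + 2 * real k * (1 * M) + 1 * M"
    proof (intro order.trans[OF norm_triangle_ineq] add_mono)
      show "cmod (of_nat (k * (k - 1)) * poly f z) \<le> real (k * (k - 1)) * M"
        unfolding norm_mult norm_of_nat using bb by (intro mult_left_mono) auto
      have "cmod z * cmod (poly (pderiv f) z) \<le> 1 * M" using bb z1 by (intro mult_mono) auto
      then show "cmod (2 * of_nat k * z * poly (pderiv f) z) \<le> 2 * real k * (1 * M)"
        by (simp add: norm_mult mult.assoc mult_left_mono)
      have "cmod (z\<^sup>2) \<le> 1" using z1 by (simp add: norm_power power_le_one)
      then show "cmod (z\<^sup>2 * poly (pderiv (pderiv f)) z) \<le> 1 * M"
        unfolding norm_mult using bb by (intro mult_mono) auto
    qed
    also have "\<dots> \<le> M * (real (k + 1))\<^sup>2"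
    proof -
      have "real (k * (k - 1)) + 2 * real k + 1 \<le> (real (k + 1))\<^sup>2"
        by (cases k) (simp_all add: power2_eq_square algebra_simps)
      then have "M * (real (k * (k - 1)) + 2 * real k + 1) \<le> M * (real (k + 1))\<^sup>2"
        using pos by (intro mult_left_mono) auto
      then show ?thesis by (simp add: algebra_simps)
    qed
    finally have "cmod (z\<^sup>2 * poly Q' z) \<le> 2 * cmod z ^ k * (M * (real (k + 1))\<^sup>2)"
      unfolding Q'_def Q_def scaled_quotient_derivatives(3)[OF f P] norm_mult[of "2 * z ^ k"]
      by (simp add: norm_mult norm_power mult_left_mono)
    moreover have "r\<^sup>2 * cmod (poly Q' z) \<le> cmod (z\<^sup>2 * poly Q' z)"
      unfolding norm_mult norm_power using z1 pos by (intro mult_right_mono power_mono) auto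
    ultimately show ?thesis using pos by (simp add: field_simps)
  qed
  have zS: "z \<noteq> 0" "0 < cmod z ^ k" "r ^ k \<le> cmod z ^ k" if "z \<in> S" for z
  proof -
    have "r \<le> cmod z" using r_le[of z] that by (simp add: S_def D_def)
    moreover from this have "0 < cmod z" using pos by linarith
    ultimately show "z \<noteq> 0" "0 < cmod z ^ k" "r ^ k \<le> cmod z ^ k" using pos by (auto intro: power_mono)
  qed
  have Q0: "poly Q z \<noteq> 0" if z: "z \<in> S" for z
  proof
    assume "poly Q z = 0"
    with dQ[OF z] have "r * \<delta> * cmod z ^ k \<le> 0" by simp
    moreover have "0 < r * \<delta> * cmod z ^ k" using pos zS[OF z] by simp
    ultimately show False by linarith
  qed
  \<comment> \<open>The factor \<open>(k + 1)^2\<close> is inserted to match the one that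
    \<open>Q' / Q^2\<close> produces, so that both bounds share the constant
    \<open>N\<close>.\<close>
  have inv1: "1 / cmod (poly Q z) \<le> (real (k + 1))\<^sup>2 * (1 / (r * \<delta>)) / r ^ k" if z: "z \<in> S" for z
  proof -
    have "r * \<delta> * r ^ k \<le> r * \<delta> * cmod z ^ k"
      using zS[OF z] pos by (intro mult_left_mono) auto
    also note dQ[OF z]
    finally have "1 / cmod (poly Q z) \<le> 1 / (r * \<delta> * r ^ k)"
      using pos Q0[OF z] by (intro divide_left_mono mult_pos_pos) auto
    also have "\<dots> \<le> (real (k + 1))\<^sup>2 * (1 / (r * \<delta> * r ^ k))"
      using pos mult_right_mono[of 1 "(real (k + 1))\<^sup>2" "1 / (r * \<delta> * r ^ k)"] by (simp add: one_le_power)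
    finally show ?thesis by simp
  qed
  have inv2: "cmod (poly Q' z) / (cmod (poly Q z))\<^sup>2 \<le> (real (k + 1))\<^sup>2 * (2 * M / (r ^ 4 * \<delta>\<^sup>2)) / r ^ k"
    if z: "z \<in> S" for z
  proof -
    have "cmod (poly Q' z) / (cmod (poly Q z))\<^sup>2
        \<le> (2 * cmod z ^ k * (M * (real (k + 1))\<^sup>2) / r\<^sup>2) / (r * \<delta> * cmod z ^ k)\<^sup>2"
      using dQ[OF z] dQ'[OF z] pos zS[OF z] Q0[OF z]
      by (intro frac_le power_mono zero_less_power) auto
    also have "\<dots> = (real (k + 1))\<^sup>2 * (2 * M / (r ^ 4 * \<delta>\<^sup>2)) / cmod z ^ k"
      using pos zS[OF z] by (simp add: field_simps power2_eq_square numeral_eq_Suc)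
    also have "\<dots> \<le> (real (k + 1))\<^sup>2 * (2 * M / (r ^ 4 * \<delta>\<^sup>2)) / r ^ k"
      using pos zS[OF z] by (intro divide_left_mono) auto
    finally show ?thesis .
  qed
  have K0: "K i' l' (arg z) = 0" if "i' \<le> 3" "l' \<le> 3" "4 * \<rho> < cmod (poly P z)" for i' l' z
  proof (rule K_eq_0[OF that(1,2)])
    have "cmod (poly P z / of_real \<rho>) = cmod (poly P z) / \<rho>" using \<rho> by (simp add: norm_divide)
    moreover have "4 < cmod (poly P z) / \<rho>" using that \<rho> by (simp add: field_simps)
    ultimately show "2 < cmod (arg z)"
      using norm_diff_ineq[of "poly P z / of_real \<rho>" y] y unfolding arg_def by (simp add: add.commute)
  qed
  define G where "G z = K i l (arg z)" for z
  define G' where "G' z e = K (Suc i) l (arg z) * Re (poly Q z * e / of_real \<rho>)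
      + K i (Suc l) (arg z) * Im (poly Q z * e / of_real \<rho>)" for z e
  have [measurable]: "G \<in> borel_measurable borel" unfolding G_def by (rule measurable_compose[OF arg_m KM(1)])
  have dG: "(G has_derivative G' z) (at z)" for z
  proof -
    have "(poly P has_field_derivative poly Q z) (at z)" unfolding Q_def by (rule poly_DERIV)
    then have "(arg has_field_derivative poly Q z / of_real \<rho>) (at z)"
      unfolding arg_def using \<rho> by (auto intro!: derivative_eq_intros simp: Q_def)
    moreover have "(*) (poly Q z / of_real \<rho>) = (\<lambda>h. poly Q z * h / of_real \<rho>)" by (simp add: fun_eq_iff)
    ultimately have "(arg has_derivative (\<lambda>h. poly Q z * h / of_real \<rho>)) (at z)"
      unfolding has_field_derivative_def by simp
    then show ?thesis
      unfolding G_def G'_def by (rule has_derivative_compose) (rule K_has_derivative[OF ils(1,2)])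
  qed
  \<comment> \<open>The field to which the operator of the integration by parts is applied. Its
    factor \<open>cnj (1 / Q)\<close> is antiholomorphic: the operator does not annihilate it but
    produces \<open>2 * cnj ((1 / Q)')\<close>, the first summand of the remainder below.\<close>
  define W where "W z = of_real (B z * G z) * cnj (inverse (poly Q z))" for z
  define E where "E e z = (if z \<in> S then of_real (B z * G z) * cnj (- (poly Q' z * e) / (poly Q z)\<^sup>2)
      + of_real (B z * G' z e + B' z e * G z) * cnj (inverse (poly Q z)) else 0)" for e z
  have dW: "((\<lambda>t. W (z + t *\<^sub>R e)) has_vector_derivative E e z) (at 0)" for e z
  proof (cases "z \<in> S")
    case True
    have zD: "z \<in> ball z0 (2 * \<eta>)" using True by (simp add: S_def D_def)
    have "((\<lambda>z. inverse (poly Q z)) has_field_derivative - (poly Q' z) / (poly Q z)\<^sup>2) (at z)"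
      unfolding Q'_def using Q0[OF True]
      by (auto intro!: derivative_eq_intros poly_DERIV simp: power2_eq_square field_simps)
    moreover have "(*) (- (poly Q' z) / (poly Q z)\<^sup>2) = (\<lambda>h. - (poly Q' z * h) / (poly Q z)\<^sup>2)"
      by (simp add: fun_eq_iff)
    ultimately have "((\<lambda>z. inverse (poly Q z)) has_derivative (\<lambda>h. - (poly Q' z * h) / (poly Q z)\<^sup>2)) (at z)"
      unfolding has_field_derivative_def by simp
    then have 1: "((\<lambda>z. cnj (inverse (poly Q z))) has_derivative (\<lambda>h. cnj (- (poly Q' z * h) / (poly Q z)\<^sup>2))) (at z)"
      by (rule bounded_linear.has_derivative[OF bounded_linear_cnj])
    have 2: "((\<lambda>z. of_real (B z * G z) :: complex) has_derivative (\<lambda>h. of_real (B z * G' z h + B' z h * G z))) (at z)"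
      by (rule bounded_linear.has_derivative[OF bounded_linear_of_real has_derivative_mult[OF dB[OF zD] dG]])
    show ?thesis
      using has_derivative_imp_directional[OF has_derivative_mult[OF 2 1], of e] True
      unfolding W_def E_def by simp
  next
    case False
    \<comment> \<open>Off \<open>S\<close> either the amplitude or the kernel vanishes on a whole
      neighbourhood, hence so does \<open>W\<close>; zeros of \<open>Q\<close> outside
      \<open>S\<close> are harmless, whatever value \<open>inverse\<close> takes there.\<close>
    define T where "T = - cball z0 \<eta> \<union> {z. 4 * \<rho> < cmod (poly P z)}"
    have "open {z. 4 * \<rho> < cmod (poly P z)}"
      by (intro open_Collect_less continuous_intros)
    then have "open T" by (simp add: T_def open_Un open_Compl)
    moreover have "z \<in> T" using False pos by (auto simp: T_def S_def D_def)
    moreover have "W w = 0" if "w \<in> T" for w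
      using that B0[of w] K0[OF ils(3,4), of w] by (auto simp: W_def T_def G_def dist_norm norm_minus_commute)
    ultimately show ?thesis using directional_0_if_locally_0[of T z W e] False by (simp add: E_def)
  qed
  have [measurable]: "cnj \<in> borel_measurable borel"
    by (intro borel_measurable_continuous_onI continuous_intros)
  have W_m: "W \<in> borel_measurable borel" unfolding W_def by measurable
  define N where "N = (real (k + 1))\<^sup>2 / r ^ k"
  have N0: "0 \<le> N" using pos by (simp add: N_def)
  have Gb: "\<bar>G z\<bar> \<le> MK" for z unfolding G_def using MK ils by blast
  have BS: "\<bar>B z\<bar> \<le> b" "cmod (of_real (B' z 1) + \<i> * of_real (B' z \<i>)) \<le> 2 * b" "\<bar>B' z e\<bar> \<le> b * cmod e"
    if "z \<in> S" for z e
  proof -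
    have zD: "z \<in> ball z0 (2 * \<eta>)" using that by (simp add: S_def D_def)
    show "\<bar>B z\<bar> \<le> b" "\<bar>B' z e\<bar> \<le> b * cmod e" by (rule Bb[OF zD], rule B'b[OF zD])
    have "cmod (of_real (B' z 1) + \<i> * of_real (B' z \<i>)) \<le> \<bar>B' z 1\<bar> + \<bar>B' z \<i>\<bar>"
      by (rule order.trans[OF norm_triangle_ineq]) (simp add: norm_mult)
    then show "cmod (of_real (B' z 1) + \<i> * of_real (B' z \<i>)) \<le> 2 * b"
      using B'b[OF zD, of 1] B'b[OF zD, of \<i>] by simp
  qed
  define c1 where "c1 = 1 / (r * \<delta>)"
  define c2 where "c2 = 2 * M / (r ^ 4 * \<delta>\<^sup>2)"
  have c0: "0 \<le> c1" "0 \<le> c2" using pos by (simp_all add: c1_def c2_def)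
  have i1: "cmod (cnj (inverse (poly Q z))) \<le> N * c1"
    and i2: "cmod (cnj (- (poly Q' z * e) / (poly Q z)\<^sup>2)) \<le> N * c2 * cmod e" if "z \<in> S" for z e
  proof -
    show "cmod (cnj (inverse (poly Q z))) \<le> N * c1"
      using inv1[OF that] unfolding complex_mod_cnj norm_inverse
      by (simp add: N_def c1_def inverse_eq_divide mult_ac)
    have "cmod (cnj (- (poly Q' z * e) / (poly Q z)\<^sup>2)) = cmod (poly Q' z) / (cmod (poly Q z))\<^sup>2 * cmod e"
      by (simp add: norm_divide norm_mult norm_power)
    also have "\<dots> \<le> N * c2 * cmod e"
      using inv2[OF that] by (intro mult_right_mono) (simp_all add: N_def c2_def mult_ac)
    finally show "cmod (cnj (- (poly Q' z * e) / (poly Q z)\<^sup>2)) \<le> N * c2 * cmod e" .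
  qed
  have BG: "\<bar>B z * G z\<bar> \<le> b * MK" if "z \<in> S" for z
    unfolding abs_mult using BS(1)[OF that] Gb b by (intro mult_mono) auto
  have notS: "B z = 0 \<or> 4 * \<rho> < cmod (poly P z)" if "z \<notin> S" for z
  proof (cases "z \<in> D")
    case False
    then have "\<eta> \<le> cmod (z - z0)" using pos by (simp add: D_def dist_norm norm_minus_commute)
    then show ?thesis using B0 by blast
  qed (use that in \<open>auto simp: S_def\<close>)
  have W_le: "cmod (W z) \<le> b * MK * (N * c1)" for z
  proof (cases "z \<in> S")
    case True
    have "cmod (W z) = \<bar>B z * G z\<bar> * cmod (cnj (inverse (poly Q z)))"
      unfolding W_def norm_mult norm_of_real ..
    also have "\<dots> \<le> b * MK * (N * c1)"
      using BG[OF True] i1[OF True] b MK0 by (intro mult_mono) auto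
    finally show ?thesis .
  next
    case False
    then have "W z = 0" using notS[OF False] K0[OF ils(3,4), of z] by (auto simp: W_def G_def)
    then show ?thesis using b MK0 N0 c0 by simp
  qed
  have E_le: "cmod (E e z) \<le> b * MK * (N * c2) + (2 * b * MK / \<rho> + b * MK * (N * c1))"
    if e: "cmod e = 1" for e z
  proof (cases "z \<in> S")
    case True
    have t1: "cmod (of_real (B z * G z) * cnj (- (poly Q' z * e) / (poly Q z)\<^sup>2)) \<le> b * MK * (N * c2)"
      unfolding norm_mult[of "of_real (B z * G z)"] norm_of_real
      using BG[OF True] i2[OF True, of e] e b MK0 by (intro mult_mono) auto
    have qe: "cmod (poly Q z * e / of_real \<rho>) = cmod (poly Q z) / \<rho>"
      using e \<rho> by (simp add: norm_mult norm_divide)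
    have "\<bar>G' z e\<bar> \<le> MK * (cmod (poly Q z) / \<rho>) + MK * (cmod (poly Q z) / \<rho>)"
      unfolding G'_def
      by (rule order.trans[OF abs_triangle_ineq], unfold abs_mult qe[symmetric])
         (intro add_mono mult_mono MK ils abs_Re_le_cmod abs_Im_le_cmod MK0 abs_ge_zero)
    then have "\<bar>B z\<bar> * \<bar>G' z e\<bar> \<le> b * (MK * (cmod (poly Q z) / \<rho>) + MK * (cmod (poly Q z) / \<rho>))"
      using BS(1)[OF True] b by (intro mult_mono) auto
    then have "\<bar>B z * G' z e\<bar> * cmod (cnj (inverse (poly Q z)))
        \<le> b * (MK * (cmod (poly Q z) / \<rho>) + MK * (cmod (poly Q z) / \<rho>)) * cmod (cnj (inverse (poly Q z)))"
      unfolding abs_mult by (rule mult_right_mono) simp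
    also have "\<dots> = 2 * b * MK / \<rho>"
      unfolding complex_mod_cnj norm_inverse using Q0[OF True] \<rho> by (simp add: field_simps)
    finally have t2: "\<bar>B z * G' z e\<bar> * cmod (cnj (inverse (poly Q z))) \<le> 2 * b * MK / \<rho>" .
    have "\<bar>B' z e * G z\<bar> \<le> b * MK"
      unfolding abs_mult using BS(3)[OF True, of e] Gb[of z] e b by (intro mult_mono) auto
    then have t3: "\<bar>B' z e * G z\<bar> * cmod (cnj (inverse (poly Q z))) \<le> b * MK * (N * c1)"
      using i1[OF True] b MK0 by (intro mult_mono) auto
    have "cmod (of_real (B z * G' z e + B' z e * G z) * cnj (inverse (poly Q z)))
        \<le> (\<bar>B z * G' z e\<bar> + \<bar>B' z e * G z\<bar>) * cmod (cnj (inverse (poly Q z)))"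
      unfolding norm_mult norm_of_real by (intro mult_right_mono abs_triangle_ineq) simp
    also have "\<dots> \<le> 2 * b * MK / \<rho> + b * MK * (N * c1)"
      using t2 t3 by (simp add: distrib_right)
    finally show ?thesis
      using True t1 unfolding E_def by (simp only: if_True) (intro order.trans[OF norm_triangle_ineq] add_mono)
  next
    case False
    then show ?thesis using b MK0 N0 c0 \<rho> by (simp add: E_def)
  qed
  have W0: "W z = 0" if "cmod z0 + \<eta> < cmod z" for z
  proof -
    have "\<eta> \<le> cmod (z - z0)" using that norm_triangle_ineq2[of z z0] by linarith
    then show ?thesis using B0 by (simp add: W_def)
  qed
  have Ei: "integrable lborel (E e)" "(\<integral>z. E e z \<partial>lborel) = 0" if "cmod e = 1" for e
    using integral_directional_derivative_eq_0[OF dW W_m W_le E_le[OF that] W0] that by auto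
  have F0: "F z = 0" if "z \<notin> S" for z
    using notS[OF that] K0[of _ _ z] ils unfolding F_def arg_def[symmetric] by (auto simp: complex_eq_iff)
  have KK: "cmod (Complex (K (Suc i) l w) (K i (Suc l) w)) \<le> 2 * MK" for w
    using cmod_le[of "Complex (K (Suc i) l w) (K i (Suc l) w)"] MK[OF ils(5,4), of w] MK[OF ils(3,6), of w] by simp
  have Fm[measurable]: "F \<in> borel_measurable lborel"
  proof -
    have "(\<lambda>z. K (Suc i) l (arg z)) \<in> borel_measurable borel" "(\<lambda>z. K i (Suc l) (arg z)) \<in> borel_measurable borel"
      by (rule measurable_compose[OF arg_m KM(2)], rule measurable_compose[OF arg_m KM(3)])
    then show ?thesis unfolding F_def arg_def[symmetric] Complex_eq by simp
  qed
  have finite_D: "emeasure lborel D < \<infinity>" unfolding D_def by (rule emeasure_bounded_finite) simp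
  show Fi: "integrable lborel F"
  proof (rule integrableI_bounded_set[where A = D and B = "b * (2 * MK)"])
    show "AE z\<in>D in lborel. norm (F z) \<le> b * (2 * MK)"
      unfolding F_def norm_scaleR using Bb KK b by (intro AE_I2 impI mult_mono) (auto simp: D_def)
    show "AE z in lborel. z \<notin> D \<longrightarrow> F z = 0" using F0 by (auto simp: S_def)
  qed (use finite_D in \<open>auto simp: D_def\<close>)
  \<comment> \<open>What the operator leaves besides the main term. As the derivatives
    \<open>E\<close> integrate to zero, \<open>\<integral> F = - \<rho> * \<integral> R\<close>. The
    bound on \<open>R\<close> carries \<open>(k + 1)^2 / r^k\<close> and the area of its support
    carries \<open>(\<rho> / r^k)^2\<close>; with the outer \<rho> this makes the cube of
    \<open>\<rho> / r^k\<close>.\<close>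
  define R where "R z = E 1 z + \<i> * E \<i> z - F z / of_real \<rho>" for z
  define C where "C = b * MK * (2 * c2 + 2 * c1) * N"
  have C0: "0 \<le> C" unfolding C_def using b MK0 c0 N0 by (intro mult_nonneg_nonneg add_nonneg_nonneg) auto
  have R_le: "cmod (R z) \<le> C * indicator S z" for z
  proof (cases "z \<in> S")
    case True
    define q where "q = poly Q z"
    have q: "q \<noteq> 0" using Q0[OF True] by (simp add: q_def)
    have key: "of_real (G' z 1) + \<i> * of_real (G' z \<i>)
        = Complex (K (Suc i) l (arg z)) (K i (Suc l) (arg z)) * (cnj q / of_real \<rho>)"
      unfolding G'_def q_def[symmetric] by (simp add: complex_eq_iff Re_divide_of_real Im_divide_of_real
          add_divide_distrib diff_divide_distrib algebra_simps)
    have "(of_real (B z) * (of_real (G' z 1) + \<i> * of_real (G' z \<i>))) * cnj (inverse q) = F z / of_real \<rho>"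
      unfolding key F_def arg_def[symmetric] using q by (simp add: scaleR_conv_of_real)
    then have "R z = 2 * (of_real (B z * G z) * cnj (- (poly Q' z * 1) / q\<^sup>2))
        + (of_real (B' z 1) + \<i> * of_real (B' z \<i>)) * of_real (G z) * cnj (inverse q)"
      unfolding R_def E_def using True by (simp add: q_def[symmetric] algebra_simps)
    also have "cmod \<dots> \<le> 2 * (b * MK * (N * c2)) + 2 * b * MK * (N * c1)"
    proof (intro order.trans[OF norm_triangle_ineq] add_mono)
      show "cmod (2 * (of_real (B z * G z) * cnj (- (poly Q' z * 1) / q\<^sup>2))) \<le> 2 * (b * MK * (N * c2))"
        unfolding norm_mult[of 2] norm_mult[of "of_real (B z * G z)"] norm_of_real
        using BG[OF True] i2[OF True, of 1] b MK0 unfolding q_def by (intro mult_mono) auto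
      show "cmod ((of_real (B' z 1) + \<i> * of_real (B' z \<i>)) * of_real (G z) * cnj (inverse q)) \<le> 2 * b * MK * (N * c1)"
        unfolding norm_mult norm_of_real q_def
        using BS(2)[OF True] Gb i1[OF True] b MK0 by (intro mult_mono mult_nonneg_nonneg) auto
    qed
    finally show ?thesis using True by (simp add: C_def algebra_simps)
  next
    case False
    then show ?thesis using F0 by (simp add: R_def E_def)
  qed
  have Ri: "integrable lborel R" unfolding R_def using Ei Fi by simp
  have "(\<integral>z. R z \<partial>lborel) = - (\<integral>z. F z \<partial>lborel) / of_real \<rho>"
    unfolding R_def using Ei Fi by simp
  then have "cmod (\<integral>z. F z \<partial>lborel) = \<rho> * cmod (\<integral>z. R z \<partial>lborel)"
    using \<rho> by (simp add: norm_divide)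
  also have "cmod (\<integral>z. R z \<partial>lborel) \<le> C * (pi * (4 * \<epsilon> / \<delta>)\<^sup>2)"
  proof -
    define S' where "S' = {z \<in> ball z0 (2 * \<eta>). cmod (poly f z) \<le> \<epsilon>}"
    note sub = sublevel_measure_le[OF f \<epsilon>0 \<epsilon>\<delta>, folded S'_def]
    have fin: "emeasure lborel S' < \<infinity>"
      by (rule emeasure_bounded_finite) (auto simp: S'_def intro: bounded_subset[of "ball z0 (2 * \<eta>)"])
    have "cmod (\<integral>z. R z \<partial>lborel) \<le> (\<integral>z. C * indicator S' z \<partial>lborel)"
    proof (rule Bochner_Integration.integral_norm_bound_integral[OF Ri])
      show "integrable lborel (\<lambda>z. C * indicator S' z)" using sub(1) fin by simp
      show "cmod (R z) \<le> C * indicator S' z" for z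
        using R_le[of z] fS[of z] C0 by (cases "z \<in> S") (auto simp: S'_def S_def D_def indicator_def)
    qed
    also have "\<dots> = C * measure lborel S'" using sub(1) by simp
    also have "\<dots> \<le> C * (pi * (4 * \<epsilon> / \<delta>)\<^sup>2)" using sub(2) C0 by (rule mult_left_mono)
    finally show ?thesis .
  qed
  finally have "cmod (\<integral>z. F z \<partial>lborel) \<le> \<rho> * (C * (pi * (4 * \<epsilon> / \<delta>)\<^sup>2))"
    using \<rho> by simp
  also have "\<dots> = b * (MK * (2 * c2 + 2 * c1) * 64 * pi / \<delta>\<^sup>2) * ((real (k + 1))\<^sup>2 * (\<rho> / r ^ k) ^ 3)"
    using pos by (simp add: C_def N_def \<epsilon>_def power2_eq_square power3_eq_cube mult_ac)
  also have "\<dots> \<le> b * (MK * (2 * c2 + 2 * c1) * 64 * pi / \<delta>\<^sup>2) * (real (k + 1) * \<rho> / r ^ k) ^ 3"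
  proof (rule mult_left_mono)
    have "(real (k + 1))\<^sup>2 * (\<rho> / r ^ k) ^ 3 \<le> (real (k + 1)) ^ 3 * (\<rho> / r ^ k) ^ 3"
      using \<rho> pos by (intro mult_right_mono power_increasing) auto
    also have "\<dots> = (real (k + 1) * \<rho> / r ^ k) ^ 3" by (simp add: power_mult_distrib power_divide)
    finally show "(real (k + 1))\<^sup>2 * (\<rho> / r ^ k) ^ 3 \<le> (real (k + 1) * \<rho> / r ^ k) ^ 3" .
    show "0 \<le> b * (MK * (2 * c2 + 2 * c1) * 64 * pi / \<delta>\<^sup>2)"
      using b MK0 c0 by (intro mult_nonneg_nonneg divide_nonneg_nonneg add_nonneg_nonneg) auto
  qed
  finally show "cmod (\<integral>z. F z \<partial>lborel)
      \<le> b * (MK * (4 * M / (r ^ 4 * \<delta>\<^sup>2) + 2 / (r * \<delta>)) * 64 * pi / \<delta>\<^sup>2) * (real (k + 1) * \<rho> / r ^ k) ^ 3"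
    by (simp add: c1_def c2_def)
qed

text \<open>A single constant \<open>b\<close> bounds value and gradient, so that the oscillatory
  estimate is linear in \<open>b\<close>.\<close>

definition cutoff_amplitude :: "real \<Rightarrow> (complex \<Rightarrow> real) \<Rightarrow> bool" where
  "cutoff_amplitude b B \<longleftrightarrow> B \<in> borel_measurable borel \<and> (\<forall>z. \<eta> \<le> cmod (z - z0) \<longrightarrow> B z = 0) \<and>
     (\<exists>B'. \<forall>z\<in>ball z0 (2 * \<eta>). (B has_derivative B' z) (at z) \<and> \<bar>B z\<bar> \<le> b \<and> (\<forall>e. \<bar>B' z e\<bar> \<le> b * cmod e))"

lemma cutoff_amplitude_le: "cutoff_amplitude b B \<Longrightarrow> \<bar>B z\<bar> \<le> b"
proof (cases "z \<in> ball z0 (2 * \<eta>)")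
  case False
  assume *: "cutoff_amplitude b B"
  have "z0 \<in> ball z0 (2 * \<eta>)" using pos by simp
  with * have "0 \<le> b" unfolding cutoff_amplitude_def by (meson abs_ge_zero order.trans)
  moreover have "\<eta> \<le> cmod (z - z0)" using False pos by (simp add: dist_norm norm_minus_commute)
  ultimately show ?thesis using * unfolding cutoff_amplitude_def by simp
qed (auto simp: cutoff_amplitude_def)

lemma cutoff_amplitude_nonneg: "cutoff_amplitude b B \<Longrightarrow> 0 \<le> b"
  using cutoff_amplitude_le[of b B z0] by (rule order.trans[OF abs_ge_zero])

text \<open>For small \<open>X = (k + 1) * \<rho> / r ^ k\<close> integration by parts gives
  \<open>X ^ 3\<close>, which is at most \<open>X powr \<beta>\<close> because
  \<open>\<beta> \<le> 3\<close>; for large \<open>X\<close> the trivial bound is enough, as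
  \<open>(X / c3) powr \<beta> \<ge> 1\<close>. The weaker power is what can be summed over
  \<open>k\<close> against \<open>2 ^ -k\<close>.\<close>

lemma oscillatory_integral_bound:
  assumes \<beta>: "0 \<le> \<beta>" "\<beta> \<le> 3"
  obtains C where "0 < C"
    "\<forall>i l f k \<rho> y b B. 1 \<le> i + l \<longrightarrow> i + l \<le> 3 \<longrightarrow> f \<in> sign_quotients \<longrightarrow> 0 < \<rho> \<longrightarrow> cmod y \<le> 2 \<longrightarrow>
      cutoff_amplitude b B \<longrightarrow>
      \<bar>\<integral>z. B z * K i l (y + poly (smult 2 (monom 1 k * f)) z / of_real \<rho>) \<partial>lborel\<bar>
        \<le> C * b * (real (k + 1) * \<rho> / r ^ k) powr \<beta>"
proof -
  obtain MK where MK: "0 < MK" "\<And>i l z. i \<le> 3 \<Longrightarrow> l \<le> 3 \<Longrightarrow> \<bar>K i l z\<bar> \<le> MK"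
    using K_bounded by blast
  define D where "D = ball z0 (2 * \<eta>)"
  define A where "A = measure lborel D"
  have finite_D: "emeasure lborel D < \<infinity>" unfolding D_def by (rule emeasure_bounded_finite) simp
  define c0 where "c0 = r * \<delta> / 4"
  define C1 where "C1 = MK * (4 * M / (r ^ 4 * \<delta>\<^sup>2) + 2 / (r * \<delta>)) * 64 * pi / \<delta>\<^sup>2"
  \<comment> \<open>Below \<open>c0\<close> the scale is fine enough for the integration by parts,
    below 1 the cube is dominated by the power \<beta>.\<close>
  define c3 where "c3 = min c0 1"
  define C2 where "C2 = MK * A / c3 powr \<beta>"
  have c0: "0 < c0" "0 < c3" using pos by (simp_all add: c0_def c3_def)
  have C1: "0 < C1" unfolding C1_def using pos MK(1)
    by (intro divide_pos_pos mult_pos_pos add_pos_pos) auto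
  have A: "0 \<le> A" by (simp add: A_def)
  have C2: "0 \<le> C2" unfolding C2_def using MK(1) A c0 by (intro divide_nonneg_nonneg mult_nonneg_nonneg) auto
  show ?thesis
  proof
    show "0 < C1 + C2" using C1 C2 by linarith
    show "\<forall>i l f k \<rho> y b B. 1 \<le> i + l \<longrightarrow> i + l \<le> 3 \<longrightarrow> f \<in> sign_quotients \<longrightarrow> 0 < \<rho> \<longrightarrow> cmod y \<le> 2 \<longrightarrow>
      cutoff_amplitude b B \<longrightarrow>
      \<bar>\<integral>z. B z * K i l (y + poly (smult 2 (monom 1 k * f)) z / of_real \<rho>) \<partial>lborel\<bar>
        \<le> (C1 + C2) * b * (real (k + 1) * \<rho> / r ^ k) powr \<beta>"
    proof (intro allI impI)
    fix i l k :: nat and \<rho> b :: real and y :: complex and f :: "complex poly" and B :: "complex \<Rightarrow> real"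
    assume il: "1 \<le> i + l" "i + l \<le> 3" and f: "f \<in> sign_quotients" and \<rho>: "0 < \<rho>" and y: "cmod y \<le> 2"
      and B: "cutoff_amplitude b B"
    define P where "P = smult 2 (monom 1 k * f)"
    define X where "X = real (k + 1) * \<rho> / r ^ k"
    have X: "0 < X" using \<rho> pos by (simp add: X_def)
    have b: "0 \<le> b" using cutoff_amplitude_nonneg[OF B] .
    let ?I = "\<integral>z. B z * K i l (y + poly P z / of_real \<rho>) \<partial>lborel"
    have "\<bar>?I\<bar> \<le> (C1 + C2) * b * X powr \<beta>"
    proof (cases "X \<le> c3")
      case True
      then have fine: "real (k + 1) * \<rho> / r ^ k \<le> r * \<delta> / 4" by (simp add: X_def c3_def c0_def)
      obtain B' where B': "B \<in> borel_measurable borel"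
        "\<And>z. z \<in> ball z0 (2 * \<eta>) \<Longrightarrow> (B has_derivative B' z) (at z)"
        "\<And>z. z \<in> ball z0 (2 * \<eta>) \<Longrightarrow> \<bar>B z\<bar> \<le> b"
        "\<And>z e. z \<in> ball z0 (2 * \<eta>) \<Longrightarrow> \<bar>B' z e\<bar> \<le> b * cmod e"
        "\<And>z. \<eta> \<le> cmod (z - z0) \<Longrightarrow> B z = 0"
        using B unfolding cutoff_amplitude_def by blast
      \<comment> \<open>The complex integral controls both first derivatives of a kernel at once: a
        real derivative is read off from its real part, an imaginary one from its imaginary
        part.\<close>
      have "\<bar>?I\<bar> \<le> b * C1 * X ^ 3"
      proof (cases i)
        case (Suc j)
        have j: "j + l \<le> 2" using il Suc by simp
        define F where "F = (\<lambda>z. B z *\<^sub>R Complex (K (Suc j) l (y + poly P z / of_real \<rho>))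
            (K j (Suc l) (y + poly P z / of_real \<rho>)))"
        have osc: "integrable lborel F" "cmod (\<integral>z. F z \<partial>lborel) \<le> b * C1 * X ^ 3"
          unfolding F_def C1_def X_def
          by (rule oscillatory_integral_aux[OF j f P_def \<rho> y fine B' MK(2)]; assumption)+
        have "(\<integral>z. Re (F z) \<partial>lborel) = ?I" by (simp add: F_def Suc)
        then have "Re (\<integral>z. F z \<partial>lborel) = ?I" by (simp only: integral_Re[OF osc(1)])
        then have "\<bar>?I\<bar> \<le> cmod (\<integral>z. F z \<partial>lborel)" using abs_Re_le_cmod[of "\<integral>z. F z \<partial>lborel"] by simp
        also note osc(2)
        finally show ?thesis .
      next
        case 0
        then obtain m where m: "l = Suc m" using il by (cases l) auto
        have j: "0 + m \<le> 2" using il m 0 by simp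
        define F where "F = (\<lambda>z. B z *\<^sub>R Complex (K (Suc 0) m (y + poly P z / of_real \<rho>))
            (K 0 (Suc m) (y + poly P z / of_real \<rho>)))"
        have osc: "integrable lborel F" "cmod (\<integral>z. F z \<partial>lborel) \<le> b * C1 * X ^ 3"
          unfolding F_def C1_def X_def
          by (rule oscillatory_integral_aux[OF j f P_def \<rho> y fine B' MK(2)]; assumption)+
        have "(\<integral>z. Im (F z) \<partial>lborel) = ?I" by (simp add: F_def m 0)
        then have "Im (\<integral>z. F z \<partial>lborel) = ?I" by (simp only: integral_Im[OF osc(1)])
        then have "\<bar>?I\<bar> \<le> cmod (\<integral>z. F z \<partial>lborel)" using abs_Im_le_cmod[of "\<integral>z. F z \<partial>lborel"] by simp
        also note osc(2)
        finally show ?thesis .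
      qed
      also have "\<dots> \<le> b * C1 * X powr \<beta>"
      proof (rule mult_left_mono)
        have "X ^ 3 = X powr 3" using X by (simp add: powr_numeral)
        also have "\<dots> \<le> X powr \<beta>" using X True \<beta> by (intro powr_mono') (auto simp: c3_def)
        finally show "X ^ 3 \<le> X powr \<beta>" .
      qed (use b C1 in simp)
      also have "\<dots> \<le> (C1 + C2) * b * X powr \<beta>"
        using b C2 by (simp add: algebra_simps)
      finally show ?thesis .
    next
      case False
      have "\<bar>?I\<bar> \<le> (\<integral>z. b * MK * indicator D z \<partial>lborel)"
        unfolding real_norm_def[symmetric]
      proof (rule Bochner_Integration.integral_norm_bound_integral)
        show g: "integrable lborel (\<lambda>z. b * MK * indicator D z)" using finite_D by (simp add: D_def)
        show bd: "norm (B z * K i l (y + poly P z / of_real \<rho>)) \<le> b * MK * indicator D z" for z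
        proof (cases "z \<in> D")
          case True
          have "\<bar>B z\<bar> * \<bar>K i l (y + poly P z / of_real \<rho>)\<bar> \<le> b * MK"
            using cutoff_amplitude_le[OF B] MK il b by (intro mult_mono) auto
          then show ?thesis using True by (simp add: abs_mult)
        next
          case False
          then have "B z = 0"
            using B pos unfolding cutoff_amplitude_def D_def by (simp add: dist_norm norm_minus_commute)
          then show ?thesis using b MK(1) by simp
        qed
        have [measurable]: "B \<in> borel_measurable borel" using B by (simp add: cutoff_amplitude_def)
        have "(\<lambda>z. y + poly P z / of_real \<rho>) \<in> borel_measurable borel"
          by (intro borel_measurable_continuous_onI continuous_intros) (use \<rho> in auto)
        then have [measurable]: "(\<lambda>z. K i l (y + poly P z / of_real \<rho>)) \<in> borel_measurable borel"
          by (rule measurable_compose) (use il in \<open>intro K_measurable; simp\<close>)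
        show "integrable lborel (\<lambda>z. B z * K i l (y + poly P z / of_real \<rho>))"
          by (rule Bochner_Integration.integrable_bound[OF g]) (use bd in \<open>auto intro: order.trans[OF _ abs_ge_self]\<close>)
      qed
      also have "\<dots> = b * (MK * A)" by (simp add: A_def D_def)
      also have "\<dots> \<le> b * (MK * A * (X / c3) powr \<beta>)"
      proof -
        have "1 \<le> (X / c3) powr \<beta>" using False c0 X \<beta> by (intro ge_one_powr_ge_zero) auto
        then have "MK * A * 1 \<le> MK * A * (X / c3) powr \<beta>" using MK(1) A by (intro mult_left_mono) auto
        then show ?thesis using b by (intro mult_left_mono) auto
      qed
      also have "\<dots> = C2 * b * X powr \<beta>" using X c0 by (simp add: C2_def powr_divide)
      also have "\<dots> \<le> (C1 + C2) * b * X powr \<beta>" using b C1 by (intro mult_right_mono) auto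
      finally show ?thesis .
    qed
    then show "\<bar>\<integral>z. B z * K i l (y + poly (smult 2 (monom 1 k * f)) z / of_real \<rho>) \<partial>lborel\<bar>
        \<le> (C1 + C2) * b * (real (k + 1) * \<rho> / r ^ k) powr \<beta>"
      by (simp only: P_def X_def)
    qed
  qed
qed

end

section \<open>Mean squares over the parameter\<close>

lemma integral_lborel_affine:
  fixes f :: "'a::euclidean_space \<Rightarrow> real" and c :: real
  assumes [measurable]: "f \<in> borel_measurable borel" and "c \<noteq> 0"
  shows "(\<integral>x. f x \<partial>lborel) = \<bar>c\<bar> ^ DIM('a) * (\<integral>x. f (t + c *\<^sub>R x) \<partial>lborel)"
  by (subst lborel_affine[OF assms(2), of t])
     (simp add: integral_density integral_distr)

lemma has_real_derivative_max0_power: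
  "((\<lambda>t::real. max 0 t ^ Suc (Suc n)) has_real_derivative of_nat (Suc (Suc n)) * max 0 x ^ Suc n) (at x)"
proof -
  consider "x < 0" | "0 < x" | "x = 0" by linarith
  then show ?thesis
  proof cases
    case 1
    have "((\<lambda>_. 0) has_real_derivative 0) (at x)" by simp
    moreover have "\<forall>\<^sub>F t in nhds x. t < 0" using 1 by (intro order_tendstoD(2)[OF filterlim_ident])
    then have ev: "\<forall>\<^sub>F t in nhds x. 0 = max 0 t ^ Suc (Suc n)" by (rule eventually_mono) (simp add: max_def)
    ultimately show ?thesis using 1 DERIV_cong_ev[OF refl ev refl] by (simp add: max_def)
  next
    case 2
    have "((\<lambda>t. t ^ Suc (Suc n)) has_real_derivative of_nat (Suc (Suc n)) * x ^ Suc n) (at x)"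
      using DERIV_pow[of "Suc (Suc n)" x] by (simp add: ac_simps)
    moreover have "\<forall>\<^sub>F t in nhds x. 0 < t" using 2 by (intro order_tendstoD(1)[OF filterlim_ident])
    then have ev: "\<forall>\<^sub>F t in nhds x. t ^ Suc (Suc n) = max 0 t ^ Suc (Suc n)" by (rule eventually_mono) simp
    ultimately show ?thesis using 2 DERIV_cong_ev[OF refl ev refl] by simp
  next
    case 3
    have "((\<lambda>h::real. \<bar>h\<bar> ^ Suc n) \<longlongrightarrow> \<bar>0\<bar> ^ Suc n) (at 0)"
      by (intro tendsto_intros)
    then have lim: "((\<lambda>h::real. \<bar>h\<bar> ^ Suc n) \<longlongrightarrow> 0) (at 0)" by simp
    have "((\<lambda>h::real. max 0 h ^ Suc (Suc n) / h) \<longlongrightarrow> 0) (at 0)"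
    proof (rule Lim_null_comparison[OF always_eventually lim], rule allI)
      fix h :: real
      show "norm (max 0 h ^ Suc (Suc n) / h) \<le> \<bar>h\<bar> ^ Suc n"
      proof (cases "0 < h")
        case False
        then have "max 0 h ^ Suc (Suc n) / h = 0" by (simp add: max_def)
        then show ?thesis by (simp only: norm_zero) simp
      qed (simp add: max_def abs_mult)
    qed
    then show ?thesis using 3 by (simp add: DERIV_def)
  qed
qed

text \<open>Write \<open>x = y ^ 4\<close>: three of the factors \<open>y ^ n\<close> absorb the
  three factors \<open>n + 1\<close>, the fourth is summed.\<close>

lemma summable_cubic_geometric:
  fixes x :: real
  assumes "0 < x" "x < 1"
  shows "summable (\<lambda>k. real (Suc k) ^ 3 * x ^ k)"
proof -
  define y where "y = x powr (1/4)"
  have y0: "0 < y" using assms by (simp add: y_def)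
  have y4: "y ^ 4 = x" using assms by (simp add: y_def powr_power)
  have y1: "y < 1"
  proof (rule ccontr)
    assume "\<not> y < 1"
    then have "1 \<le> y ^ 4" by (intro one_le_power) simp
    then show False using y4 assms by simp
  qed
  have "(\<lambda>n. real n * y ^ n) \<longlonglongrightarrow> 0"
    using powser_times_n_limit_0[of y] y0 y1 by simp
  then have "(\<lambda>n. real (Suc n) * y ^ Suc n) \<longlonglongrightarrow> 0" by (rule LIMSEQ_Suc)
  then have "Bseq (\<lambda>n. real (Suc n) * y ^ Suc n)" by (intro convergent_imp_Bseq) (auto simp: convergent_def)
  then obtain B where B: "\<And>n. norm (real (Suc n) * y ^ Suc n) \<le> B" by (meson BseqE)
  show ?thesis
  proof (rule summable_comparison_test')
    show "summable (\<lambda>n. (B / y) ^ 3 * y ^ n)" using y0 y1 by (intro summable_mult summable_geometric) auto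
    fix n
    have "real (Suc n) * y ^ n \<le> B / y" using B[of n] y0 by (simp add: field_simps)
    then have "(real (Suc n) * y ^ n) ^ 3 * y ^ n \<le> (B / y) ^ 3 * y ^ n"
      using y0 by (intro mult_right_mono power_mono) auto
    moreover have "x ^ n = (y ^ n) ^ 3 * y ^ n"
      by (simp flip: y4 power_mult power_add power_Suc2)
    ultimately show "norm (real (Suc n) ^ 3 * x ^ n) \<le> (B / y) ^ 3 * y ^ n"
      using assms y0 by (simp add: power_mult_distrib abs_mult mult_ac)
  qed
qed

lemma coeff_sign_polys_le: "p \<in> sign_polys n \<Longrightarrow> cmod (coeff p i) \<le> 1"
  unfolding sign_polys_def by (cases "i < n") auto

context oscillation
begin

text \<open>The outer square makes it differentiable across the circle of radius \<eta>, all that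
  one integration by parts demands.\<close>

definition cutoff :: "complex \<Rightarrow> real" where
  "cutoff z = (max 0 (1 - (cmod (z - z0))\<^sup>2 / \<eta>\<^sup>2))\<^sup>2"

lemma cutoff_range: "0 \<le> cutoff z" "cutoff z \<le> 1"
  unfolding cutoff_def by (auto intro!: power_le_one)

lemma cutoff_eq_0: "\<eta> \<le> cmod (z - z0) \<Longrightarrow> cutoff z = 0"
proof -
  assume "\<eta> \<le> cmod (z - z0)"
  then have "\<eta>\<^sup>2 \<le> (cmod (z - z0))\<^sup>2" using pos by (intro power_mono) auto
  then show ?thesis using pos by (simp add: cutoff_def field_simps max_def)
qed

lemma cutoff_ge_half: "cmod (z - z0) \<le> \<eta> / 2 \<Longrightarrow> 1 / 2 \<le> cutoff z"
proof -
  assume "cmod (z - z0) \<le> \<eta> / 2"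
  then have "(cmod (z - z0))\<^sup>2 \<le> (\<eta> / 2)\<^sup>2" by (intro power_mono) auto
  then have "3 / 4 \<le> 1 - (cmod (z - z0))\<^sup>2 / \<eta>\<^sup>2" using pos by (simp add: field_simps power2_eq_square)
  then have "(3 / 4)\<^sup>2 \<le> cutoff z"
    unfolding cutoff_def by (rule power_mono[OF order.trans[OF _ max.cobounded2]]) simp
  then show ?thesis by (simp add: power2_eq_square)
qed

lemma cutoff_continuous: "continuous_on UNIV cutoff"
  unfolding cutoff_def by (intro continuous_intros) (use pos in auto)

lemma cutoff_derivative:
  obtains D where "\<And>z. (cutoff has_derivative D z) (at z)" "\<And>z e. \<bar>D z e\<bar> \<le> 4 / \<eta> * cmod e"
proof
  let ?m = "\<lambda>z. max 0 (1 - (cmod (z - z0))\<^sup>2 / \<eta>\<^sup>2)"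
  define D where "D z e = - (4 * ?m z * inner (z - z0) e / \<eta>\<^sup>2)" for z e
  show "(cutoff has_derivative D z) (at z)" for z
  proof -
    have "((\<lambda>z. 1 - inner (z - z0) (z - z0) * inverse (\<eta>\<^sup>2))
        has_derivative (\<lambda>e. - (2 * inner (z - z0) e * inverse (\<eta>\<^sup>2)))) (at z)"
      by (auto intro!: derivative_eq_intros simp: inner_commute)
    then have 1: "((\<lambda>z. 1 - (cmod (z - z0))\<^sup>2 / \<eta>\<^sup>2) has_derivative (\<lambda>e. - (2 * inner (z - z0) e / \<eta>\<^sup>2))) (at z)"
      by (simp add: power2_norm_eq_inner divide_inverse)
    show ?thesis
      using DERIV_compose_FDERIV[OF has_real_derivative_max0_power[of 0] 1]
      by (simp add: cutoff_def[abs_def] D_def[abs_def] numeral_2_eq_2 mult_ac)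
  qed
  show "\<bar>D z e\<bar> \<le> 4 / \<eta> * cmod e" for z e
  proof (cases "\<eta> \<le> cmod (z - z0)")
    case True
    then have "cutoff z = 0" by (rule cutoff_eq_0)
    then have "?m z = 0" unfolding cutoff_def by (rule power_eq_0_iff[THEN iffD1, THEN conjunct1])
    then show ?thesis using pos by (simp only: D_def) simp
  next
    case False
    have m: "0 \<le> ?m z" "?m z \<le> 1" by auto
    have "\<bar>inner (z - z0) e\<bar> \<le> cmod (z - z0) * cmod e" by (rule Cauchy_Schwarz_ineq2)
    also have "\<dots> \<le> \<eta> * cmod e" using False by (intro mult_right_mono) auto
    finally have "?m z * \<bar>inner (z - z0) e\<bar> \<le> 1 * (\<eta> * cmod e)"
      using m by (intro mult_mono) auto
    then have "4 * (?m z * \<bar>inner (z - z0) e\<bar>) / \<eta>\<^sup>2 \<le> 4 * (\<eta> * cmod e) / \<eta>\<^sup>2"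
      using pos by (intro divide_right_mono) auto
    then show ?thesis using pos m by (simp add: D_def abs_mult power2_eq_square mult.assoc)
  qed
qed

text \<open>Differentiating \<open>K ((x - p z) / \<rho>)\<close> in \<open>z\<close> brings down
  derivatives of \<open>p\<close>. Such weights depend on the sign sequence, so their bounds must be
  uniform over all polynomials with coefficients in the unit disc.\<close>

definition amplitude :: "real \<Rightarrow> (complex poly \<Rightarrow> complex \<Rightarrow> real) \<Rightarrow> bool" where
  "amplitude b A \<longleftrightarrow> 0 \<le> b \<and> (\<forall>p. (\<forall>i. cmod (coeff p i) \<le> 1) \<longrightarrow> continuous_on UNIV (A p) \<and>
     (\<exists>A'. \<forall>z\<in>ball z0 (2 * \<eta>). (A p has_derivative A' z) (at z) \<and> \<bar>A p z\<bar> \<le> b \<and> (\<forall>e. \<bar>A' z e\<bar> \<le> b * cmod e)))"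

lemma amplitude_1: "amplitude 1 (\<lambda>_ _. 1)"
  unfolding amplitude_def by (auto intro!: exI[of _ "\<lambda>_ _. 0"])

lemma amplitude_Re_Im:
  assumes "\<And>p z. (\<And>i. cmod (coeff p i) \<le> 1) \<Longrightarrow> z \<in> ball z0 (2 * \<eta>) \<Longrightarrow>
      cmod (poly (d p) z) \<le> M \<and> cmod (poly (pderiv (d p)) z) \<le> M"
  shows "amplitude M (\<lambda>p z. Re (poly (d p) z))" "amplitude M (\<lambda>p z. Im (poly (d p) z))"
proof -
  have dd: "(poly q has_derivative (\<lambda>h. poly (pderiv q) z * h)) (at z)" for q :: "complex poly" and z
    using poly_DERIV[of q z] by (simp add: has_field_derivative_def)
  show "amplitude M (\<lambda>p z. Re (poly (d p) z))"
    unfolding amplitude_def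
  proof (intro conjI allI impI exI[of _ "\<lambda>z h. Re (poly (pderiv (d _)) z * h)"] ballI)
    show "((\<lambda>z. Re (poly (d p) z)) has_derivative (\<lambda>h. Re (poly (pderiv (d p)) z * h))) (at z)" for p z
      by (rule bounded_linear.has_derivative[OF bounded_linear_Re dd])
    show "\<bar>Re (poly (d p) z)\<bar> \<le> M" if "\<forall>i. cmod (coeff p i) \<le> 1" "z \<in> ball z0 (2 * \<eta>)" for p z
      using assms[of p z] that abs_Re_le_cmod order.trans by blast
    show "\<bar>Re (poly (pderiv (d p)) z * e)\<bar> \<le> M * cmod e"
      if "\<forall>i. cmod (coeff p i) \<le> 1" "z \<in> ball z0 (2 * \<eta>)" for p z e
      using assms[of p z] that
      by (intro order.trans[OF abs_Re_le_cmod]) (simp add: norm_mult mult_right_mono)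
  qed (use pos in \<open>auto intro!: continuous_intros\<close>)
  show "amplitude M (\<lambda>p z. Im (poly (d p) z))"
    unfolding amplitude_def
  proof (intro conjI allI impI exI[of _ "\<lambda>z h. Im (poly (pderiv (d _)) z * h)"] ballI)
    show "((\<lambda>z. Im (poly (d p) z)) has_derivative (\<lambda>h. Im (poly (pderiv (d p)) z * h))) (at z)" for p z
      by (rule bounded_linear.has_derivative[OF bounded_linear_Im dd])
    show "\<bar>Im (poly (d p) z)\<bar> \<le> M" if "\<forall>i. cmod (coeff p i) \<le> 1" "z \<in> ball z0 (2 * \<eta>)" for p z
      using assms[of p z] that abs_Im_le_cmod order.trans by blast
    show "\<bar>Im (poly (pderiv (d p)) z * e)\<bar> \<le> M * cmod e"
      if "\<forall>i. cmod (coeff p i) \<le> 1" "z \<in> ball z0 (2 * \<eta>)" for p z e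
      using assms[of p z] that
      by (intro order.trans[OF abs_Im_le_cmod]) (simp add: norm_mult mult_right_mono)
  qed (use pos in \<open>auto intro!: continuous_intros\<close>)
qed

lemma product_derivative_bound:
  assumes "(A has_derivative A') (at z)" "\<bar>A z\<bar> \<le> b" "\<And>e. \<bar>A' e\<bar> \<le> b * cmod e"
    and "(B has_derivative B') (at z)" "\<bar>B z\<bar> \<le> c" "\<And>e. \<bar>B' e\<bar> \<le> c * cmod e"
  shows "((\<lambda>z. A z * B z :: real) has_derivative (\<lambda>e. A z * B' e + A' e * B z)) (at z)"
    "\<bar>A z * B z\<bar> \<le> 2 * b * c" "\<bar>A z * B' e + A' e * B z\<bar> \<le> 2 * b * c * cmod e"
proof -
  have b: "0 \<le> b" "0 \<le> c" using assms by (meson abs_ge_zero order.trans)+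
  show "((\<lambda>z. A z * B z) has_derivative (\<lambda>e. A z * B' e + A' e * B z)) (at z)"
    by (rule has_derivative_mult[OF assms(1,4)])
  have "\<bar>A z * B z\<bar> \<le> b * c" unfolding abs_mult using assms b by (intro mult_mono) auto
  then show "\<bar>A z * B z\<bar> \<le> 2 * b * c" using b mult_nonneg_nonneg[of b c] by linarith
  have "\<bar>A z * B' e\<bar> \<le> b * (c * cmod e)" "\<bar>A' e * B z\<bar> \<le> (b * cmod e) * c"
    unfolding abs_mult using assms b by (intro mult_mono; auto)+
  then show "\<bar>A z * B' e + A' e * B z\<bar> \<le> 2 * b * c * cmod e"
    by (intro order.trans[OF abs_triangle_ineq]) (simp add: algebra_simps)
qed

lemma amplitude_mult:
  assumes "amplitude b A" "amplitude c B"
  shows "amplitude (2 * b * c) (\<lambda>p z. A p z * B p z)"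
  unfolding amplitude_def
proof (intro conjI allI impI)
  fix p assume p: "\<forall>i. cmod (coeff p i) \<le> 1"
  show "continuous_on UNIV (\<lambda>z. A p z * B p z)"
    using assms p unfolding amplitude_def by (intro continuous_on_mult) auto
  obtain A' where A': "\<And>z. z \<in> ball z0 (2 * \<eta>) \<Longrightarrow>
      (A p has_derivative A' z) (at z) \<and> \<bar>A p z\<bar> \<le> b \<and> (\<forall>e. \<bar>A' z e\<bar> \<le> b * cmod e)"
    using assms(1) p unfolding amplitude_def by blast
  obtain B' where B': "\<And>z. z \<in> ball z0 (2 * \<eta>) \<Longrightarrow>
      (B p has_derivative B' z) (at z) \<and> \<bar>B p z\<bar> \<le> c \<and> (\<forall>e. \<bar>B' z e\<bar> \<le> c * cmod e)"
    using assms(2) p unfolding amplitude_def by blast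
  show "\<exists>D. \<forall>z\<in>ball z0 (2 * \<eta>). ((\<lambda>z. A p z * B p z) has_derivative D z) (at z) \<and>
      \<bar>A p z * B p z\<bar> \<le> 2 * b * c \<and> (\<forall>e. \<bar>D z e\<bar> \<le> 2 * b * c * cmod e)"
  proof (intro exI[of _ "\<lambda>z e. A p z * B' z e + A' z e * B p z"] ballI)
    fix z assume z: "z \<in> ball z0 (2 * \<eta>)"
    show "((\<lambda>z. A p z * B p z) has_derivative (\<lambda>e. A p z * B' z e + A' z e * B p z)) (at z) \<and>
      \<bar>A p z * B p z\<bar> \<le> 2 * b * c \<and> (\<forall>e. \<bar>A p z * B' z e + A' z e * B p z\<bar> \<le> 2 * b * c * cmod e)"
      using product_derivative_bound[of "A p" "A' z" z b "B p" "B' z" c] A'[OF z] B'[OF z] by simp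
  qed
qed (use assms in \<open>auto simp: amplitude_def\<close>)

lemma cutoff_amplitude_product:
  assumes "amplitude b A" and p: "\<And>i. cmod (coeff p i) \<le> 1" and q: "\<And>i. cmod (coeff q i) \<le> 1"
  shows "cutoff_amplitude (2 * (1 + 4 / \<eta>) * (2 * b * b)) (\<lambda>z. cutoff z * (A p z * A q z))"
  unfolding cutoff_amplitude_def
proof (intro conjI)
  obtain D where D: "\<And>z. (cutoff has_derivative D z) (at z)" "\<And>z e. \<bar>D z e\<bar> \<le> 4 / \<eta> * cmod e"
    using cutoff_derivative by blast
  have c: "\<bar>cutoff z\<bar> \<le> 1 + 4 / \<eta>" "\<bar>D z e\<bar> \<le> (1 + 4 / \<eta>) * cmod e" for z e
  proof -
    have "0 \<le> 4 / \<eta>" using pos by simp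
    then show "\<bar>cutoff z\<bar> \<le> 1 + 4 / \<eta>" using cutoff_range[of z] by linarith
    show "\<bar>D z e\<bar> \<le> (1 + 4 / \<eta>) * cmod e" unfolding distrib_right
      using D(2)[of z e] norm_ge_zero[of e] by linarith
  qed
  obtain A' where A': "\<And>z. z \<in> ball z0 (2 * \<eta>) \<Longrightarrow>
      (A p has_derivative A' z) (at z) \<and> \<bar>A p z\<bar> \<le> b \<and> (\<forall>e. \<bar>A' z e\<bar> \<le> b * cmod e)"
    using assms(1) p unfolding amplitude_def by blast
  obtain B' where B': "\<And>z. z \<in> ball z0 (2 * \<eta>) \<Longrightarrow>
      (A q has_derivative B' z) (at z) \<and> \<bar>A q z\<bar> \<le> b \<and> (\<forall>e. \<bar>B' z e\<bar> \<le> b * cmod e)"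
    using assms(1) q unfolding amplitude_def by blast
  define E where "E z e = A p z * B' z e + A' z e * A q z" for z e
  have E: "((\<lambda>z. A p z * A q z) has_derivative E z) (at z)" "\<bar>A p z * A q z\<bar> \<le> 2 * b * b"
    "\<bar>E z e\<bar> \<le> 2 * b * b * cmod e" if "z \<in> ball z0 (2 * \<eta>)" for z e
    unfolding E_def using product_derivative_bound[of "A p" "A' z" z b "A q" "B' z" b] A'[OF that] B'[OF that]
    by blast+
  show "\<exists>B'. \<forall>z\<in>ball z0 (2 * \<eta>). ((\<lambda>z. cutoff z * (A p z * A q z)) has_derivative B' z) (at z) \<and>
      \<bar>cutoff z * (A p z * A q z)\<bar> \<le> 2 * (1 + 4 / \<eta>) * (2 * b * b) \<and>
      (\<forall>e. \<bar>B' z e\<bar> \<le> 2 * (1 + 4 / \<eta>) * (2 * b * b) * cmod e)"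
    using product_derivative_bound[of cutoff "D _" _ "1 + 4 / \<eta>" "\<lambda>z. A p z * A q z" "E _" "2 * b * b", OF D(1) c E]
    by (intro exI[of _ "\<lambda>z e. cutoff z * E z e + D z e * (A p z * A q z)"]) blast
  show "(\<lambda>z. cutoff z * (A p z * A q z)) \<in> borel_measurable borel"
    using assms unfolding amplitude_def
    by (intro borel_measurable_continuous_onI continuous_on_mult cutoff_continuous) auto
qed (auto simp: cutoff_eq_0)

text \<open>For \<open>A = 1\<close> this is the truncation to \<open>n\<close> signs of the
  integral of \<open>K ((x - y) / \<rho>)\<close> over \<open>nu z\<close>. The kernel is not
  normalized by \<open>\<rho>^-2\<close>; that factor is restored when the increments of the
  mollifications are assembled.\<close>

definition averaged_kernel ::
  "nat \<Rightarrow> nat \<Rightarrow> (complex poly \<Rightarrow> complex \<Rightarrow> real) \<Rightarrow> real \<Rightarrow> nat \<Rightarrow> complex \<Rightarrow> complex \<Rightarrow> real" where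
  "averaged_kernel i l A \<rho> n z x = (\<Sum>p\<in>sign_polys n. K i l ((x - poly p z) / of_real \<rho>) * A p z) / 2 ^ n"

lemma kernel_correlation:
  assumes il: "i \<le> 3" "l \<le> 3" and \<rho>: "0 < \<rho>"
  shows "(\<integral>x. K i l ((x - a) / of_real \<rho>) * K i l ((x - c) / of_real \<rho>) \<partial>lborel)
    = \<rho>\<^sup>2 * (\<integral>y. K i l y * K i l (y + (a - c) / of_real \<rho>) \<partial>lborel)"
proof -
  note [measurable] = K_measurable[OF il]
  have "(\<lambda>x. (x - w) / of_real \<rho>) \<in> borel_measurable borel" for w :: complex
    by (intro borel_measurable_continuous_onI continuous_intros) (use \<rho> in auto)
  then have m: "(\<lambda>x. K i l ((x - w) / of_real \<rho>)) \<in> borel_measurable borel" for w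
    by (rule measurable_compose) (rule K_measurable[OF il])
  have "(a + \<rho> *\<^sub>R y - a) / of_real \<rho> = y" "(a + \<rho> *\<^sub>R y - c) / of_real \<rho> = y + (a - c) / of_real \<rho>" for y
    using \<rho> by (simp_all add: scaleR_conv_of_real field_simps)
  then show ?thesis
    using integral_lborel_affine[of "\<lambda>x. K i l ((x - a) / of_real \<rho>) * K i l ((x - c) / of_real \<rho>)" \<rho> a] m \<rho>
    by (simp add: DIM_complex)
qed

lemma integrable_bounded_on_product:
  fixes g :: "complex \<times> complex \<Rightarrow> real"
  assumes "g \<in> borel_measurable (lborel \<Otimes>\<^sub>M lborel)" "\<And>z. \<bar>g z\<bar> \<le> B"
    and "\<And>x y. R < cmod x \<or> R < cmod y \<Longrightarrow> g (x, y) = 0"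
  shows "integrable (lborel \<Otimes>\<^sub>M lborel) g"
proof (rule integrableI_bounded_set[where A = "cball 0 R \<times> cball 0 R" and B = B])
  have "emeasure (lborel \<Otimes>\<^sub>M lborel) (cball (0::complex) R \<times> cball (0::complex) R)
      = emeasure lborel (cball (0::complex) R) * emeasure lborel (cball (0::complex) R)"
    by (rule lborel.emeasure_pair_measure_Times) auto
  also have "\<dots> < \<infinity>"
    using emeasure_bounded_finite[of "cball (0::complex) R"] by (simp add: ennreal_mult_less_top)
  finally show "emeasure (lborel \<Otimes>\<^sub>M lborel) (cball (0::complex) R \<times> cball (0::complex) R) < \<infinity>" .
  show "AE w in lborel \<Otimes>\<^sub>M lborel. w \<notin> cball 0 R \<times> cball 0 R \<longrightarrow> g w = 0"
  proof (intro AE_I2 impI)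
    fix w assume "w \<notin> cball (0::complex) R \<times> cball (0::complex) R"
    moreover obtain x y where "w = (x, y)" by (cases w)
    ultimately show "g w = 0" using assms(3)[of x y] by auto
  qed
qed (use assms in auto)

text \<open>The square expands into pairs \<open>p\<close>, \<open>q\<close>. Substituting
  \<open>x = p z + \<rho> * y\<close> for each \<open>z\<close> yields \<open>\<rho>^2\<close> and a
  correlation in which the first kernel depends on \<open>y\<close> alone, so for fixed
  \<open>y\<close> only \<open>K (y + (p - q) / \<rho>)\<close> oscillates in \<open>z\<close>.
  Pairs first differing at \<open>k\<close> have weight \<open>2 ^ -(k + 1)\<close>; up to a cubic
  factor they sum to a geometric series of ratio \<open>1 / (2 * r powr \<beta>)\<close>, which is
  less than 1. Diagonal pairs do not oscillate and are small only through their share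
  \<open>1 / 2 ^ n\<close>.\<close>

lemma mean_square_averaged_kernel:
  assumes \<beta>: "0 \<le> \<beta>" "\<beta> \<le> 3" "1 < 2 * r powr \<beta>" and il: "1 \<le> i + l" "i + l \<le> 3"
    and A: "amplitude b A"
  obtains C where "0 \<le> C" "\<And>n \<rho>. 0 < \<rho> \<Longrightarrow> \<rho> \<le> 1 \<Longrightarrow>
    (\<integral>\<^sup>+x. \<integral>\<^sup>+z. ennreal (cutoff z * (averaged_kernel i l A \<rho> n z x)\<^sup>2) \<partial>lborel \<partial>lborel)
      \<le> ennreal (C * \<rho>\<^sup>2 * (\<rho> powr \<beta> + 1 / 2 ^ n))"
proof -
  have il3: "i \<le> 3" "l \<le> 3" using il by auto
  note Km[measurable] = K_measurable[OF il3]
  obtain MK where MK: "0 < MK" "\<And>z. \<bar>K i l z\<bar> \<le> MK" using K_bounded il3 by blast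
  define b' where "b' = 2 * (1 + 4 / \<eta>) * (2 * b * b)"
  define B where "B p q z = cutoff z * (A p z * A q z)" for p q z
  have Bamp: "cutoff_amplitude b' (B p q)" if "p \<in> sign_polys n" "q \<in> sign_polys n" for p q n
    unfolding B_def[abs_def] b'_def
    by (rule cutoff_amplitude_product[OF A coeff_sign_polys_le[OF that(1)] coeff_sign_polys_le[OF that(2)]])
  have b'0: "0 \<le> b'"
    using A pos unfolding b'_def amplitude_def by (intro mult_nonneg_nonneg add_nonneg_nonneg) auto
  obtain C where C: "0 < C"
    "\<forall>i l f k \<rho> y b B. 1 \<le> i + l \<longrightarrow> i + l \<le> 3 \<longrightarrow> f \<in> sign_quotients \<longrightarrow> 0 < \<rho> \<longrightarrow> cmod y \<le> 2 \<longrightarrow>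
      cutoff_amplitude b B \<longrightarrow>
      \<bar>\<integral>z. B z * K i l (y + poly (smult 2 (monom 1 k * f)) z / of_real \<rho>) \<partial>lborel\<bar>
        \<le> C * b * (real (k + 1) * \<rho> / r ^ k) powr \<beta>"
    by (rule oscillatory_integral_bound[OF \<beta>(1,2)])
  note osc = C(2)[rule_format]
  define a2 where "a2 = measure lborel (cball (0::complex) 2)"
  define a\<eta> where "a\<eta> = measure lborel (cball z0 \<eta>)"
  have fin2: "emeasure lborel (cball (0::complex) 2) < \<infinity>" "emeasure lborel (cball z0 \<eta>) < \<infinity>"
    by (rule emeasure_bounded_finite; simp)+
  define S where "S = (\<Sum>k. real (Suc k) ^ 3 * (1 / (2 * r powr \<beta>)) ^ k)"
  have Ssum: "summable (\<lambda>k. real (Suc k) ^ 3 * (1 / (2 * r powr \<beta>)) ^ k)"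
    using \<beta>(3) pos by (intro summable_cubic_geometric) auto
  define C1 where "C1 = MK * a2 * C * b' * S"
  define C2 where "C2 = MK\<^sup>2 * a2 * b' * a\<eta>"
  have "0 \<le> S" unfolding S_def using Ssum \<beta>(3) by (intro suminf_nonneg) auto
  then have C12: "0 \<le> C1" "0 \<le> C2"
    unfolding C1_def C2_def using MK(1) C(1) b'0 by (auto simp: a2_def a\<eta>_def intro!: mult_nonneg_nonneg)
  have main: "(\<integral>\<^sup>+x. \<integral>\<^sup>+z. ennreal (cutoff z * (averaged_kernel i l A \<rho> n z x)\<^sup>2) \<partial>lborel \<partial>lborel)
      \<le> ennreal ((C1 + C2) * \<rho>\<^sup>2 * (\<rho> powr \<beta> + 1 / 2 ^ n))" if \<rho>: "0 < \<rho>" "\<rho> \<le> 1" for n \<rho>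
  proof -
    define g where "g p q = (\<lambda>(x, z). B p q z * (K i l ((x - poly p z) / of_real \<rho>) * K i l ((x - poly q z) / of_real \<rho>)))"
      for p q
    define T where "T p q = (\<integral>w. g p q w \<partial>(lborel \<Otimes>\<^sub>M lborel))" for p q
    have Am: "A p \<in> borel_measurable borel" if "p \<in> sign_polys n" for p
      using A coeff_sign_polys_le[OF that] unfolding amplitude_def by (intro borel_measurable_continuous_onI) auto
    have pm: "poly p \<in> borel_measurable borel" for p :: "complex poly"
      by (intro borel_measurable_continuous_onI continuous_intros)
    have Bm: "B p q \<in> borel_measurable borel" if "p \<in> sign_polys n" "q \<in> sign_polys n" for p q
      using Bamp[OF that] by (simp add: cutoff_amplitude_def)
    have Kp: "(\<lambda>(x, z). K i l ((x - poly p z) / of_real \<rho>)) \<in> borel_measurable (lborel \<Otimes>\<^sub>M lborel)" for p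
    proof -
      have "(\<lambda>w. (fst w - poly p (snd w)) / of_real \<rho>) \<in> borel_measurable (lborel \<Otimes>\<^sub>M lborel)"
        unfolding lborel_prod measurable_lborel2
        by (intro borel_measurable_continuous_onI continuous_intros) (use \<rho> in auto)
      then have "(\<lambda>w. K i l ((fst w - poly p (snd w)) / of_real \<rho>)) \<in> borel_measurable (lborel \<Otimes>\<^sub>M lborel)"
        by (rule measurable_compose) (rule Km)
      then show ?thesis by (simp add: case_prod_unfold)
    qed
    \<comment> \<open>On the disc \<open>|p z| \<le> M\<close>, and \<open>\<rho> \<le> 1\<close>
      keeps the kernel within distance 2 of \<open>p z\<close>; this bounds the support in
      \<open>x\<close>, and the cutoff bounds the one in \<open>z\<close>.\<close>
    define R where "R = max (M + 2) (cmod z0 + \<eta>)"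
    have gi: "integrable (lborel \<Otimes>\<^sub>M lborel) (g p q)" if p: "p \<in> sign_polys n" and q: "q \<in> sign_polys n" for p q
    proof (rule integrable_bounded_on_product[where B = "b' * (MK * MK)" and R = R])
      have "(\<lambda>w. B p q (snd w)) \<in> borel_measurable (lborel \<Otimes>\<^sub>M lborel)"
        by (rule measurable_compose[OF measurable_snd]) (use Bm[OF p q] in simp)
      then show "g p q \<in> borel_measurable (lborel \<Otimes>\<^sub>M lborel)"
        using borel_measurable_times[OF _ borel_measurable_times[OF Kp[of p] Kp[of q]]]
        unfolding g_def by (simp add: case_prod_unfold)
      show "\<bar>g p q w\<bar> \<le> b' * (MK * MK)" for w
        unfolding g_def case_prod_unfold abs_mult
        using cutoff_amplitude_le[OF Bamp[OF p q]] MK b'0 by (intro mult_mono) auto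
      show "g p q (x, z) = 0" if R: "R < cmod x \<or> R < cmod z" for x z
      proof (cases "\<eta> \<le> cmod (z - z0)")
        case True
        then show ?thesis using cutoff_eq_0 by (simp add: g_def B_def)
      next
        case False
        then have "cmod z < cmod z0 + \<eta>" using norm_triangle_ineq2[of z z0] by linarith
        then have x: "M + 2 < cmod x" using R by (auto simp: R_def)
        have "z \<in> ball z0 (2 * \<eta>)" using False pos by (simp add: dist_norm norm_minus_commute)
        then have "cmod (poly p z) \<le> M" using bound0 coeff_sign_polys_le[OF p] by blast
        then have "2 < cmod (x - poly p z)" using x norm_triangle_ineq2[of x "poly p z"] by linarith
        also have "\<dots> \<le> cmod (x - poly p z) / \<rho>"
          using \<rho> mult_right_mono[of \<rho> 1 "cmod (x - poly p z)"] by (simp add: field_simps)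
        finally have "K i l ((x - poly p z) / of_real \<rho>) = 0"
          using \<rho> by (intro K_eq_0 il3) (simp add: norm_divide)
        then show ?thesis by (simp add: g_def)
      qed
    qed
    have square: "cutoff z * (averaged_kernel i l A \<rho> n z x)\<^sup>2
        = (\<Sum>p\<in>sign_polys n. \<Sum>q\<in>sign_polys n. g p q (x, z)) / 4 ^ n" for x z
    proof -
      define a where "a p = K i l ((x - poly p z) / of_real \<rho>) * A p z" for p
      have e: "((2::real) ^ n)\<^sup>2 = 4 ^ n" by (simp add: power2_eq_square flip: power_mult_distrib)
      have "(averaged_kernel i l A \<rho> n z x)\<^sup>2 = (\<Sum>p\<in>sign_polys n. \<Sum>q\<in>sign_polys n. a p * a q) / 4 ^ n"
        unfolding averaged_kernel_def a_def[symmetric] power_divide e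
        by (simp only: power2_eq_square sum_product)
      then have "cutoff z * (averaged_kernel i l A \<rho> n z x)\<^sup>2
          = (\<Sum>p\<in>sign_polys n. \<Sum>q\<in>sign_polys n. cutoff z * (a p * a q)) / 4 ^ n"
        by (simp add: sum_distrib_left)
      also have "\<dots> = (\<Sum>p\<in>sign_polys n. \<Sum>q\<in>sign_polys n. g p q (x, z)) / 4 ^ n"
        by (simp add: g_def B_def a_def mult_ac)
      finally show ?thesis .
    qed
    define h where "h w = (\<Sum>p\<in>sign_polys n. \<Sum>q\<in>sign_polys n. g p q w) / 4 ^ n" for w
    have hi: "integrable (lborel \<Otimes>\<^sub>M lborel) h" unfolding h_def using gi by auto
    have h0: "0 \<le> h w" for w
    proof -
      have "h w = cutoff (snd w) * (averaged_kernel i l A \<rho> n (snd w) (fst w))\<^sup>2"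
        unfolding square by (simp add: h_def)
      then show ?thesis using cutoff_range(1)[of "snd w"] by simp
    qed
    have "(\<integral>\<^sup>+x. \<integral>\<^sup>+z. ennreal (cutoff z * (averaged_kernel i l A \<rho> n z x)\<^sup>2) \<partial>lborel \<partial>lborel)
        = (\<integral>\<^sup>+x. \<integral>\<^sup>+z. ennreal (h (x, z)) \<partial>lborel \<partial>lborel)"
      by (simp only: square h_def)
    also have "\<dots> = (\<integral>\<^sup>+w. ennreal (h w) \<partial>(lborel \<Otimes>\<^sub>M lborel))"
      by (rule lborel.nn_integral_fst) (use hi in measurable)
    also have "\<dots> = ennreal (\<integral>w. h w \<partial>(lborel \<Otimes>\<^sub>M lborel))"
      by (rule nn_integral_eq_integral[OF hi]) (use h0 in auto)
    also have "(\<integral>w. h w \<partial>(lborel \<Otimes>\<^sub>M lborel)) = (\<Sum>p\<in>sign_polys n. \<Sum>q\<in>sign_polys n. T p q) / 4 ^ n"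
      unfolding h_def T_def using gi by (simp add: Bochner_Integration.integral_sum)
    finally have eq: "(\<integral>\<^sup>+x. \<integral>\<^sup>+z. ennreal (cutoff z * (averaged_kernel i l A \<rho> n z x)\<^sup>2) \<partial>lborel \<partial>lborel)
        = ennreal ((\<Sum>p\<in>sign_polys n. \<Sum>q\<in>sign_polys n. T p q) / 4 ^ n)" .
    have T_eq: "T p q = \<rho>\<^sup>2 * (\<integral>y. K i l y * (\<integral>z. B p q z * K i l (y + poly (p - q) z / of_real \<rho>) \<partial>lborel) \<partial>lborel)"
      if p: "p \<in> sign_polys n" and q: "q \<in> sign_polys n" for p q
    proof -
      define f2 where "f2 y z = \<rho>\<^sup>2 * (B p q z * (K i l y * K i l (y + poly (p - q) z / of_real \<rho>)))" for y z
      have "T p q = (\<integral>z. \<integral>x. g p q (x, z) \<partial>lborel \<partial>lborel)"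
        unfolding T_def by (rule lborel_pair.integral_snd[symmetric, of "\<lambda>x z. g p q (x, z)", simplified]) (rule gi[OF p q])
      also have "\<dots> = (\<integral>z. \<integral>y. f2 y z \<partial>lborel \<partial>lborel)"
        unfolding g_def f2_def using kernel_correlation[OF il3 \<rho>(1)] by (simp add: mult.left_commute)
      also have "\<dots> = (\<integral>y. \<integral>z. f2 y z \<partial>lborel \<partial>lborel)"
      proof (rule lborel_pair.Fubini_integral)
        have "(\<lambda>w. fst w + poly (p - q) (snd w) / of_real \<rho>) \<in> borel_measurable (lborel \<Otimes>\<^sub>M lborel)"
          unfolding lborel_prod measurable_lborel2
          by (intro borel_measurable_continuous_onI continuous_intros) (use \<rho> in auto)
        then have "(\<lambda>w. K i l (fst w + poly (p - q) (snd w) / of_real \<rho>)) \<in> borel_measurable (lborel \<Otimes>\<^sub>M lborel)"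
          by (rule measurable_compose) (rule Km)
        moreover have "(\<lambda>w. B p q (snd w)) \<in> borel_measurable (lborel \<Otimes>\<^sub>M lborel)"
          by (rule measurable_compose[OF measurable_snd]) (use Bm[OF p q] in simp)
        moreover have "(\<lambda>w. K i l (fst w)) \<in> borel_measurable (lborel \<Otimes>\<^sub>M lborel)"
          by (rule measurable_compose[OF measurable_fst]) (use Km in simp)
        ultimately have m: "(\<lambda>w. f2 (fst w) (snd w)) \<in> borel_measurable (lborel \<Otimes>\<^sub>M lborel)"
          unfolding f2_def by (intro borel_measurable_times borel_measurable_const)
        have "integrable (lborel \<Otimes>\<^sub>M lborel) (\<lambda>w. f2 (fst w) (snd w))"
        proof (rule integrable_bounded_on_product[OF m])
          show "\<bar>f2 (fst w) (snd w)\<bar> \<le> \<rho>\<^sup>2 * (b' * (MK * MK))" for w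
            unfolding f2_def abs_mult
            using cutoff_amplitude_le[OF Bamp[OF p q]] MK b'0 by (intro mult_mono) auto
          show "f2 (fst (y, z)) (snd (y, z)) = 0"
            if R: "max 2 (cmod z0 + \<eta>) < cmod y \<or> max 2 (cmod z0 + \<eta>) < cmod z" for y z
          proof (cases "2 < cmod y")
            case True
            then show ?thesis using K_eq_0[OF il3 True] by (simp add: f2_def)
          next
            case False
            then have "cmod z0 + \<eta> < cmod z" using R by auto
            then have "\<eta> \<le> cmod (z - z0)" using norm_triangle_ineq2[of z z0] by linarith
            then show ?thesis using cutoff_eq_0 by (simp add: B_def f2_def)
          qed
        qed
        then show "integrable (lborel \<Otimes>\<^sub>M lborel) (\<lambda>(y, z). f2 y z)" by (simp add: case_prod_unfold)
      qed
      also have "\<dots> = \<rho>\<^sup>2 * (\<integral>y. K i l y * (\<integral>z. B p q z * K i l (y + poly (p - q) z / of_real \<rho>) \<partial>lborel) \<partial>lborel)"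
        unfolding f2_def by (simp add: mult.left_commute[of "B p q _"])
      finally show ?thesis .
    qed
    have T_le: "T p q \<le> \<rho>\<^sup>2 * (MK * a2 * c)"
      if p: "p \<in> sign_polys n" and q: "q \<in> sign_polys n" and c: "0 \<le> c"
        and inner: "\<And>y. cmod y \<le> 2 \<Longrightarrow> \<bar>\<integral>z. B p q z * K i l (y + poly (p - q) z / of_real \<rho>) \<partial>lborel\<bar> \<le> c" for p q c
    proof -
      let ?I = "\<lambda>y. \<integral>z. B p q z * K i l (y + poly (p - q) z / of_real \<rho>) \<partial>lborel"
      have "(\<integral>y. K i l y * ?I y \<partial>lborel) \<le> (\<integral>y. MK * c * indicator (cball (0::complex) 2) y \<partial>lborel)"
      proof (rule integral_mono_AE')
        show "integrable lborel (\<lambda>y. MK * c * indicator (cball (0::complex) 2) y)" using fin2 by simp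
        have "K i l y * ?I y \<le> MK * c * indicator (cball 0 2) y" for y
        proof (cases "cmod y \<le> 2")
          case True
          have "K i l y * ?I y \<le> \<bar>K i l y\<bar> * \<bar>?I y\<bar>"
            unfolding abs_mult[symmetric] by (rule abs_ge_self)
          also have "\<dots> \<le> MK * c" using inner[OF True] MK c by (intro mult_mono) auto
          finally show ?thesis using True by simp
        next
          case False
          then show ?thesis using K_eq_0[OF il3, of y] by simp
        qed
        then show "AE y in lborel. K i l y * ?I y \<le> MK * c * indicator (cball 0 2) y" by simp
        show "AE y in lborel. 0 \<le> MK * c * indicator (cball (0::complex) 2) y" using MK(1) c by simp
      qed
      also have "\<dots> = MK * a2 * c" by (simp add: a2_def)
      finally show ?thesis unfolding T_eq[OF p q] by (intro mult_left_mono) auto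
    qed
    have T_off: "T p q \<le> \<rho>\<^sup>2 * (MK * a2 * (C * b' * (real (k + 1) * \<rho> / r ^ k) powr \<beta>))"
      if "p \<in> sign_polys n" "q \<in> sign_polys n" "f \<in> sign_quotients" "p - q = smult 2 (monom 1 k * f)" for p q k f
      using that C(1) b'0 osc[OF il that(3) \<rho>(1) _ Bamp[OF that(1,2)], of _ k]
      by (intro T_le) auto
    have T_diag: "T p p \<le> \<rho>\<^sup>2 * C2" if p: "p \<in> sign_polys n" for p
    proof -
      have "T p p \<le> \<rho>\<^sup>2 * (MK * a2 * (b' * MK * a\<eta>))"
      proof (rule T_le[OF p p])
        show "0 \<le> b' * MK * a\<eta>" using b'0 MK(1) by (simp add: a\<eta>_def)
        fix y :: complex
        have g: "integrable lborel (\<lambda>z. b' * MK * indicator (cball z0 \<eta>) z)" using fin2 by simp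
        have bd: "norm (B p p z * K i l (y + poly (p - p) z / of_real \<rho>)) \<le> b' * MK * indicator (cball z0 \<eta>) z" for z
        proof (cases "z \<in> cball z0 \<eta>")
          case True
          then show ?thesis
            using mult_mono[OF cutoff_amplitude_le[OF Bamp[OF p p]] MK(2) b'0 abs_ge_zero] by (simp add: abs_mult)
        next
          case False
          then have "\<eta> \<le> cmod (z - z0)" by (simp add: dist_norm norm_minus_commute)
          then show ?thesis using cutoff_eq_0 b'0 MK(1) by (simp add: B_def)
        qed
        have "integrable lborel (\<lambda>z. B p p z * K i l (y + poly (p - p) z / of_real \<rho>))"
          by (rule Bochner_Integration.integrable_bound[OF g])
             (use Bm[OF p p] bd in \<open>auto intro: order.trans[OF _ abs_ge_self]\<close>)
        then have "norm (\<integral>z. B p p z * K i l (y + poly (p - p) z / of_real \<rho>) \<partial>lborel)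
            \<le> (\<integral>z. b' * MK * indicator (cball z0 \<eta>) z \<partial>lborel)"
          using g bd by (rule Bochner_Integration.integral_norm_bound_integral)
        then show "\<bar>\<integral>z. B p p z * K i l (y + poly (p - p) z / of_real \<rho>) \<partial>lborel\<bar> \<le> b' * MK * a\<eta>"
          by (simp add: a\<eta>_def)
      qed
      then show ?thesis by (simp add: C2_def power2_eq_square mult_ac)
    qed
    have "(\<Sum>p\<in>sign_polys n. \<Sum>q\<in>sign_polys n. T p q)
        \<le> 4 ^ n * ((\<Sum>k<n. \<rho>\<^sup>2 * (MK * a2 * (C * b' * (real (k + 1) * \<rho> / r ^ k) powr \<beta>)) / 2 ^ Suc k) + \<rho>\<^sup>2 * C2 / 2 ^ n)"
      by (rule sum_sign_poly_pairs_le[OF T_diag T_off])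
    then have "(\<Sum>p\<in>sign_polys n. \<Sum>q\<in>sign_polys n. T p q) / 4 ^ n
        \<le> (\<Sum>k<n. \<rho>\<^sup>2 * (MK * a2 * (C * b' * (real (k + 1) * \<rho> / r ^ k) powr \<beta>)) / 2 ^ Suc k) + \<rho>\<^sup>2 * C2 / 2 ^ n"
      by (simp add: field_simps)
    also have "(\<Sum>k<n. \<rho>\<^sup>2 * (MK * a2 * (C * b' * (real (k + 1) * \<rho> / r ^ k) powr \<beta>)) / 2 ^ Suc k)
        \<le> (\<Sum>k<n. \<rho>\<^sup>2 * (MK * a2 * C * b') * \<rho> powr \<beta> * (real (Suc k) ^ 3 * (1 / (2 * r powr \<beta>)) ^ k))"
    proof (rule sum_mono)
      fix k
      have rk: "(r ^ k) powr \<beta> = (r powr \<beta>) ^ k"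
        using pos by (simp add: powr_powr powr_power mult.commute flip: powr_realpow)
      have "real (k + 1) powr \<beta> \<le> real (k + 1) powr 3" using \<beta> by (intro powr_mono) auto
      also have "\<dots> = real (Suc k) ^ 3" by (simp add: powr_numeral)
      finally have k3: "real (k + 1) powr \<beta> \<le> real (Suc k) ^ 3" .
      have "(real (k + 1) * \<rho> / r ^ k) powr \<beta> / 2 ^ Suc k
          = real (k + 1) powr \<beta> * (\<rho> powr \<beta> / (r powr \<beta>) ^ k / 2 ^ Suc k)"
        using pos \<rho> by (simp add: powr_mult powr_divide rk)
      also have "\<dots> \<le> real (Suc k) ^ 3 * (\<rho> powr \<beta> / (r powr \<beta>) ^ k / 2 ^ k)"
        using pos k3 by (intro mult_mono divide_left_mono) auto
      also have "\<dots> = \<rho> powr \<beta> * (real (Suc k) ^ 3 * (1 / (2 * r powr \<beta>)) ^ k)"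
        by (simp add: power_mult_distrib power_one_over field_simps)
      finally have le: "(real (k + 1) * \<rho> / r ^ k) powr \<beta> / 2 ^ Suc k
          \<le> \<rho> powr \<beta> * (real (Suc k) ^ 3 * (1 / (2 * r powr \<beta>)) ^ k)" .
      have "0 \<le> \<rho>\<^sup>2 * (MK * a2 * C * b')" using MK(1) C(1) b'0 by (simp add: a2_def)
      from mult_left_mono[OF le this]
      show "\<rho>\<^sup>2 * (MK * a2 * (C * b' * (real (k + 1) * \<rho> / r ^ k) powr \<beta>)) / 2 ^ Suc k
          \<le> \<rho>\<^sup>2 * (MK * a2 * C * b') * \<rho> powr \<beta> * (real (Suc k) ^ 3 * (1 / (2 * r powr \<beta>)) ^ k)"
        by (simp add: mult_ac)
    qed
    also have "\<dots> = \<rho>\<^sup>2 * (MK * a2 * C * b') * \<rho> powr \<beta> * (\<Sum>k<n. real (Suc k) ^ 3 * (1 / (2 * r powr \<beta>)) ^ k)"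
      by (rule sum_distrib_left[symmetric])
    also have "\<dots> \<le> \<rho>\<^sup>2 * (MK * a2 * C * b') * \<rho> powr \<beta> * S"
      unfolding S_def using MK(1) C(1) b'0 \<beta>(3)
      by (intro mult_left_mono sum_le_suminf Ssum) (auto simp: a2_def)
    also have "\<rho>\<^sup>2 * (MK * a2 * C * b') * \<rho> powr \<beta> * S + \<rho>\<^sup>2 * C2 / 2 ^ n
        \<le> (C1 + C2) * \<rho>\<^sup>2 * (\<rho> powr \<beta> + 1 / 2 ^ n)"
    proof -
      have "0 \<le> C2 * \<rho>\<^sup>2 * \<rho> powr \<beta>" "0 \<le> C1 * \<rho>\<^sup>2 * (1 / 2 ^ n)" using C12 by auto
      then show ?thesis by (simp add: C1_def algebra_simps)
    qed
    finally show ?thesis unfolding eq by (intro ennreal_leI) simp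
  qed
  show ?thesis using that[of "C1 + C2"] main C12 by simp
qed

end

section \<open>A mollifier with derivative increments\<close>

lemma lborel_complex_eq_distr:
  "(lborel :: complex measure) = distr (lborel \<Otimes>\<^sub>M lborel) borel (\<lambda>(a, b). Complex a b)"
proof (rule lborel_eqI)
  have m: "(\<lambda>(a, b). Complex a b) \<in> borel_measurable (lborel \<Otimes>\<^sub>M lborel)"
    unfolding Complex_eq case_prod_unfold lborel_prod measurable_lborel2
    by (intro borel_measurable_continuous_onI continuous_intros)
  fix l u :: complex
  assume le: "\<And>b. b \<in> Basis \<Longrightarrow> l \<bullet> b \<le> u \<bullet> b"
  have le': "Re l \<le> Re u" "Im l \<le> Im u"
    using le[of 1] le[of \<i>] by (simp_all add: Basis_complex_def inner_complex_def)
  have "(\<lambda>(a, b). Complex a b) -` box l u \<inter> space (lborel \<Otimes>\<^sub>M lborel)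
      = {Re l<..<Re u} \<times> {Im l<..<Im u}"
    by (auto simp: box_def Basis_complex_def inner_complex_def space_pair_measure)
  then have "emeasure (distr (lborel \<Otimes>\<^sub>M lborel) borel (\<lambda>(a, b). Complex a b)) (box l u)
      = emeasure (lborel \<Otimes>\<^sub>M lborel) ({Re l<..<Re u} \<times> {Im l<..<Im u})"
    by (subst emeasure_distr[OF m]) auto
  also have "\<dots> = ennreal (Re u - Re l) * ennreal (Im u - Im l)"
    using le' by (subst lborel.emeasure_pair_measure_Times) auto
  also have "\<dots> = ennreal (\<Prod>b\<in>Basis. (u - l) \<bullet> b)"
    using le' by (simp add: Basis_complex_def inner_complex_def ennreal_mult)
  finally show "emeasure (distr (lborel \<Otimes>\<^sub>M lborel) borel (\<lambda>(a, b). Complex a b)) (box l u)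
      = ennreal (\<Prod>b\<in>Basis. (u - l) \<bullet> b)" .
qed simp

lemma nn_integral_complex:
  assumes f: "f \<in> borel_measurable borel"
  shows "(\<integral>\<^sup>+z. f z \<partial>lborel) = (\<integral>\<^sup>+a. \<integral>\<^sup>+b. f (Complex a b) \<partial>lborel \<partial>lborel)"
proof -
  have m: "(\<lambda>(a, b). Complex a b) \<in> borel_measurable (lborel \<Otimes>\<^sub>M lborel)"
    unfolding Complex_eq case_prod_unfold lborel_prod measurable_lborel2
    by (intro borel_measurable_continuous_onI continuous_intros)
  have "(\<integral>\<^sup>+z. f z \<partial>lborel) = (\<integral>\<^sup>+w. f (case w of (a, b) \<Rightarrow> Complex a b) \<partial>(lborel \<Otimes>\<^sub>M lborel))"
    by (subst lborel_complex_eq_distr) (rule nn_integral_distr[OF m], simp add: f)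
  also have "\<dots> = (\<integral>\<^sup>+a. \<integral>\<^sup>+b. f (Complex a b) \<partial>lborel \<partial>lborel)"
    using lborel.nn_integral_fst[OF measurable_compose[OF m f]] by simp
  finally show ?thesis .
qed

text \<open>The function \<open>(1 - t^2)^5\<close> on \<open>[-1, 1]\<close>, extended by zero,
  with its first three derivatives in closed form. The fifth power makes all of them continuous at
  the ends of the support.\<close>

definition raw_bump :: "nat \<Rightarrow> real \<Rightarrow> real" where
  "raw_bump i t = (let m = max 0 (1 - t\<^sup>2) in
     if i = 0 then m ^ 5 else if i = 1 then - 10 * t * m ^ 4
     else if i = 2 then - 10 * m ^ 4 + 80 * t\<^sup>2 * m ^ 3 else 240 * t * m ^ 3 - 480 * t ^ 3 * m\<^sup>2)"

lemma raw_bump_eq_0: "1 \<le> \<bar>t\<bar> \<Longrightarrow> raw_bump i t = 0"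
proof -
  assume "1 \<le> \<bar>t\<bar>"
  then have "1 \<le> t\<^sup>2" using power_mono[of 1 "\<bar>t\<bar>" 2] by simp
  then have "max 0 (1 - t\<^sup>2) = 0" by simp
  then show ?thesis by (simp add: raw_bump_def)
qed

lemma raw_bump_continuous: "continuous_on S (raw_bump i)"
proof -
  consider "i = 0" | "i = 1" | "i = 2" | "i \<noteq> 0" "i \<noteq> 1" "i \<noteq> 2" by blast
  then show ?thesis
    unfolding raw_bump_def Let_def by cases (simp_all, (intro continuous_intros)+)
qed

lemma raw_bump_0_nonneg: "0 \<le> raw_bump 0 t"
  by (simp add: raw_bump_def Let_def)

lemma raw_bump_derivative:
  assumes "i < 3"
  shows "(raw_bump i has_real_derivative raw_bump (Suc i) t) (at t)"
proof -
  let ?m = "\<lambda>t::real. max 0 (1 - t\<^sup>2)"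
  have sq: "((\<lambda>t. 1 - t\<^sup>2) has_real_derivative - 2 * t) (at t)"
    by (auto intro!: derivative_eq_intros)
  have d: "((\<lambda>t. ?m t ^ Suc (Suc n)) has_real_derivative of_nat (Suc (Suc n)) * ?m t ^ Suc n * (- 2 * t)) (at t)" for n
    using DERIV_chain2[OF has_real_derivative_max0_power sq] .
  have d5: "((\<lambda>t. ?m t ^ 5) has_real_derivative 5 * ?m t ^ 4 * (- 2 * t)) (at t)"
    using d[of 3] by (simp add: numeral_eq_Suc)
  have d4: "((\<lambda>t. ?m t ^ 4) has_real_derivative 4 * ?m t ^ 3 * (- 2 * t)) (at t)"
    using d[of 2] by (simp add: numeral_eq_Suc)
  have d3: "((\<lambda>t. ?m t ^ 3) has_real_derivative 3 * ?m t ^ 2 * (- 2 * t)) (at t)"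
    using d[of 1] by (simp add: numeral_eq_Suc)
  consider "i = 0" | "i = 1" | "i = 2" using assms by linarith
  then show ?thesis
  proof cases
    case 1
    then have "raw_bump i = (\<lambda>t. ?m t ^ 5)" "raw_bump (Suc i) t = 5 * ?m t ^ 4 * (- 2 * t)"
      by (simp_all add: raw_bump_def[abs_def] Let_def)
    then show ?thesis using d5 by simp
  next
    case 2
    then have e: "raw_bump i = (\<lambda>t. - 10 * t * ?m t ^ 4)" by (simp add: raw_bump_def[abs_def] Let_def)
    have "((\<lambda>t. - 10 * t * ?m t ^ 4) has_real_derivative (- 10 * t * (4 * ?m t ^ 3 * (- 2 * t)) + - 10 * 1 * ?m t ^ 4)) (at t)"
      by (rule DERIV_mult'[OF DERIV_cmult[OF DERIV_ident] d4])
    moreover have "- 10 * t * (4 * ?m t ^ 3 * (- 2 * t)) + - 10 * 1 * ?m t ^ 4 = raw_bump (Suc i) t"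
      using 2 by (simp add: raw_bump_def Let_def power2_eq_square)
    ultimately show ?thesis unfolding e by simp
  next
    case 3
    then have e: "raw_bump i = (\<lambda>t. - 10 * ?m t ^ 4 + 80 * t\<^sup>2 * ?m t ^ 3)"
      by (simp add: raw_bump_def[abs_def] Let_def)
    have "((\<lambda>t. 80 * t\<^sup>2) has_real_derivative 160 * t) (at t)"
      by (auto intro!: derivative_eq_intros)
    from DERIV_mult'[OF this d3]
    have "((\<lambda>t. - 10 * ?m t ^ 4 + 80 * t\<^sup>2 * ?m t ^ 3) has_real_derivative
        (- 10 * (4 * ?m t ^ 3 * (- 2 * t)) + (80 * t\<^sup>2 * (3 * ?m t ^ 2 * (- 2 * t)) + 160 * t * ?m t ^ 3))) (at t)"
      by (rule DERIV_add[OF DERIV_cmult[OF d4]])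
    moreover have "- 10 * (4 * ?m t ^ 3 * (- 2 * t)) + (80 * t\<^sup>2 * (3 * ?m t ^ 2 * (- 2 * t)) + 160 * t * ?m t ^ 3)
        = raw_bump (Suc i) t"
      using 3 by (simp add: raw_bump_def Let_def power2_eq_square power3_eq_cube algebra_simps)
    ultimately show ?thesis unfolding e by simp
  qed
qed

definition bump_mass :: real where "bump_mass = (\<integral>t. raw_bump 0 t \<partial>lborel)"

lemma raw_bump_integrable: "integrable lborel (raw_bump 0)"
proof -
  have "integrable lborel (\<lambda>t. indicator {-1..1} t *\<^sub>R raw_bump 0 t)"
    by (rule borel_integrable_compact) (auto intro: raw_bump_continuous)
  moreover have "(\<lambda>t. indicator {-1..1} t *\<^sub>R raw_bump 0 t) = raw_bump 0"
  proof
    fix t :: real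
    show "indicator {-1..1} t *\<^sub>R raw_bump 0 t = raw_bump 0 t"
    proof (cases "1 \<le> \<bar>t\<bar>")
      case False
      then have "t \<in> {-1..1}" by auto
      then show ?thesis by simp
    qed (simp add: raw_bump_eq_0)
  qed
  ultimately show ?thesis by simp
qed

lemma bump_mass_pos: "0 < bump_mass"
proof -
  have "(\<integral>t. (1/2) ^ 5 * indicator {-1/2..1/2::real} t \<partial>lborel) \<le> bump_mass"
    unfolding bump_mass_def
  proof (rule integral_mono[OF _ raw_bump_integrable])
    fix t :: real
    show "(1/2) ^ 5 * indicator {-1/2..1/2} t \<le> raw_bump 0 t"
    proof (cases "t \<in> {-1/2..1/2}")
      case True
      then have "\<bar>t\<bar> \<le> 1/2" by auto
      then have "t\<^sup>2 \<le> (1/2)\<^sup>2" using power_mono[of "\<bar>t\<bar>" "1/2" 2] by simp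
      moreover have "(1/2)\<^sup>2 = (1/4 :: real)" by (simp add: power2_eq_square)
      ultimately have "1/2 \<le> 1 - t\<^sup>2" by linarith
      then have "1/2 \<le> max 0 (1 - t\<^sup>2)" by (rule order.trans[OF _ max.cobounded2])
      then have le: "(1/2) ^ 5 \<le> max 0 (1 - t\<^sup>2) ^ 5" by (rule power_mono) simp
      have "(1/2) ^ 5 * indicator {-1/2..1/2} t = (1/2 :: real) ^ 5" using True by (simp only: indicator_simps mult_1_right)
      also note le
      also have "max 0 (1 - t\<^sup>2) ^ 5 = raw_bump 0 t" by (simp add: raw_bump_def Let_def)
      finally show ?thesis .
    qed (simp add: raw_bump_0_nonneg)
  qed simp
  moreover have "(\<integral>t. (1/2) ^ 5 * indicator {-1/2..1/2::real} t \<partial>lborel) = (1/2 :: real) ^ 5" by simp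
  moreover have "0 < (1/2 :: real) ^ 5" by (intro zero_less_power) simp
  ultimately show ?thesis by linarith
qed

definition bump :: "nat \<Rightarrow> real \<Rightarrow> real" where
  "bump i t = raw_bump i t / bump_mass"

text \<open>The primitive of the bump that vanishes on the left. Any start left of \<open>-1\<close>
  gives the same function; for \<open>t < -2\<close> the interval is empty and the integral is 0, as
  it should be.\<close>

definition raw_step :: "real \<Rightarrow> real" where
  "raw_step t = integral {-2..t} (raw_bump 0)"

lemma raw_step_derivative: "(raw_step has_real_derivative raw_bump 0 t) (at t)"
proof (cases "-2 < t")
  case True
  have "((\<lambda>x. integral {-2..x} (raw_bump 0)) has_real_derivative raw_bump 0 t) (at t within {-2..t + 1})"
    by (rule integral_has_real_derivative[OF raw_bump_continuous]) (use True in auto)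
  moreover have "at t within {-2..t + 1} = at t"
    using True by (intro at_within_interior) (simp add: interior_atLeastAtMost_real)
  ultimately show ?thesis by (simp add: raw_step_def[abs_def])
next
  case False
  have z: "raw_step s = 0" if "s < -1" for s
  proof -
    have "integral {-2..s} (raw_bump 0) = integral {-2..s} (\<lambda>_. 0)"
      by (rule Henstock_Kurzweil_Integration.integral_cong) (use that in \<open>auto intro: raw_bump_eq_0\<close>)
    then show ?thesis by (simp add: raw_step_def)
  qed
  have "((\<lambda>_. 0) has_real_derivative 0) (at t)" by simp
  then have "(raw_step has_real_derivative 0) (at t)"
    by (rule has_field_derivative_transform_within_open[where S = "{..<-1}"]) (use False z in auto)
  then show ?thesis using False by (simp add: raw_bump_eq_0)
qed

lemma raw_step_left: "t \<le> -1 \<Longrightarrow> raw_step t = 0"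
proof -
  assume "t \<le> -1"
  then have "integral {-2..t} (raw_bump 0) = integral {-2..t} (\<lambda>_. 0)"
    by (intro Henstock_Kurzweil_Integration.integral_cong) (auto intro: raw_bump_eq_0)
  then show ?thesis by (simp add: raw_step_def)
qed

lemma raw_step_right: "1 \<le> t \<Longrightarrow> raw_step t = raw_step 1"
proof -
  assume t: "1 \<le> t"
  have "raw_bump 0 integrable_on {-2..t}"
    by (rule integrable_continuous_real[OF raw_bump_continuous])
  then have "integral {-2..1} (raw_bump 0) + integral {1..t} (raw_bump 0) = integral {-2..t} (raw_bump 0)"
    by (intro Henstock_Kurzweil_Integration.integral_combine) (use t in auto)
  moreover have "integral {1..t} (raw_bump 0) = integral {1..t} (\<lambda>_. 0)"
    by (intro Henstock_Kurzweil_Integration.integral_cong) (auto intro: raw_bump_eq_0)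
  ultimately show ?thesis by (simp add: raw_step_def)
qed

text \<open>With \<open>\<phi> = bump 0\<close>, index 0 is the primitive of
  \<open>2 \<phi>(2 t) - \<phi>(t)\<close>. It has compact support because dilation preserves the
  mass, so that the two primitives agree on both sides of \<open>[-1, 1]\<close>. Index
  \<open>Suc j\<close> is derivative number \<open>j\<close> of that difference.\<close>

definition scale_step :: "nat \<Rightarrow> real \<Rightarrow> real" where
  "scale_step i t = (case i of 0 \<Rightarrow> (raw_step (2 * t) - raw_step t) / bump_mass
     | Suc j \<Rightarrow> 2 ^ Suc j * bump j (2 * t) - bump j t)"

lemma bump_derivative: "i < 3 \<Longrightarrow> (bump i has_real_derivative bump (Suc i) t) (at t)"
  unfolding bump_def[abs_def] by (intro DERIV_cdivide raw_bump_derivative)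

lemma bump_eq_0: "1 \<le> \<bar>t\<bar> \<Longrightarrow> bump i t = 0"
  by (simp add: bump_def raw_bump_eq_0)

lemma bump_continuous: "continuous_on S (bump i)"
  unfolding bump_def[abs_def] by (intro continuous_intros raw_bump_continuous) (use bump_mass_pos in auto)

lemma dilate_derivative:
  assumes "(f has_real_derivative f') (at (2 * t))"
  shows "((\<lambda>t. f (2 * t)) has_real_derivative 2 * f') (at t)"
proof -
  have "((\<lambda>t. 2 * t) has_real_derivative 2) (at t)" by (auto intro!: derivative_eq_intros)
  from DERIV_chain2[of f f' "\<lambda>t. 2 * t", OF assms this] show ?thesis by (simp add: mult.commute)
qed

lemma scale_step_derivative: "i < 3 \<Longrightarrow> (scale_step i has_real_derivative scale_step (Suc i) t) (at t)"
proof (cases i)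
  case 0
  have "((\<lambda>t. (raw_step (2 * t) - raw_step t) / bump_mass) has_real_derivative
      (2 * raw_bump 0 (2 * t) - raw_bump 0 t) / bump_mass) (at t)"
    by (intro DERIV_cdivide DERIV_diff dilate_derivative raw_step_derivative)
  moreover have "(2 * raw_bump 0 (2 * t) - raw_bump 0 t) / bump_mass = scale_step (Suc i) t"
    by (simp add: 0 scale_step_def bump_def diff_divide_distrib)
  ultimately show ?thesis by (simp add: 0 scale_step_def[abs_def])
next
  case (Suc j)
  assume "i < 3"
  then have "((\<lambda>t. 2 ^ Suc j * bump j (2 * t) - bump j t) has_real_derivative
      2 ^ Suc j * (2 * bump (Suc j) (2 * t)) - bump (Suc j) t) (at t)"
    using Suc by (intro DERIV_cmult DERIV_diff dilate_derivative bump_derivative) auto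
  then show ?thesis by (simp add: Suc scale_step_def[abs_def] mult_ac)
qed

lemma scale_step_eq_0: "1 \<le> \<bar>t\<bar> \<Longrightarrow> scale_step i t = 0"
proof (cases i)
  case 0
  assume "1 \<le> \<bar>t\<bar>"
  then consider "1 \<le> t" | "t \<le> -1" by linarith
  then show ?thesis
    by cases (simp_all add: 0 scale_step_def raw_step_right[of t] raw_step_right[of "2 * t"]
        raw_step_left[of t] raw_step_left[of "2 * t"])
next
  case (Suc j)
  assume "1 \<le> \<bar>t\<bar>"
  then show ?thesis by (simp add: Suc scale_step_def bump_eq_0)
qed

lemma scale_step_continuous: "continuous_on UNIV (scale_step i)"
proof (cases i)
  case 0
  have "isCont (scale_step 0) t" for t using DERIV_isCont[OF scale_step_derivative[of 0]] by simp
  then show ?thesis using 0 by (simp add: continuous_at_imp_continuous_on)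
next
  case (Suc j)
  have "continuous_on UNIV (\<lambda>t. bump j (2 * t))"
    by (rule continuous_on_compose2[OF bump_continuous[of UNIV]]) (auto intro: continuous_intros)
  then show ?thesis
    unfolding Suc scale_step_def[abs_def] nat.case by (intro continuous_intros bump_continuous)
qed

definition dilated_bump :: "nat \<Rightarrow> real \<Rightarrow> real" where
  "dilated_bump i t = 2 * 2 ^ i * bump i (2 * t)"

lemma dilated_bump_continuous: "continuous_on UNIV (dilated_bump i)"
proof -
  have "continuous_on UNIV (\<lambda>t. bump i (2 * t))"
    by (rule continuous_on_compose2[OF bump_continuous[of UNIV]]) (auto intro: continuous_intros)
  then show ?thesis unfolding dilated_bump_def[abs_def] by (intro continuous_intros)
qed

lemma dilated_bump_derivative: "i < 3 \<Longrightarrow> (dilated_bump i has_real_derivative dilated_bump (Suc i) t) (at t)"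
proof -
  assume "i < 3"
  then have "((\<lambda>t. 2 * 2 ^ i * bump i (2 * t)) has_real_derivative 2 * 2 ^ i * (2 * bump (Suc i) (2 * t))) (at t)"
    by (intro DERIV_cmult dilate_derivative bump_derivative)
  then show ?thesis by (simp add: dilated_bump_def[abs_def] mult_ac)
qed

lemma dilated_bump_eq_0: "1 \<le> \<bar>t\<bar> \<Longrightarrow> dilated_bump i t = 0"
  by (simp add: dilated_bump_def bump_eq_0)

interpretation horizontal: smooth_kernel scale_step bump
  by (rule smooth_kernel.intro) (auto intro: scale_step_derivative bump_derivative scale_step_continuous bump_continuous
      scale_step_eq_0 bump_eq_0)

interpretation vertical: smooth_kernel dilated_bump scale_step
  by (rule smooth_kernel.intro) (auto intro: scale_step_derivative dilated_bump_derivative scale_step_continuous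
      dilated_bump_continuous scale_step_eq_0 dilated_bump_eq_0)

definition mollifier :: "complex \<Rightarrow> real" where
  "mollifier z = bump 0 (Re z) * bump 0 (Im z)"

text \<open>Telescoping: with \<open>a(t) = 2 \<phi>(2 t)\<close> and \<open>b = \<phi>\<close>, the
  product \<open>a a - b b\<close> is \<open>(a - b) b + a (a - b)\<close>, where
  \<open>a - b\<close> is the derivative of \<open>scale_step 0\<close>. Each summand is thus a
  first derivative of a compactly supported kernel, one in each direction, and can be integrated by
  parts; the mollifier itself could not.\<close>

lemma mollifier_dilation:
  "4 * mollifier (2 * z) - mollifier z = horizontal.K 1 0 z + vertical.K 0 1 z"
  by (simp add: mollifier_def horizontal.K_def vertical.K_def scale_step_def dilated_bump_def algebra_simps)

lemma mollifier_nonneg: "0 \<le> mollifier z"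
  using bump_mass_pos by (simp add: mollifier_def bump_def raw_bump_0_nonneg)

lemma mollifier_continuous: "continuous_on UNIV mollifier"
  unfolding mollifier_def[abs_def]
  by (intro continuous_intros continuous_on_compose2[OF bump_continuous[of UNIV]]) auto

lemma mollifier_eq_0: "2 < cmod z \<Longrightarrow> mollifier z = 0"
proof -
  assume "2 < cmod z"
  then have "1 \<le> \<bar>Re z\<bar> \<or> 1 \<le> \<bar>Im z\<bar>" using cmod_le[of z] by linarith
  then show ?thesis by (auto simp: mollifier_def bump_eq_0)
qed

lemma mollifier_bounded: "\<exists>B. \<forall>z. mollifier z \<le> B"
proof -
  have "raw_bump 0 t \<le> 1" for t
    unfolding raw_bump_def Let_def by (simp add: power_le_one)
  then have b: "bump 0 t \<le> 1 / bump_mass" for t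
    using bump_mass_pos by (simp add: bump_def divide_right_mono)
  have "mollifier z \<le> 1 / bump_mass * (1 / bump_mass)" for z
    unfolding mollifier_def using bump_mass_pos
    by (intro mult_mono b) (auto simp: bump_def raw_bump_0_nonneg)
  then show ?thesis by blast
qed

lemma nn_integral_mollifier: "(\<integral>\<^sup>+z. ennreal (mollifier z) \<partial>lborel) = 1"
proof -
  have b0: "0 \<le> bump 0 t" for t using bump_mass_pos by (simp add: bump_def raw_bump_0_nonneg)
  have bm: "bump 0 \<in> borel_measurable borel" by (intro borel_measurable_continuous_onI bump_continuous)
  have "integrable lborel (bump 0)" unfolding bump_def[abs_def] using raw_bump_integrable by simp
  then have "(\<integral>\<^sup>+t. ennreal (bump 0 t) \<partial>lborel) = ennreal (\<integral>t. bump 0 t \<partial>lborel)"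
    using b0 by (intro nn_integral_eq_integral) auto
  also have "(\<integral>t. bump 0 t \<partial>lborel) = 1"
    using bump_mass_pos by (simp add: bump_def bump_mass_def[symmetric])
  finally have one: "(\<integral>\<^sup>+t. ennreal (bump 0 t) \<partial>lborel) = 1" by simp
  have "mollifier \<in> borel_measurable borel"
    by (intro borel_measurable_continuous_onI mollifier_continuous)
  then have "(\<integral>\<^sup>+z. ennreal (mollifier z) \<partial>lborel)
      = (\<integral>\<^sup>+a. \<integral>\<^sup>+b. ennreal (mollifier (Complex a b)) \<partial>lborel \<partial>lborel)"
    by (intro nn_integral_complex) simp
  also have "\<dots> = (\<integral>\<^sup>+a. \<integral>\<^sup>+b. ennreal (bump 0 a) * ennreal (bump 0 b) \<partial>lborel \<partial>lborel)"
    by (simp add: mollifier_def ennreal_mult b0)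
  also have "\<dots> = 1"
    using bm by (simp add: nn_integral_cmult one)
  finally show ?thesis .
qed

section \<open>Sampling on a grid\<close>

text \<open>The value \<open>(f t0)^2\<close> is at most the mean of \<open>f^2\<close> plus its
  oscillation. The oscillation is at most the integral of \<open>|2 f f'|\<close>, which is split by
  the arithmetic-geometric mean inequality with weight \<open>h\<close> so that both terms scale
  alike.\<close>

lemma sobolev_interval:
  fixes f f' :: "real \<Rightarrow> real"
  assumes df: "\<And>t. (f has_real_derivative f' t) (at t)" and cf': "continuous_on UNIV f'"
    and h: "0 < h" and t0: "t0 \<in> {c..<c + h}"
  shows "ennreal ((f t0)\<^sup>2) \<le> (\<integral>\<^sup>+t. ennreal (2 / h * (f t)\<^sup>2 + h * (f' t)\<^sup>2) * indicator {c..<c + h} t \<partial>lborel)"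
proof -
  define I where "I = {c..c + h}"
  define w where "w t = (f t)\<^sup>2 / h + h * (f' t)\<^sup>2" for t
  have cf: "continuous_on UNIV f" by (meson DERIV_isCont continuous_at_imp_continuous_on df)
  have cw: "continuous_on S w" for S
    unfolding w_def[abs_def] by (intro continuous_intros continuous_on_subset[OF cf] continuous_on_subset[OF cf']) (use h in auto)
  have wi: "w integrable_on {a..b}" for a b by (rule integrable_continuous_real[OF cw])
  have w0: "0 \<le> w t" for t unfolding w_def using h by simp
  have le_w: "\<bar>2 * f t * f' t\<bar> \<le> w t" for t
  proof -
    have "2 * (\<bar>f t\<bar> / sqrt h) * (sqrt h * \<bar>f' t\<bar>) \<le> (\<bar>f t\<bar> / sqrt h)\<^sup>2 + (sqrt h * \<bar>f' t\<bar>)\<^sup>2"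
      by (rule sum_squares_bound)
    then show ?thesis using h by (simp add: w_def power_divide power_mult_distrib abs_mult)
  qed
  have der: "((\<lambda>t. 2 * f t * f' t) has_integral (f t)\<^sup>2 - (f s)\<^sup>2) {s..t}" if "s \<le> t" for s t
    using that
  proof (rule fundamental_theorem_of_calculus)
    fix x
    have "((\<lambda>t. (f t)\<^sup>2) has_real_derivative 2 * f x * f' x) (at x within {s..t})"
      using DERIV_power[OF DERIV_subset[OF df[of x]], of "{s..t}" 2] by (simp add: mult_ac)
    then show "((\<lambda>t. (f t)\<^sup>2) has_vector_derivative 2 * f x * f' x) (at x within {s..t})"
      by (simp add: has_real_derivative_iff_has_vector_derivative)
  qed
  define E where "E = integral I w"
  have osc: "\<bar>(f t)\<^sup>2 - (f s)\<^sup>2\<bar> \<le> E" if "s \<le> t" "s \<in> I" "t \<in> I" for s t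
  proof -
    have i: "(w has_integral integral {s..t} w) {s..t}" using wi by (rule integrable_integral)
    have "(f t)\<^sup>2 - (f s)\<^sup>2 \<le> integral {s..t} w"
      by (rule has_integral_le[OF der[OF that(1)] i]) (use le_w in \<open>auto simp: abs_le_iff\<close>)
    moreover have "- ((f t)\<^sup>2 - (f s)\<^sup>2) \<le> integral {s..t} w"
      by (rule has_integral_le[OF has_integral_neg[OF der[OF that(1)]] i]) (use le_w in \<open>auto simp: abs_le_iff\<close>)
    moreover have "integral {s..t} w \<le> E"
      unfolding E_def I_def by (rule integral_subset_le[OF _ wi wi]) (use that w0 in \<open>auto simp: I_def\<close>)
    ultimately show ?thesis by linarith
  qed
  have pt: "(f t0)\<^sup>2 \<le> (f s)\<^sup>2 + E" if "s \<in> I" for s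
    using osc[of s t0] osc[of t0 s] that t0 by (cases "s \<le> t0") (auto simp: I_def abs_le_iff)
  have fi: "(\<lambda>t. (f t)\<^sup>2) integrable_on I"
    unfolding I_def by (intro integrable_continuous_real continuous_intros continuous_on_subset[OF cf]) auto
  have const: "((\<lambda>_. k) has_integral h * k) I" for k :: real
    using has_integral_const_real[of k c "c + h"] h by (simp add: I_def)
  have "h * (f t0)\<^sup>2 \<le> integral I (\<lambda>t. (f t)\<^sup>2) + h * E"
    by (rule has_integral_le[OF const has_integral_add[OF integrable_integral[OF fi] const]]) (use pt in auto)
  then have le: "(f t0)\<^sup>2 \<le> integral I (\<lambda>t. (f t)\<^sup>2) / h + E" using h by (simp add: field_simps)
  have "((\<lambda>t. (f t)\<^sup>2 / h + w t) has_integral integral I (\<lambda>t. (f t)\<^sup>2) / h + E) I"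
    unfolding E_def by (intro has_integral_add has_integral_divide integrable_integral fi) (use wi in \<open>simp add: I_def\<close>)
  moreover have "(f t)\<^sup>2 / h + w t = 2 / h * (f t)\<^sup>2 + h * (f' t)\<^sup>2" for t by (simp add: w_def)
  ultimately have "((\<lambda>t. 2 / h * (f t)\<^sup>2 + h * (f' t)\<^sup>2) has_integral integral I (\<lambda>t. (f t)\<^sup>2) / h + E) I" by simp
  then have "(\<integral>\<^sup>+t. ennreal (2 / h * (f t)\<^sup>2 + h * (f' t)\<^sup>2) * indicator I t \<partial>lborel)
      = ennreal (integral I (\<lambda>t. (f t)\<^sup>2) / h + E)"
    by (intro nn_integral_has_integral_lebesgue') (use h in auto)
  moreover have "(\<integral>\<^sup>+t. ennreal (2 / h * (f t)\<^sup>2 + h * (f' t)\<^sup>2) * indicator I t \<partial>lborel)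
      = (\<integral>\<^sup>+t. ennreal (2 / h * (f t)\<^sup>2 + h * (f' t)\<^sup>2) * indicator {c..<c + h} t \<partial>lborel)"
    by (rule nn_integral_cong_AE, rule AE_mp[OF AE_lborel_singleton[of "c + h"]])
       (auto simp: I_def indicator_def)
  ultimately show ?thesis using le by (metis ennreal_leI)
qed

text \<open>Half-open, so that the squares of one grid are disjoint and cover the plane.\<close>

definition grid_square :: "real \<Rightarrow> int \<times> int \<Rightarrow> complex set" where
  "grid_square h g = {z. Re z \<in> {h * fst g..<h * fst g + h} \<and> Im z \<in> {h * snd g..<h * snd g + h}}"

text \<open>The interval inequality is applied in one variable and then, to \<open>u\<close> and to
  \<open>ua\<close>, in the other. Iterating in this way calls for the mixed derivative but for no
  pure second one, so two derivatives in all are spent on sampling.\<close>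

lemma sobolev_square:
  fixes u ua ub uab :: "complex \<Rightarrow> real"
  assumes da: "\<And>a b. ((\<lambda>a. u (Complex a b)) has_real_derivative ua (Complex a b)) (at a)"
    and db: "\<And>a b. ((\<lambda>b. u (Complex a b)) has_real_derivative ub (Complex a b)) (at b)"
    and dab: "\<And>a b. ((\<lambda>b. ua (Complex a b)) has_real_derivative uab (Complex a b)) (at b)"
    and cont: "continuous_on UNIV u" "continuous_on UNIV ua" "continuous_on UNIV ub" "continuous_on UNIV uab"
    and h: "0 < h" and \<zeta>: "\<zeta> \<in> grid_square h g"
  shows "ennreal ((u \<zeta>)\<^sup>2) \<le> (\<integral>\<^sup>+z. ennreal (4 / h\<^sup>2 * (u z)\<^sup>2 + 2 * (ub z)\<^sup>2 + 2 * (ua z)\<^sup>2 + h\<^sup>2 * (uab z)\<^sup>2)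
      * indicator (grid_square h g) z \<partial>lborel)"
proof -
  define A where "A = {h * fst g..<h * fst g + h}"
  define B where "B = {h * snd g..<h * snd g + h}"
  define a0 where "a0 = Re \<zeta>"
  define b0 where "b0 = Im \<zeta>"
  have \<zeta>_eq: "\<zeta> = Complex a0 b0" by (simp add: a0_def b0_def)
  have mem: "a0 \<in> A" "b0 \<in> B" using \<zeta> by (auto simp: grid_square_def A_def B_def a0_def b0_def)
  have C: "continuous_on UNIV (\<lambda>a. f (Complex a b))" "continuous_on UNIV (\<lambda>b. f (Complex a b))"
    if f: "continuous_on UNIV f" for f :: "complex \<Rightarrow> real" and a b
    unfolding Complex_eq by (intro continuous_on_compose2[OF f] continuous_intros; simp)+
  have [measurable]: "u \<in> borel_measurable borel" "ua \<in> borel_measurable borel"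
    "ub \<in> borel_measurable borel" "uab \<in> borel_measurable borel"
    using cont by (auto intro: borel_measurable_continuous_onI)
  have meas: "(\<lambda>b. f (Complex a b)) \<in> borel_measurable borel"
    if "continuous_on UNIV f" for f :: "complex \<Rightarrow> real" and a
    using C[OF that] by (intro borel_measurable_continuous_onI)
  define W where "W z = 4 / h\<^sup>2 * (u z)\<^sup>2 + 2 * (ub z)\<^sup>2 + 2 * (ua z)\<^sup>2 + h\<^sup>2 * (uab z)\<^sup>2" for z
  have [measurable]: "W \<in> borel_measurable borel" unfolding W_def by measurable
  have sq: "grid_square h g \<in> sets borel"
  proof -
    have "grid_square h g = {z \<in> space borel. Re z \<in> A} \<inter> {z \<in> space borel. Im z \<in> B}"
      by (auto simp: grid_square_def A_def B_def)
    moreover have "{z \<in> space borel. Re z \<in> A} \<in> sets borel" "{z \<in> space borel. Im z \<in> B} \<in> sets borel"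
      unfolding A_def B_def by measurable
    ultimately show ?thesis by simp
  qed
  have "ennreal ((u \<zeta>)\<^sup>2) \<le> (\<integral>\<^sup>+a. ennreal (2 / h * (u (Complex a b0))\<^sup>2 + h * (ua (Complex a b0))\<^sup>2) * indicator A a \<partial>lborel)"
    unfolding \<zeta>_eq A_def
    by (rule sobolev_interval[OF da C(1)[OF cont(2)] h]) (use mem in \<open>simp add: A_def\<close>)
  also have "\<dots> \<le> (\<integral>\<^sup>+a. (\<integral>\<^sup>+b. ennreal (W (Complex a b)) * indicator B b \<partial>lborel) * indicator A a \<partial>lborel)"
  proof (rule nn_integral_mono, rule mult_right_mono)
    fix a
    have 1: "ennreal ((u (Complex a b0))\<^sup>2)
        \<le> (\<integral>\<^sup>+b. ennreal (2 / h * (u (Complex a b))\<^sup>2 + h * (ub (Complex a b))\<^sup>2) * indicator B b \<partial>lborel)"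
      unfolding B_def by (rule sobolev_interval[OF db C(2)[OF cont(3)] h]) (use mem in \<open>simp add: B_def\<close>)
    have 2: "ennreal ((ua (Complex a b0))\<^sup>2)
        \<le> (\<integral>\<^sup>+b. ennreal (2 / h * (ua (Complex a b))\<^sup>2 + h * (uab (Complex a b))\<^sup>2) * indicator B b \<partial>lborel)"
      unfolding B_def by (rule sobolev_interval[OF dab C(2)[OF cont(4)] h]) (use mem in \<open>simp add: B_def\<close>)
    have Bm: "B \<in> sets borel" by (simp add: B_def)
    note [measurable] = meas[OF cont(1), of a] meas[OF cont(2), of a] meas[OF cont(3), of a] meas[OF cont(4), of a] Bm
    have "ennreal (2 / h * (u (Complex a b0))\<^sup>2 + h * (ua (Complex a b0))\<^sup>2)
        = ennreal (2 / h) * ennreal ((u (Complex a b0))\<^sup>2) + ennreal h * ennreal ((ua (Complex a b0))\<^sup>2)"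
    proof -
      have "0 \<le> 2 / h" "0 \<le> h" using h by auto
      then show ?thesis by (simp only: ennreal_plus ennreal_mult mult_nonneg_nonneg zero_le_power2)
    qed
    also have "\<dots> \<le> ennreal (2 / h) * (\<integral>\<^sup>+b. ennreal (2 / h * (u (Complex a b))\<^sup>2 + h * (ub (Complex a b))\<^sup>2) * indicator B b \<partial>lborel)
        + ennreal h * (\<integral>\<^sup>+b. ennreal (2 / h * (ua (Complex a b))\<^sup>2 + h * (uab (Complex a b))\<^sup>2) * indicator B b \<partial>lborel)"
      by (intro add_mono mult_left_mono 1 2) auto
    also have "\<dots> = (\<integral>\<^sup>+b. ennreal (2 / h) * (ennreal (2 / h * (u (Complex a b))\<^sup>2 + h * (ub (Complex a b))\<^sup>2) * indicator B b)
        + ennreal h * (ennreal (2 / h * (ua (Complex a b))\<^sup>2 + h * (uab (Complex a b))\<^sup>2) * indicator B b) \<partial>lborel)"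
      by (subst nn_integral_add) (auto simp: nn_integral_cmult)
    also have "\<dots> = (\<integral>\<^sup>+b. ennreal (W (Complex a b)) * indicator B b \<partial>lborel)"
    proof (rule nn_integral_cong)
      fix b
      have "ennreal (2 / h) * ennreal (2 / h * (u (Complex a b))\<^sup>2 + h * (ub (Complex a b))\<^sup>2)
          + ennreal h * ennreal (2 / h * (ua (Complex a b))\<^sup>2 + h * (uab (Complex a b))\<^sup>2)
        = ennreal (2 / h * (2 / h * (u (Complex a b))\<^sup>2 + h * (ub (Complex a b))\<^sup>2)
          + h * (2 / h * (ua (Complex a b))\<^sup>2 + h * (uab (Complex a b))\<^sup>2))"
        using h by (simp flip: ennreal_mult ennreal_plus)
      also have "2 / h * (2 / h * (u (Complex a b))\<^sup>2 + h * (ub (Complex a b))\<^sup>2)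
          + h * (2 / h * (ua (Complex a b))\<^sup>2 + h * (uab (Complex a b))\<^sup>2) = W (Complex a b)"
        using h by (simp add: W_def power2_eq_square field_simps)
      finally show "ennreal (2 / h) * (ennreal (2 / h * (u (Complex a b))\<^sup>2 + h * (ub (Complex a b))\<^sup>2) * indicator B b)
          + ennreal h * (ennreal (2 / h * (ua (Complex a b))\<^sup>2 + h * (uab (Complex a b))\<^sup>2) * indicator B b)
        = ennreal (W (Complex a b)) * indicator B b"
        by (cases "b \<in> B") auto
    qed
    finally show "ennreal (2 / h * (u (Complex a b0))\<^sup>2 + h * (ua (Complex a b0))\<^sup>2)
        \<le> (\<integral>\<^sup>+b. ennreal (W (Complex a b)) * indicator B b \<partial>lborel)" .
  qed simp
  also have "\<dots> = (\<integral>\<^sup>+a. \<integral>\<^sup>+b. ennreal (W (Complex a b)) * indicator (grid_square h g) (Complex a b) \<partial>lborel \<partial>lborel)"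
  proof (rule nn_integral_cong)
    fix a
    have "(\<integral>\<^sup>+b. ennreal (W (Complex a b)) * indicator (grid_square h g) (Complex a b) \<partial>lborel)
        = (\<integral>\<^sup>+b. (ennreal (W (Complex a b)) * indicator B b) * indicator A a \<partial>lborel)"
      by (rule nn_integral_cong) (auto simp: grid_square_def A_def B_def indicator_def)
    then show "(\<integral>\<^sup>+b. ennreal (W (Complex a b)) * indicator B b \<partial>lborel) * indicator A a
        = (\<integral>\<^sup>+b. ennreal (W (Complex a b)) * indicator (grid_square h g) (Complex a b) \<partial>lborel)"
      by (cases "a \<in> A") auto
  qed
  also have "\<dots> = (\<integral>\<^sup>+z. ennreal (W z) * indicator (grid_square h g) z \<partial>lborel)"
    by (rule nn_integral_complex[symmetric]) (use sq in measurable)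
  finally show ?thesis unfolding W_def .
qed

lemma sum_quotients_split:
  fixes c N :: real
  shows "(\<Sum>p\<in>S. f p - (g p + h p) / c) / N = (\<Sum>p\<in>S. f p) / N - ((\<Sum>p\<in>S. g p) / N + (\<Sum>p\<in>S. h p) / N) / c"
proof -
  have "(\<Sum>p\<in>S. f p - (g p + h p) / c) = (\<Sum>p\<in>S. f p) - ((\<Sum>p\<in>S. g p) + (\<Sum>p\<in>S. h p)) / c"
    by (simp only: sum_subtractf sum.distrib flip: sum_divide_distrib)
  then show ?thesis by (simp add: diff_divide_distrib add_divide_distrib mult.commute)
qed

section \<open>Derivatives of averaged kernels in the parameter\<close>

context oscillation
begin

definition Re1 where "Re1 p z = Re (poly (pderiv p) z)"
definition Im1 where "Im1 p z = Im (poly (pderiv p) z)"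
definition Re2 where "Re2 p z = Re (poly (pderiv (pderiv p)) z)"
definition Im2 where "Im2 p z = Im (poly (pderiv (pderiv p)) z)"

lemma amplitude_derivatives: "amplitude M Re1" "amplitude M Im1" "amplitude M Re2" "amplitude M Im2"
  unfolding Re1_def[abs_def] Im1_def[abs_def] Re2_def[abs_def] Im2_def[abs_def]
  by (rule amplitude_Re_Im(1)[of pderiv] amplitude_Re_Im(2)[of pderiv]
      amplitude_Re_Im(1)[of "\<lambda>p. pderiv (pderiv p)"] amplitude_Re_Im(2)[of "\<lambda>p. pderiv (pderiv p)"],
      use bound1 bound2 bound3 in blast)+

lemma K_arg_has_derivative:
  assumes "i < 3" "l < 3" "0 < \<rho>"
  shows "((\<lambda>z. K i l ((x - poly p z) / of_real \<rho>)) has_derivative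
    (\<lambda>h. - (K (Suc i) l ((x - poly p z) / of_real \<rho>) * Re (poly (pderiv p) z * h)
        + K i (Suc l) ((x - poly p z) / of_real \<rho>) * Im (poly (pderiv p) z * h)) / \<rho>)) (at z)"
proof -
  have "((\<lambda>z. (x - poly p z) / of_real \<rho>) has_field_derivative - poly (pderiv p) z / of_real \<rho>) (at z)"
    using assms by (auto intro!: derivative_eq_intros)
  then have "((\<lambda>z. (x - poly p z) / of_real \<rho>) has_derivative (\<lambda>h. - poly (pderiv p) z / of_real \<rho> * h)) (at z)"
    unfolding has_field_derivative_def .
  then have d: "((\<lambda>z. K i l ((x - poly p z) / of_real \<rho>)) has_derivative
      (\<lambda>h. K (Suc i) l ((x - poly p z) / of_real \<rho>) * Re (- poly (pderiv p) z / of_real \<rho> * h)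
        + K i (Suc l) ((x - poly p z) / of_real \<rho>) * Im (- poly (pderiv p) z / of_real \<rho> * h))) (at z)"
    by (rule has_derivative_compose) (rule K_has_derivative[OF assms(1,2)])
  have e: "Re (- poly (pderiv p) z / of_real \<rho> * h) = - Re (poly (pderiv p) z * h) / \<rho>"
    "Im (- poly (pderiv p) z / of_real \<rho> * h) = - Im (poly (pderiv p) z * h) / \<rho>" for h
    using Re_divide_of_real[of "- poly (pderiv p) z * h" \<rho>] Im_divide_of_real[of "- poly (pderiv p) z * h" \<rho>]
    by (simp_all add: times_divide_eq_left)
  show ?thesis
  proof (rule has_derivative_eq_rhs[OF d])
    have alg: "a * (- b / c) + a' * (- b' / c) = - (a * b + a' * b') / c" for a b c a' b' :: real
      by (simp add: add_divide_distrib diff_divide_distrib)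
    show "(\<lambda>h. K (Suc i) l ((x - poly p z) / of_real \<rho>) * Re (- poly (pderiv p) z / of_real \<rho> * h)
        + K i (Suc l) ((x - poly p z) / of_real \<rho>) * Im (- poly (pderiv p) z / of_real \<rho> * h))
      = (\<lambda>h. - (K (Suc i) l ((x - poly p z) / of_real \<rho>) * Re (poly (pderiv p) z * h)
        + K i (Suc l) ((x - poly p z) / of_real \<rho>) * Im (poly (pderiv p) z * h)) / \<rho>)"
      by (simp only: e alg)
  qed
qed

lemma averaged_kernel_has_derivative:
  assumes "i < 3" "l < 3" "0 < \<rho>" and A: "\<And>p. (A p has_derivative A' p) (at z)"
  shows "((\<lambda>z. averaged_kernel i l A \<rho> n z x) has_derivative
    (\<lambda>h. (\<Sum>p\<in>sign_polys n. K i l ((x - poly p z) / of_real \<rho>) * A' p h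
      + - (K (Suc i) l ((x - poly p z) / of_real \<rho>) * Re (poly (pderiv p) z * h)
        + K i (Suc l) ((x - poly p z) / of_real \<rho>) * Im (poly (pderiv p) z * h)) / \<rho> * A p z) / 2 ^ n)) (at z)"
  unfolding averaged_kernel_def divide_inverse[of _ "2 ^ n"]
  by (intro has_derivative_mult_left has_derivative_sum has_derivative_mult K_arg_has_derivative assms)

text \<open>Polynomials are holomorphic, so the derivative in direction \<open>h\<close> involves
  \<open>p' h\<close>. For \<open>h = 1\<close> its parts are \<open>Re1\<close> and
  \<open>Im1\<close>; for \<open>h = \<i>\<close> they are \<open>- Im1\<close> and
  \<open>Re1\<close>, which explains the exchange of kernels and the sign in the second formula. The
  sum with \<open>A'\<close> collects what comes from the amplitude.\<close>

lemma averaged_kernel_has_partials: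
  assumes "i < 3" "l < 3" "0 < \<rho>" and A: "\<And>p. (A p has_derivative A' p) (at (Complex a b))"
  shows "((\<lambda>a. averaged_kernel i l A \<rho> n (Complex a b) x) has_real_derivative
      (\<Sum>p\<in>sign_polys n. K i l ((x - poly p (Complex a b)) / of_real \<rho>) * A' p 1) / 2 ^ n
      - (averaged_kernel (Suc i) l (\<lambda>p z. Re1 p z * A p z) \<rho> n (Complex a b) x
       + averaged_kernel i (Suc l) (\<lambda>p z. Im1 p z * A p z) \<rho> n (Complex a b) x) / \<rho>) (at a)"
    and "((\<lambda>b. averaged_kernel i l A \<rho> n (Complex a b) x) has_real_derivative
      (\<Sum>p\<in>sign_polys n. K i l ((x - poly p (Complex a b)) / of_real \<rho>) * A' p \<i>) / 2 ^ n
      - (averaged_kernel i (Suc l) (\<lambda>p z. Re1 p z * A p z) \<rho> n (Complex a b) x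
       - averaged_kernel (Suc i) l (\<lambda>p z. Im1 p z * A p z) \<rho> n (Complex a b) x) / \<rho>) (at b)"
proof -
  let ?z = "Complex a b"
  define D where "D h = (\<Sum>p\<in>sign_polys n. K i l ((x - poly p ?z) / of_real \<rho>) * A' p h
      + - (K (Suc i) l ((x - poly p ?z) / of_real \<rho>) * Re (poly (pderiv p) ?z * h)
        + K i (Suc l) ((x - poly p ?z) / of_real \<rho>) * Im (poly (pderiv p) ?z * h)) / \<rho> * A p ?z) / 2 ^ n" for h
  have d: "((\<lambda>z. averaged_kernel i l A \<rho> n z x) has_derivative D) (at ?z)"
    unfolding D_def[abs_def] by (rule averaged_kernel_has_derivative[OF assms])
  interpret D: bounded_linear D by (rule has_derivative_bounded_linear[OF d])
  have "((\<lambda>a. Complex a b) has_derivative (\<lambda>t. t *\<^sub>R 1)) (at a)"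
    unfolding Complex_eq scaleR_conv_of_real by (auto intro!: derivative_eq_intros)
  from has_derivative_compose[OF this d] have 1: "((\<lambda>a. averaged_kernel i l A \<rho> n (Complex a b) x)
      has_real_derivative D 1) (at a)"
    by (simp only: has_field_derivative_def D.scaleR real_scaleR_def mult_commute_abs)
  have "((\<lambda>b. Complex a b) has_derivative (\<lambda>t. t *\<^sub>R \<i>)) (at b)"
    unfolding Complex_eq scaleR_conv_of_real by (auto intro!: derivative_eq_intros simp: mult.commute)
  from has_derivative_compose[OF this d] have 2: "((\<lambda>b. averaged_kernel i l A \<rho> n (Complex a b) x)
      has_real_derivative D \<i>) (at b)"
    by (simp only: has_field_derivative_def D.scaleR real_scaleR_def mult_commute_abs)
  define k where "k i l p = K i l ((x - poly p ?z) / of_real \<rho>)" for i l p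
  have "D 1 = (\<Sum>p\<in>sign_polys n. k i l p * A' p 1 - (k (Suc i) l p * (Re1 p ?z * A p ?z) + k i (Suc l) p * (Im1 p ?z * A p ?z)) / \<rho>) / 2 ^ n"
    unfolding D_def k_def Re1_def Im1_def using assms(3)
    by (intro arg_cong2[where f = "(/)"] sum.cong refl) (simp add: field_simps)
  then have e1: "D 1 = (\<Sum>p\<in>sign_polys n. K i l ((x - poly p ?z) / of_real \<rho>) * A' p 1) / 2 ^ n
      - (averaged_kernel (Suc i) l (\<lambda>p z. Re1 p z * A p z) \<rho> n ?z x
       + averaged_kernel i (Suc l) (\<lambda>p z. Im1 p z * A p z) \<rho> n ?z x) / \<rho>"
    unfolding sum_quotients_split by (simp only: averaged_kernel_def k_def)
  have "D \<i> = (\<Sum>p\<in>sign_polys n. k i l p * A' p \<i> - (k i (Suc l) p * (Re1 p ?z * A p ?z) + - (k (Suc i) l p * (Im1 p ?z * A p ?z))) / \<rho>) / 2 ^ n"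
    unfolding D_def k_def Re1_def Im1_def using assms(3)
    by (intro arg_cong2[where f = "(/)"] sum.cong refl) (simp add: field_simps)
  then have e2: "D \<i> = (\<Sum>p\<in>sign_polys n. K i l ((x - poly p ?z) / of_real \<rho>) * A' p \<i>) / 2 ^ n
      - (averaged_kernel i (Suc l) (\<lambda>p z. Re1 p z * A p z) \<rho> n ?z x
       - averaged_kernel (Suc i) l (\<lambda>p z. Im1 p z * A p z) \<rho> n ?z x) / \<rho>"
    unfolding sum_quotients_split by (simp add: averaged_kernel_def k_def sum_negf)
  show "((\<lambda>a. averaged_kernel i l A \<rho> n (Complex a b) x) has_real_derivative
      (\<Sum>p\<in>sign_polys n. K i l ((x - poly p ?z) / of_real \<rho>) * A' p 1) / 2 ^ n
      - (averaged_kernel (Suc i) l (\<lambda>p z. Re1 p z * A p z) \<rho> n ?z x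
       + averaged_kernel i (Suc l) (\<lambda>p z. Im1 p z * A p z) \<rho> n ?z x) / \<rho>) (at a)"
    using 1 unfolding e1 .
  show "((\<lambda>b. averaged_kernel i l A \<rho> n (Complex a b) x) has_real_derivative
      (\<Sum>p\<in>sign_polys n. K i l ((x - poly p ?z) / of_real \<rho>) * A' p \<i>) / 2 ^ n
      - (averaged_kernel i (Suc l) (\<lambda>p z. Re1 p z * A p z) \<rho> n ?z x
       - averaged_kernel (Suc i) l (\<lambda>p z. Im1 p z * A p z) \<rho> n ?z x) / \<rho>) (at b)"
    using 2 unfolding e2 .
qed

text \<open>The kernels that occur in the four functions of the Sobolev inequality, without signs
  and powers of \<rho>. Entry 0 is the function itself, 1 and 2 belong to its real partial
  derivative, 3 and 4 to the imaginary one, and 5 to 10 to the mixed one: 5 to 8 differentiate the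
  kernel twice, 9 and 10 differentiate the factor \<open>p'\<close>.\<close>

definition derivative_terms :: "nat \<Rightarrow> nat \<Rightarrow> (nat \<times> nat \<times> (complex poly \<Rightarrow> complex \<Rightarrow> real)) list" where
  "derivative_terms i l = [(i, l, \<lambda>_ _. 1), (Suc i, l, Re1), (i, Suc l, Im1), (Suc i, l, Im1), (i, Suc l, Re1),
    (Suc (Suc i), l, \<lambda>p z. Im1 p z * Re1 p z), (Suc i, Suc l, \<lambda>p z. Re1 p z * Re1 p z),
    (Suc i, Suc l, \<lambda>p z. Im1 p z * Im1 p z), (i, Suc (Suc l), \<lambda>p z. Re1 p z * Im1 p z),
    (Suc i, l, Im2), (i, Suc l, Re2)]"

definition term_kernel where
  "term_kernel \<rho> n z x t = averaged_kernel (fst t) (fst (snd t)) (snd (snd t)) \<rho> n z x"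

lemma square_sum6_le:
  "(a + b + c + d + e + f)\<^sup>2 \<le> 6 * (a\<^sup>2 + b\<^sup>2 + c\<^sup>2 + d\<^sup>2 + e\<^sup>2 + f\<^sup>2)" for a b c d e f :: real
proof -
  have "0 \<le> (a - b)\<^sup>2 + (a - c)\<^sup>2 + (a - d)\<^sup>2 + (a - e)\<^sup>2 + (a - f)\<^sup>2 + (b - c)\<^sup>2 + (b - d)\<^sup>2 + (b - e)\<^sup>2
    + (b - f)\<^sup>2 + (c - d)\<^sup>2 + (c - e)\<^sup>2 + (c - f)\<^sup>2 + (d - e)\<^sup>2 + (d - f)\<^sup>2 + (e - f)\<^sup>2"
    by (intro add_nonneg_nonneg zero_le_power2)
  then show ?thesis by (simp add: power2_eq_square algebra_simps)
qed

lemma averaged_kernel_continuous: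
  assumes "i \<le> 3" "l \<le> 3" "0 < \<rho>" and A: "\<And>p. continuous_on UNIV (A p)"
  shows "continuous_on UNIV (\<lambda>z. averaged_kernel i l A \<rho> n z x)"
    and "continuous_on UNIV (\<lambda>x. averaged_kernel i l A \<rho> n z x)"
    and "(\<lambda>(x, z). averaged_kernel i l A \<rho> n z x) \<in> borel_measurable (lborel \<Otimes>\<^sub>M lborel)"
proof -
  note K = continuous_on_compose2[OF K_continuous[OF assms(1,2)], of UNIV]
  have 1: "continuous_on UNIV (\<lambda>z. K i l ((x - poly p z) / of_real \<rho>))"
    and 2: "continuous_on UNIV (\<lambda>x. K i l ((x - poly p z) / of_real \<rho>))"
    and 3: "continuous_on UNIV (\<lambda>w. K i l ((fst w - poly p (snd w)) / of_real \<rho>))" for p x z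
    using assms(3) by (intro K continuous_intros; simp)+
  show "continuous_on UNIV (\<lambda>z. averaged_kernel i l A \<rho> n z x)"
    unfolding averaged_kernel_def by (intro continuous_intros 1 A) auto
  show "continuous_on UNIV (\<lambda>x. averaged_kernel i l A \<rho> n z x)"
    unfolding averaged_kernel_def by (intro continuous_intros 2) auto
  have A2: "continuous_on UNIV (\<lambda>w :: complex \<times> complex. A p (snd w))" for p
    by (rule continuous_on_compose2[OF A]) (auto intro: continuous_intros)
  have "continuous_on UNIV (\<lambda>w. averaged_kernel i l A \<rho> n (snd w) (fst w))"
    unfolding averaged_kernel_def by (intro continuous_intros 3 A2) auto
  then show "(\<lambda>(x, z). averaged_kernel i l A \<rho> n z x) \<in> borel_measurable (lborel \<Otimes>\<^sub>M lborel)"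
    unfolding lborel_prod measurable_lborel2 case_prod_unfold by (rule borel_measurable_continuous_onI)
qed

lemma derivative_amplitudes_continuous:
  "continuous_on UNIV (Re1 p)" "continuous_on UNIV (Im1 p)" "continuous_on UNIV (Re2 p)" "continuous_on UNIV (Im2 p)"
  unfolding Re1_def[abs_def] Im1_def[abs_def] Re2_def[abs_def] Im2_def[abs_def] by (intro continuous_intros)+

lemma derivative_terms_props:
  assumes "i + l = 1" "t \<in> set (derivative_terms i l)"
  shows "1 \<le> fst t + fst (snd t)" "fst t + fst (snd t) \<le> 3" "\<exists>b. amplitude b (snd (snd t))"
    "continuous_on UNIV (snd (snd t) p)"
proof -
  show "1 \<le> fst t + fst (snd t)" "fst t + fst (snd t) \<le> 3"
    using assms unfolding derivative_terms_def by auto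
  note d = amplitude_derivatives
  have "\<exists>b. amplitude b (\<lambda>_ _. 1)" "\<exists>b. amplitude b Re1" "\<exists>b. amplitude b Im1" "\<exists>b. amplitude b Re2" "\<exists>b. amplitude b Im2"
    "\<exists>b. amplitude b (\<lambda>p z. Im1 p z * Re1 p z)" "\<exists>b. amplitude b (\<lambda>p z. Re1 p z * Re1 p z)"
    "\<exists>b. amplitude b (\<lambda>p z. Im1 p z * Im1 p z)" "\<exists>b. amplitude b (\<lambda>p z. Re1 p z * Im1 p z)"
    by (rule exI, rule amplitude_1 d amplitude_mult[OF d(2,1)] amplitude_mult[OF d(1,1)]
        amplitude_mult[OF d(2,2)] amplitude_mult[OF d(1,2)])+
  then show "\<exists>b. amplitude b (snd (snd t))"
    using assms(2) unfolding derivative_terms_def by auto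
  show "continuous_on UNIV (snd (snd t) p)"
    using assms(2) unfolding derivative_terms_def
    by (auto intro!: derivative_amplitudes_continuous continuous_intros)
qed

text \<open>The side of the square equals the scale of the kernel. Each derivative costs
  \<open>1 / \<rho>\<close>, and the weights of the Sobolev inequality compensate exactly this, so
  every term enters with \<open>\<rho>^-2\<close>. The two terms from differentiated amplitudes are
  smaller by a factor \<rho>, which \<open>\<rho> \<le> 1\<close> discards.\<close>

lemma averaged_kernel_sobolev:
  assumes il: "i + l = 1" and \<rho>: "0 < \<rho>" "\<rho> \<le> 1" and \<zeta>: "\<zeta> \<in> grid_square \<rho> g"
  shows "ennreal ((averaged_kernel i l (\<lambda>_ _. 1) \<rho> n \<zeta> x)\<^sup>2)
    \<le> (\<integral>\<^sup>+z. ennreal (6 / \<rho>\<^sup>2 * (\<Sum>k<11. (term_kernel \<rho> n z x (derivative_terms i l ! k))\<^sup>2))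
        * indicator (grid_square \<rho> g) z \<partial>lborel)"
proof -
  have ils: "i < 3" "l < 3" "Suc i < 3" "Suc l < 3" using il by auto
  let ?V = "\<lambda>i l A z. averaged_kernel i l A \<rho> n z x"
  define u where "u = ?V i l (\<lambda>_ _. 1)"
  define ua where "ua z = - ((?V (Suc i) l Re1 z + ?V i (Suc l) Im1 z) / \<rho>)" for z
  define ub where "ub z = - ((?V i (Suc l) Re1 z - ?V (Suc i) l Im1 z) / \<rho>)" for z
  define va where "va z = - ?V (Suc i) l Im2 z - (?V (Suc i) (Suc l) (\<lambda>p z. Re1 p z * Re1 p z) z
      - ?V (Suc (Suc i)) l (\<lambda>p z. Im1 p z * Re1 p z) z) / \<rho>" for z
  define vb where "vb z = ?V i (Suc l) Re2 z - (?V i (Suc (Suc l)) (\<lambda>p z. Re1 p z * Im1 p z) z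
      - ?V (Suc i) (Suc l) (\<lambda>p z. Im1 p z * Im1 p z) z) / \<rho>" for z
  define uab where "uab z = - ((va z + vb z) / \<rho>)" for z
  have dd: "(poly q has_derivative (\<lambda>h. poly (pderiv q) z * h)) (at z)" for q :: "complex poly" and z
    using poly_DERIV[of q z] by (simp add: has_field_derivative_def)
  have dRe: "(Re1 p has_derivative (\<lambda>h. Re (poly (pderiv (pderiv p)) z * h))) (at z)"
    and dIm: "(Im1 p has_derivative (\<lambda>h. Im (poly (pderiv (pderiv p)) z * h))) (at z)" for p z
    unfolding Re1_def[abs_def] Im1_def[abs_def]
    by (rule bounded_linear.has_derivative[OF bounded_linear_Re dd] bounded_linear.has_derivative[OF bounded_linear_Im dd])+
  have da: "((\<lambda>a. u (Complex a b)) has_real_derivative ua (Complex a b)) (at a)"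
    and db: "((\<lambda>b. u (Complex a b)) has_real_derivative ub (Complex a b)) (at b)" for a b
    using averaged_kernel_has_partials[OF ils(1,2) \<rho>(1), of "\<lambda>_ _. 1" "\<lambda>_ _. 0" a b n x]
    by (simp_all add: u_def ua_def ub_def)
  have dva: "((\<lambda>b. ?V (Suc i) l Re1 (Complex a b)) has_real_derivative va (Complex a b)) (at b)" for a b
    using averaged_kernel_has_partials(2)[where A = Re1 and a = a and b = b and n = n and x = x, OF ils(3,2) \<rho>(1) dRe]
    by (simp add: va_def averaged_kernel_def[where A = Im2] Im2_def sum_negf)
  have dvb: "((\<lambda>b. ?V i (Suc l) Im1 (Complex a b)) has_real_derivative vb (Complex a b)) (at b)" for a b
    using averaged_kernel_has_partials(2)[where A = Im1 and a = a and b = b and n = n and x = x, OF ils(1,4) \<rho>(1) dIm]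
    by (simp add: vb_def averaged_kernel_def[where A = Re2] Re2_def)
  have dab: "((\<lambda>b. ua (Complex a b)) has_real_derivative uab (Complex a b)) (at b)" for a b
    unfolding ua_def uab_def by (intro DERIV_minus DERIV_cdivide DERIV_add dva dvb)
  have c: "continuous_on UNIV (?V i' l' A)" if "i' \<le> 3" "l' \<le> 3" "\<And>p. continuous_on UNIV (A p)" for i' l' A
    using averaged_kernel_continuous(1)[OF that(1,2) \<rho>(1) that(3)] .
  note dc = derivative_amplitudes_continuous
  have cont: "continuous_on UNIV u" "continuous_on UNIV ua" "continuous_on UNIV ub" "continuous_on UNIV uab"
    unfolding u_def ua_def[abs_def] ub_def[abs_def] uab_def[abs_def] va_def vb_def
    by (intro c continuous_intros dc; use il \<rho> in simp)+
  have "ennreal ((u \<zeta>)\<^sup>2) \<le> (\<integral>\<^sup>+z. ennreal (4 / \<rho>\<^sup>2 * (u z)\<^sup>2 + 2 * (ub z)\<^sup>2 + 2 * (ua z)\<^sup>2 + \<rho>\<^sup>2 * (uab z)\<^sup>2)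
      * indicator (grid_square \<rho> g) z \<partial>lborel)"
    by (rule sobolev_square[OF da db dab cont \<rho>(1) \<zeta>])
  also have "\<dots> \<le> (\<integral>\<^sup>+z. ennreal (6 / \<rho>\<^sup>2 * (\<Sum>k<11. (term_kernel \<rho> n z x (derivative_terms i l ! k))\<^sup>2))
        * indicator (grid_square \<rho> g) z \<partial>lborel)"
  proof (intro nn_integral_mono mult_right_mono ennreal_leI)
    fix z
    define t where "t k = term_kernel \<rho> n z x (derivative_terms i l ! k)" for k
    have eqs: "u z = t 0" "ua z = - ((t 1 + t 2) / \<rho>)" "ub z = - ((t 4 - t 3) / \<rho>)"
      "va z = - t 9 - (t 6 - t 5) / \<rho>" "vb z = t 10 - (t 8 - t 7) / \<rho>"
      unfolding u_def ua_def ub_def va_def vb_def t_def term_kernel_def derivative_terms_def by simp_all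
    have "(ua z)\<^sup>2 = (t 1 + t 2)\<^sup>2 / \<rho>\<^sup>2" "(ub z)\<^sup>2 = (t 4 - t 3)\<^sup>2 / \<rho>\<^sup>2"
      unfolding eqs by (simp_all only: power_divide power2_minus)
    moreover have "(t 1 + t 2)\<^sup>2 \<le> 2 * ((t 1)\<^sup>2 + (t 2)\<^sup>2)" "(t 4 - t 3)\<^sup>2 \<le> 2 * ((t 4)\<^sup>2 + (t 3)\<^sup>2)"
      using zero_le_power2[of "t 1 - t 2"] zero_le_power2[of "t 4 + t 3"] by (simp_all add: power2_eq_square algebra_simps)
    ultimately have 1: "(ua z)\<^sup>2 \<le> 2 * ((t 1)\<^sup>2 + (t 2)\<^sup>2) / \<rho>\<^sup>2" "(ub z)\<^sup>2 \<le> 2 * ((t 4)\<^sup>2 + (t 3)\<^sup>2) / \<rho>\<^sup>2"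
      by (simp_all add: divide_right_mono)
    have "\<rho> * uab z = (t 9 * \<rho> + - (t 10 * \<rho>) + t 6 + - t 5 + t 8 + - t 7) / \<rho>"
      unfolding uab_def eqs using \<rho> by (simp add: field_simps)
    then have "\<rho>\<^sup>2 * (uab z)\<^sup>2 = (t 9 * \<rho> + - (t 10 * \<rho>) + t 6 + - t 5 + t 8 + - t 7)\<^sup>2 / \<rho>\<^sup>2"
      by (simp only: power_divide flip: power_mult_distrib)
    also have "\<dots> \<le> 6 * ((t 9 * \<rho>)\<^sup>2 + (- (t 10 * \<rho>))\<^sup>2 + (t 6)\<^sup>2 + (- t 5)\<^sup>2 + (t 8)\<^sup>2 + (- t 7)\<^sup>2) / \<rho>\<^sup>2"
      by (intro divide_right_mono square_sum6_le) simp
    also have "\<dots> \<le> 6 * ((t 9)\<^sup>2 + (t 10)\<^sup>2 + (t 6)\<^sup>2 + (t 5)\<^sup>2 + (t 8)\<^sup>2 + (t 7)\<^sup>2) / \<rho>\<^sup>2"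
    proof (intro divide_right_mono mult_left_mono add_mono)
      have "\<rho>\<^sup>2 \<le> 1" using \<rho> by (simp add: power_le_one)
      then show "(t 9 * \<rho>)\<^sup>2 \<le> (t 9)\<^sup>2" "(- (t 10 * \<rho>))\<^sup>2 \<le> (t 10)\<^sup>2"
        by (simp_all add: power_mult_distrib mult_left_le)
    qed auto
    finally have 2: "\<rho>\<^sup>2 * (uab z)\<^sup>2 \<le> 6 * ((t 9)\<^sup>2 + (t 10)\<^sup>2 + (t 6)\<^sup>2 + (t 5)\<^sup>2 + (t 8)\<^sup>2 + (t 7)\<^sup>2) / \<rho>\<^sup>2" .
    have "4 / \<rho>\<^sup>2 * (u z)\<^sup>2 + 2 * (ub z)\<^sup>2 + 2 * (ua z)\<^sup>2 + \<rho>\<^sup>2 * (uab z)\<^sup>2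
        \<le> 6 / \<rho>\<^sup>2 * (t 0)\<^sup>2 + 2 * (2 * ((t 4)\<^sup>2 + (t 3)\<^sup>2) / \<rho>\<^sup>2) + 2 * (2 * ((t 1)\<^sup>2 + (t 2)\<^sup>2) / \<rho>\<^sup>2)
          + 6 * ((t 9)\<^sup>2 + (t 10)\<^sup>2 + (t 6)\<^sup>2 + (t 5)\<^sup>2 + (t 8)\<^sup>2 + (t 7)\<^sup>2) / \<rho>\<^sup>2"
      using 1 2 unfolding eqs(1) by (intro add_mono mult_left_mono mult_right_mono divide_right_mono) auto
    also have "\<dots> = (6 * (t 0)\<^sup>2 + 4 * ((t 4)\<^sup>2 + (t 3)\<^sup>2) + 4 * ((t 1)\<^sup>2 + (t 2)\<^sup>2)
          + 6 * ((t 9)\<^sup>2 + (t 10)\<^sup>2 + (t 6)\<^sup>2 + (t 5)\<^sup>2 + (t 8)\<^sup>2 + (t 7)\<^sup>2)) / \<rho>\<^sup>2"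
      by (simp add: add_divide_distrib)
    also have "\<dots> \<le> (6 * (\<Sum>k<11. (t k)\<^sup>2)) / \<rho>\<^sup>2"
    proof (rule divide_right_mono)
      have sum: "(\<Sum>k<11. (t k)\<^sup>2) = (t 0)\<^sup>2 + (t 1)\<^sup>2 + (t 2)\<^sup>2 + (t 3)\<^sup>2 + (t 4)\<^sup>2 + (t 5)\<^sup>2 + (t 6)\<^sup>2
          + (t 7)\<^sup>2 + (t 8)\<^sup>2 + (t 9)\<^sup>2 + (t 10)\<^sup>2"
        by (simp add: eval_nat_numeral)
      have alg: "6 * (x0 + x1 + x2 + x3 + x4 + x5 + x6 + x7 + x8 + x9 + x10)
        = (6 * x0 + 4 * (x4 + x3) + 4 * (x1 + x2) + 6 * (x9 + x10 + x6 + x5 + x8 + x7))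
          + 2 * (x1 + x2 + x3 + x4)" for x0 x1 x2 x3 x4 x5 x6 x7 x8 x9 x10 :: real
        by (simp add: algebra_simps)
      show "6 * (t 0)\<^sup>2 + 4 * ((t 4)\<^sup>2 + (t 3)\<^sup>2) + 4 * ((t 1)\<^sup>2 + (t 2)\<^sup>2)
          + 6 * ((t 9)\<^sup>2 + (t 10)\<^sup>2 + (t 6)\<^sup>2 + (t 5)\<^sup>2 + (t 8)\<^sup>2 + (t 7)\<^sup>2) \<le> 6 * (\<Sum>k<11. (t k)\<^sup>2)"
        unfolding sum alg by (rule order.trans[OF eq_refl[OF add_0_right[symmetric]] add_left_mono]) simp
    qed simp
    finally show "4 / \<rho>\<^sup>2 * (u z)\<^sup>2 + 2 * (ub z)\<^sup>2 + 2 * (ua z)\<^sup>2 + \<rho>\<^sup>2 * (uab z)\<^sup>2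
        \<le> 6 / \<rho>\<^sup>2 * (\<Sum>k<11. (term_kernel \<rho> n z x (derivative_terms i l ! k))\<^sup>2)"
      by (simp add: t_def)
  qed simp
  finally show ?thesis by (simp add: u_def)
qed

end

section \<open>Summing one sample per grid square\<close>

context oscillation
begin

text \<open>Disjointness of the squares merges the local integrals into one, and the factor
  \<open>\<rho>^-2\<close> of the Sobolev step cancels the \<open>\<rho>^2\<close> of the mean
  square. A sample within \<open>\<eta> / 4\<close> of the centre and
  \<open>8 * \<rho> \<le> \<eta>\<close> keep the whole square within \<open>\<eta> / 2\<close>,
  where the cutoff is at least 1/2; this is the 2 that turns 6 into 12.\<close>

lemma grid_sum_le:
  assumes \<beta>: "0 \<le> \<beta>" "\<beta> \<le> 3" "1 < 2 * r powr \<beta>" and il: "i + l = 1"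
  obtains C where "0 \<le> C" "\<And>n \<rho> G \<zeta>. 0 < \<rho> \<Longrightarrow> \<rho> \<le> 1 \<Longrightarrow> 8 * \<rho> \<le> \<eta> \<Longrightarrow> finite G \<Longrightarrow>
    (\<And>g. g \<in> G \<Longrightarrow> \<zeta> g \<in> grid_square \<rho> g \<and> cmod (\<zeta> g - z0) \<le> \<eta> / 4) \<Longrightarrow>
    (\<integral>\<^sup>+x. (\<Sum>g\<in>G. ennreal ((averaged_kernel i l (\<lambda>_ _. 1) \<rho> n (\<zeta> g) x)\<^sup>2)) \<partial>lborel)
      \<le> ennreal (C * (\<rho> powr \<beta> + 1 / 2 ^ n))"
proof -
  let ?t = "\<lambda>k. derivative_terms i l ! k"
  have mem: "?t k \<in> set (derivative_terms i l)" if "k < 11" for k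
    using that by (intro nth_mem) (simp add: derivative_terms_def)
  note tp = derivative_terms_props[OF il mem]
  define P where "P k C \<longleftrightarrow> (k < 11 \<longrightarrow> 0 \<le> C \<and> (\<forall>n \<rho>. 0 < \<rho> \<longrightarrow> \<rho> \<le> 1 \<longrightarrow>
    (\<integral>\<^sup>+x. \<integral>\<^sup>+z. ennreal (cutoff z * (term_kernel \<rho> n z x (?t k))\<^sup>2) \<partial>lborel \<partial>lborel)
      \<le> ennreal (C * \<rho>\<^sup>2 * (\<rho> powr \<beta> + 1 / 2 ^ n))))" for k :: nat and C
  have "\<exists>C. P k C" for k
  proof (cases "k < 11")
    case True
    obtain b where b: "amplitude b (snd (snd (?t k)))" using tp(3)[OF True] by blast
    obtain C where C: "0 \<le> C" "\<And>n \<rho>. 0 < \<rho> \<Longrightarrow> \<rho> \<le> 1 \<Longrightarrow>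
      (\<integral>\<^sup>+x. \<integral>\<^sup>+z. ennreal (cutoff z * (term_kernel \<rho> n z x (?t k))\<^sup>2) \<partial>lborel \<partial>lborel)
      \<le> ennreal (C * \<rho>\<^sup>2 * (\<rho> powr \<beta> + 1 / 2 ^ n))"
      unfolding term_kernel_def
      by (rule mean_square_averaged_kernel[OF \<beta> tp(1,2)[OF True] b]) blast
    then show ?thesis unfolding P_def by (intro exI[of _ C]) auto
  qed (simp add: P_def)
  then obtain C where "\<And>k. P k (C k)" by metis
  then have C: "\<And>k. k < 11 \<Longrightarrow> 0 \<le> C k" "\<And>k n \<rho>. k < 11 \<Longrightarrow> 0 < \<rho> \<Longrightarrow> \<rho> \<le> 1 \<Longrightarrow>
    (\<integral>\<^sup>+x. \<integral>\<^sup>+z. ennreal (cutoff z * (term_kernel \<rho> n z x (?t k))\<^sup>2) \<partial>lborel \<partial>lborel)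
      \<le> ennreal (C k * \<rho>\<^sup>2 * (\<rho> powr \<beta> + 1 / 2 ^ n))"
    unfolding P_def by blast+
  show ?thesis
  proof
    show "0 \<le> 12 * (\<Sum>k<11. C k)" by (intro mult_nonneg_nonneg sum_nonneg) (use C(1) in auto)
    fix n :: nat and \<rho> :: real and G :: "(int \<times> int) set" and \<zeta>
    assume \<rho>: "0 < \<rho>" "\<rho> \<le> 1" "8 * \<rho> \<le> \<eta>" and G: "finite G"
      and \<zeta>: "\<And>g. g \<in> G \<Longrightarrow> \<zeta> g \<in> grid_square \<rho> g \<and> cmod (\<zeta> g - z0) \<le> \<eta> / 4"
    define T where "T k z x = term_kernel \<rho> n z x (?t k)" for k z x
    have Tc: "continuous_on UNIV (\<lambda>z. T k z x)" "(\<lambda>(x, z). T k z x) \<in> borel_measurable (lborel \<Otimes>\<^sub>M lborel)"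
      if k: "k < 11" for k x
      unfolding T_def term_kernel_def
      using tp(2)[OF k] tp(4)[OF k] \<rho>(1) by (auto intro!: averaged_kernel_continuous)
    have sqm: "grid_square \<rho> g \<in> sets borel" for g
    proof -
      have "grid_square \<rho> g = {z \<in> space borel. Re z \<in> {\<rho> * fst g..<\<rho> * fst g + \<rho>}}
          \<inter> {z \<in> space borel. Im z \<in> {\<rho> * snd g..<\<rho> * snd g + \<rho>}}"
        by (auto simp: grid_square_def)
      also have "\<dots> \<in> sets borel" by measurable
      finally show ?thesis .
    qed
    have disj: "(\<Sum>g\<in>G. indicator (grid_square \<rho> g) z) \<le> ennreal (2 * cutoff z)" for z
    proof (cases "\<exists>g\<in>G. z \<in> grid_square \<rho> g")
      case True
      then obtain g where g: "g \<in> G" "z \<in> grid_square \<rho> g" by blast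
      have uniq: "g' = g" if "z \<in> grid_square \<rho> g'" for g'
      proof -
        have fl: "m = \<lfloor>t / \<rho>\<rfloor>" if "t \<in> {\<rho> * real_of_int m..<\<rho> * real_of_int m + \<rho>}" for t m
        proof -
          have "real_of_int m \<le> t / \<rho>" "t / \<rho> < real_of_int m + 1"
            using that \<rho>(1) by (auto simp: field_simps)
          then show ?thesis by linarith
        qed
        have "fst g' = \<lfloor>Re z / \<rho>\<rfloor>" "snd g' = \<lfloor>Im z / \<rho>\<rfloor>" "fst g = \<lfloor>Re z / \<rho>\<rfloor>" "snd g = \<lfloor>Im z / \<rho>\<rfloor>"
          using g(2) that unfolding grid_square_def by (auto intro!: fl)
        then show ?thesis by (simp add: prod_eq_iff)
      qed
      have "(\<Sum>g\<in>G. indicator (grid_square \<rho> g) z) = (\<Sum>g'\<in>G. if g' = g then 1 else 0 :: ennreal)"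
      proof (rule sum.cong[OF refl])
        fix g'
        show "indicator (grid_square \<rho> g') z = (if g' = g then 1 else 0 :: ennreal)"
        proof (cases "g' = g")
          case False
          then have "z \<notin> grid_square \<rho> g'" using uniq by blast
          then show ?thesis using False by simp
        qed (use g(2) in simp)
      qed
      also have "\<dots> = ennreal 1" using g G by simp
      also have "\<dots> \<le> ennreal (2 * cutoff z)"
      proof (rule ennreal_leI)
        have "\<bar>Re z - Re (\<zeta> g)\<bar> \<le> \<rho>" "\<bar>Im z - Im (\<zeta> g)\<bar> \<le> \<rho>"
          using \<zeta>[OF g(1)] g(2) unfolding grid_square_def by auto
        then have "cmod (z - \<zeta> g) \<le> 2 * \<rho>" using cmod_le[of "z - \<zeta> g"] by simp
        moreover have "cmod (z - z0) \<le> cmod (z - \<zeta> g) + cmod (\<zeta> g - z0)"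
          using norm_triangle_ineq[of "z - \<zeta> g" "\<zeta> g - z0"] by simp
        ultimately have "cmod (z - z0) \<le> \<eta> / 2" using \<zeta>[OF g(1)] \<rho>(3) by linarith
        then show "1 \<le> 2 * cutoff z" using cutoff_ge_half[of z] by simp
      qed
      finally show ?thesis .
    next
      case False
      then have "(\<Sum>g\<in>G. indicator (grid_square \<rho> g) z) = (0 :: ennreal)"
        by (intro sum.neutral) auto
      then show ?thesis by simp
    qed
    define E where "E z x = (\<Sum>k<11. (T k z x)\<^sup>2)" for z x
    have E0: "0 \<le> E z x" for z x by (simp add: E_def sum_nonneg)
    have cutm: "cutoff \<in> borel_measurable borel" by (intro borel_measurable_continuous_onI cutoff_continuous)
    have Em: "(\<lambda>z. E z x) \<in> borel_measurable borel" for x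
      unfolding E_def by (intro borel_measurable_sum borel_measurable_power borel_measurable_continuous_onI Tc) auto
    have "(\<Sum>g\<in>G. ennreal ((averaged_kernel i l (\<lambda>_ _. 1) \<rho> n (\<zeta> g) x)\<^sup>2))
        \<le> (\<Sum>k<11. \<integral>\<^sup>+z. ennreal (12 / \<rho>\<^sup>2) * ennreal (cutoff z * (T k z x)\<^sup>2) \<partial>lborel)" for x
    proof -
      have "(\<Sum>g\<in>G. ennreal ((averaged_kernel i l (\<lambda>_ _. 1) \<rho> n (\<zeta> g) x)\<^sup>2))
          \<le> (\<Sum>g\<in>G. \<integral>\<^sup>+z. ennreal (6 / \<rho>\<^sup>2 * E z x) * indicator (grid_square \<rho> g) z \<partial>lborel)"
        unfolding E_def T_def
        by (intro sum_mono averaged_kernel_sobolev il \<rho>) (use \<zeta> in blast)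
      also have "\<dots> = (\<integral>\<^sup>+z. (\<Sum>g\<in>G. ennreal (6 / \<rho>\<^sup>2 * E z x) * indicator (grid_square \<rho> g) z) \<partial>lborel)"
        by (rule nn_integral_sum[symmetric])
           (use Em sqm in \<open>auto intro!: borel_measurable_times_ennreal borel_measurable_indicator\<close>)
      also have "\<dots> \<le> (\<integral>\<^sup>+z. (\<Sum>k<11. ennreal (12 / \<rho>\<^sup>2) * ennreal (cutoff z * (T k z x)\<^sup>2)) \<partial>lborel)"
      proof (rule nn_integral_mono)
        fix z
        have "(\<Sum>g\<in>G. ennreal (6 / \<rho>\<^sup>2 * E z x) * indicator (grid_square \<rho> g) z)
            = ennreal (6 / \<rho>\<^sup>2 * E z x) * (\<Sum>g\<in>G. indicator (grid_square \<rho> g) z)"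
          by (simp add: sum_distrib_left)
        also have "\<dots> \<le> ennreal (6 / \<rho>\<^sup>2 * E z x) * ennreal (2 * cutoff z)"
          using disj by (intro mult_left_mono) auto
        also have "\<dots> = ennreal (6 / \<rho>\<^sup>2 * E z x * (2 * cutoff z))"
          using E0[of z x] cutoff_range(1)[of z] by (intro ennreal_mult[symmetric]) auto
        also have "6 / \<rho>\<^sup>2 * E z x * (2 * cutoff z) = (\<Sum>k<11. 12 / \<rho>\<^sup>2 * (cutoff z * (T k z x)\<^sup>2))"
          by (simp add: E_def sum_distrib_left sum_distrib_right mult_ac)
        also have "ennreal (\<Sum>k<11. 12 / \<rho>\<^sup>2 * (cutoff z * (T k z x)\<^sup>2)) = (\<Sum>k<11. ennreal (12 / \<rho>\<^sup>2 * (cutoff z * (T k z x)\<^sup>2)))"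
          using cutoff_range(1)[of z] by (intro sum_ennreal[symmetric]) auto
        also have "\<dots> = (\<Sum>k<11. ennreal (12 / \<rho>\<^sup>2) * ennreal (cutoff z * (T k z x)\<^sup>2))"
          using cutoff_range(1)[of z] by (intro sum.cong refl ennreal_mult) auto
        finally show "(\<Sum>g\<in>G. ennreal (6 / \<rho>\<^sup>2 * E z x) * indicator (grid_square \<rho> g) z)
            \<le> (\<Sum>k<11. ennreal (12 / \<rho>\<^sup>2) * ennreal (cutoff z * (T k z x)\<^sup>2))" .
      qed
      also have "\<dots> = (\<Sum>k<11. \<integral>\<^sup>+z. ennreal (12 / \<rho>\<^sup>2) * ennreal (cutoff z * (T k z x)\<^sup>2) \<partial>lborel)"
      proof (rule nn_integral_sum)
        fix k :: nat assume "k \<in> {..<11}"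
        then have "(\<lambda>z. T k z x) \<in> borel_measurable borel"
          by (intro borel_measurable_continuous_onI Tc) auto
        then show "(\<lambda>z. ennreal (12 / \<rho>\<^sup>2) * ennreal (cutoff z * (T k z x)\<^sup>2)) \<in> borel_measurable lborel"
          using cutm by simp
      qed
      finally show ?thesis .
    qed
    then have "(\<integral>\<^sup>+x. (\<Sum>g\<in>G. ennreal ((averaged_kernel i l (\<lambda>_ _. 1) \<rho> n (\<zeta> g) x)\<^sup>2)) \<partial>lborel)
        \<le> (\<integral>\<^sup>+x. (\<Sum>k<11. \<integral>\<^sup>+z. ennreal (12 / \<rho>\<^sup>2) * ennreal (cutoff z * (T k z x)\<^sup>2) \<partial>lborel) \<partial>lborel)"
      by (rule nn_integral_mono)
    also have "\<dots> = (\<Sum>k<11. ennreal (12 / \<rho>\<^sup>2) * (\<integral>\<^sup>+x. \<integral>\<^sup>+z. ennreal (cutoff z * (T k z x)\<^sup>2) \<partial>lborel \<partial>lborel))"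
    proof -
      have m: "(\<lambda>(x, z). ennreal (cutoff z * (T k z x)\<^sup>2)) \<in> borel_measurable (lborel \<Otimes>\<^sub>M lborel)" if "k < 11" for k
      proof -
        have "(\<lambda>w. cutoff (snd w)) \<in> borel_measurable (lborel \<Otimes>\<^sub>M lborel)"
          by (rule measurable_compose[OF measurable_snd]) (use cutm in simp)
        moreover have "(\<lambda>w. T k (snd w) (fst w)) \<in> borel_measurable (lborel \<Otimes>\<^sub>M lborel)"
          using Tc(2)[OF that] by (simp add: case_prod_unfold)
        ultimately have "(\<lambda>w. cutoff (snd w) * (T k (snd w) (fst w))\<^sup>2) \<in> borel_measurable (lborel \<Otimes>\<^sub>M lborel)"
          by (intro borel_measurable_times borel_measurable_power)
        then show ?thesis unfolding case_prod_unfold by (rule measurable_compose) simp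
      qed
      note m2 = lborel.borel_measurable_nn_integral[OF m]
      have mz: "(\<lambda>z. ennreal (cutoff z * (T k z x)\<^sup>2)) \<in> borel_measurable lborel" if "k < 11" for k x
        using borel_measurable_continuous_onI[OF Tc(1)[OF that]] cutm by simp
      have inner: "(\<integral>\<^sup>+z. ennreal (12 / \<rho>\<^sup>2) * ennreal (cutoff z * (T k z x)\<^sup>2) \<partial>lborel)
          = ennreal (12 / \<rho>\<^sup>2) * (\<integral>\<^sup>+z. ennreal (cutoff z * (T k z x)\<^sup>2) \<partial>lborel)" if "k < 11" for k x
        by (rule nn_integral_cmult[OF mz[OF that]])
      have "(\<integral>\<^sup>+x. (\<Sum>k<11. \<integral>\<^sup>+z. ennreal (12 / \<rho>\<^sup>2) * ennreal (cutoff z * (T k z x)\<^sup>2) \<partial>lborel) \<partial>lborel)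
        = (\<integral>\<^sup>+x. (\<Sum>k<11. ennreal (12 / \<rho>\<^sup>2) * (\<integral>\<^sup>+z. ennreal (cutoff z * (T k z x)\<^sup>2) \<partial>lborel)) \<partial>lborel)"
        by (intro nn_integral_cong sum.cong refl inner) simp
      also have "\<dots> = (\<Sum>k<11. \<integral>\<^sup>+x. ennreal (12 / \<rho>\<^sup>2) * (\<integral>\<^sup>+z. ennreal (cutoff z * (T k z x)\<^sup>2) \<partial>lborel) \<partial>lborel)"
        by (rule nn_integral_sum) (use m2 in simp)
      also have "\<dots> = (\<Sum>k<11. ennreal (12 / \<rho>\<^sup>2) * (\<integral>\<^sup>+x. \<integral>\<^sup>+z. ennreal (cutoff z * (T k z x)\<^sup>2) \<partial>lborel \<partial>lborel))"
        by (rule sum.cong[OF refl]) (use m2 in \<open>simp add: nn_integral_cmult\<close>)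
      finally show ?thesis .
    qed
    also have "(\<Sum>k<11. ennreal (12 / \<rho>\<^sup>2) * (\<integral>\<^sup>+x. \<integral>\<^sup>+z. ennreal (cutoff z * (T k z x)\<^sup>2) \<partial>lborel \<partial>lborel))
        \<le> (\<Sum>k<11. ennreal (12 / \<rho>\<^sup>2) * ennreal (C k * \<rho>\<^sup>2 * (\<rho> powr \<beta> + 1 / 2 ^ n)))"
      unfolding T_def by (intro sum_mono mult_left_mono C(2) \<rho>) auto
    also have "\<dots> = (\<Sum>k<11. ennreal (12 * (C k * (\<rho> powr \<beta> + 1 / 2 ^ n))))"
      using \<rho>(1) C(1) by (intro sum.cong refl) (simp flip: ennreal_mult')
    also have "\<dots> = ennreal (\<Sum>k<11. 12 * (C k * (\<rho> powr \<beta> + 1 / 2 ^ n)))"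
      using C(1) by (intro sum_ennreal) auto
    also have "(\<Sum>k<11. 12 * (C k * (\<rho> powr \<beta> + 1 / 2 ^ n))) = 12 * (\<Sum>k<11. C k) * (\<rho> powr \<beta> + 1 / 2 ^ n)"
      by (simp only: sum_distrib_left sum_distrib_right mult.assoc)
    finally show "(\<integral>\<^sup>+x. (\<Sum>g\<in>G. ennreal ((averaged_kernel i l (\<lambda>_ _. 1) \<rho> n (\<zeta> g) x)\<^sup>2)) \<partial>lborel)
      \<le> ennreal (12 * (\<Sum>k<11. C k) * (\<rho> powr \<beta> + 1 / 2 ^ n))" .
  qed
qed

definition smoothed :: "nat \<Rightarrow> nat \<Rightarrow> real \<Rightarrow> complex \<Rightarrow> complex \<Rightarrow> real" where
  "smoothed i l \<rho> z x = (\<integral>y. K i l ((x - y) / of_real \<rho>) \<partial>nu z)"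

lemma averaged_kernel_tendsto:
  assumes "i \<le> 3" "l \<le> 3" "0 < \<rho>" "cmod z < 1"
  shows "(\<lambda>n. averaged_kernel i l (\<lambda>_ _. 1) \<rho> n z x) \<longlonglongrightarrow> smoothed i l \<rho> z x"
proof -
  obtain B where B: "\<And>w. \<bar>K i l w\<bar> \<le> B" using K_bounded assms by blast
  have c: "continuous_on UNIV (\<lambda>y. K i l ((x - y) / of_real \<rho>))"
    using assms by (intro continuous_on_compose2[OF K_continuous[OF assms(1,2)], of UNIV] continuous_intros) auto
  from nu_integral_limit[OF c B assms(4)] show ?thesis
    by (simp add: averaged_kernel_def smoothed_def)
qed

text \<open>Fatou's lemma for growing truncation length \<open>n\<close>. The diagonal contribution
  \<open>1 / 2 ^ n\<close>, carried along separately so far, disappears in the limit.\<close>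

lemma smoothed_grid_sum_le:
  assumes \<beta>: "0 \<le> \<beta>" "\<beta> \<le> 3" "1 < 2 * r powr \<beta>" and il: "i + l = 1"
  obtains C where "0 \<le> C" "\<And>\<rho> G \<zeta>. 0 < \<rho> \<Longrightarrow> \<rho> \<le> 1 \<Longrightarrow> 8 * \<rho> \<le> \<eta> \<Longrightarrow> finite G \<Longrightarrow>
    (\<And>g. g \<in> G \<Longrightarrow> \<zeta> g \<in> grid_square \<rho> g \<and> cmod (\<zeta> g - z0) \<le> \<eta> / 4) \<Longrightarrow>
    (\<Sum>g\<in>G. \<integral>\<^sup>+x. ennreal ((smoothed i l \<rho> (\<zeta> g) x)\<^sup>2) \<partial>lborel) \<le> ennreal (C * \<rho> powr \<beta>)"
proof -
  obtain C where C: "0 \<le> C" "\<And>n \<rho> G \<zeta>. 0 < \<rho> \<Longrightarrow> \<rho> \<le> 1 \<Longrightarrow> 8 * \<rho> \<le> \<eta> \<Longrightarrow> finite G \<Longrightarrow>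
    (\<And>g. g \<in> G \<Longrightarrow> \<zeta> g \<in> grid_square \<rho> g \<and> cmod (\<zeta> g - z0) \<le> \<eta> / 4) \<Longrightarrow>
    (\<integral>\<^sup>+x. (\<Sum>g\<in>G. ennreal ((averaged_kernel i l (\<lambda>_ _. 1) \<rho> n (\<zeta> g) x)\<^sup>2)) \<partial>lborel)
      \<le> ennreal (C * (\<rho> powr \<beta> + 1 / 2 ^ n))"
    by (rule grid_sum_le[OF assms]) blast
  show ?thesis
  proof (rule that[OF C(1)])
    fix \<rho> :: real and G :: "(int \<times> int) set" and \<zeta>
    assume \<rho>: "0 < \<rho>" "\<rho> \<le> 1" "8 * \<rho> \<le> \<eta>" and G: "finite G"
      and \<zeta>: "\<And>g. g \<in> G \<Longrightarrow> \<zeta> g \<in> grid_square \<rho> g \<and> cmod (\<zeta> g - z0) \<le> \<eta> / 4"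
    define f where "f n x = (\<Sum>g\<in>G. ennreal ((averaged_kernel i l (\<lambda>_ _. 1) \<rho> n (\<zeta> g) x)\<^sup>2))" for n x
    have il3: "i \<le> 3" "l \<le> 3" using il by auto
    have am: "(\<lambda>x. averaged_kernel i l (\<lambda>_ _. 1) \<rho> n (\<zeta> g) x) \<in> borel_measurable lborel" for n g
      using averaged_kernel_continuous(2)[OF il3 \<rho>(1), of "\<lambda>_ _. 1" n "\<zeta> g"]
      by (simp add: borel_measurable_continuous_onI)
    have fm: "f n \<in> borel_measurable lborel" for n
      unfolding f_def using am by (intro borel_measurable_sum) simp
    have lim: "(\<lambda>n. averaged_kernel i l (\<lambda>_ _. 1) \<rho> n (\<zeta> g) x) \<longlonglongrightarrow> smoothed i l \<rho> (\<zeta> g) x" if "g \<in> G" for g x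
    proof (rule averaged_kernel_tendsto[OF il3 \<rho>(1)])
      have "\<zeta> g \<in> ball z0 (2 * \<eta>)" using \<zeta>[OF that] pos by (simp add: dist_norm norm_minus_commute)
      then show "cmod (\<zeta> g) < 1" by (rule lt_1)
    qed
    have sm: "smoothed i l \<rho> (\<zeta> g) \<in> borel_measurable lborel" if "g \<in> G" for g
      by (rule borel_measurable_LIMSEQ_metric[OF am lim[OF that]])
    have "(\<Sum>g\<in>G. \<integral>\<^sup>+x. ennreal ((smoothed i l \<rho> (\<zeta> g) x)\<^sup>2) \<partial>lborel)
        = (\<integral>\<^sup>+x. (\<Sum>g\<in>G. ennreal ((smoothed i l \<rho> (\<zeta> g) x)\<^sup>2)) \<partial>lborel)"
      using sm by (intro nn_integral_sum[symmetric]) simp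
    also have "\<dots> = (\<integral>\<^sup>+x. liminf (\<lambda>n. f n x) \<partial>lborel)"
    proof (rule nn_integral_cong)
      fix x
      have "(\<lambda>n. f n x) \<longlonglongrightarrow> (\<Sum>g\<in>G. ennreal ((smoothed i l \<rho> (\<zeta> g) x)\<^sup>2))"
        unfolding f_def by (intro tendsto_sum tendsto_ennrealI tendsto_power lim)
      then show "(\<Sum>g\<in>G. ennreal ((smoothed i l \<rho> (\<zeta> g) x)\<^sup>2)) = liminf (\<lambda>n. f n x)"
        by (simp add: lim_imp_Liminf)
    qed
    also have "\<dots> \<le> liminf (\<lambda>n. \<integral>\<^sup>+x. f n x \<partial>lborel)"
      by (rule nn_integral_liminf[OF fm])
    also have "\<dots> \<le> liminf (\<lambda>n. ennreal (C * (\<rho> powr \<beta> + 1 / 2 ^ n)))"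
      unfolding f_def by (intro Liminf_mono always_eventually allI C(2) \<rho> G \<zeta>)
    also have "\<dots> = ennreal (C * (\<rho> powr \<beta> + 0))"
    proof (rule lim_imp_Liminf)
      have "(\<lambda>n. 1 / 2 ^ n :: real) \<longlonglongrightarrow> 0"
        using LIMSEQ_power_zero[of "1/2 :: real"] by (simp add: power_one_over)
      then show "(\<lambda>n. ennreal (C * (\<rho> powr \<beta> + 1 / 2 ^ n))) \<longlonglongrightarrow> ennreal (C * (\<rho> powr \<beta> + 0))"
        by (intro tendsto_ennrealI tendsto_intros)
    qed simp
    finally show "(\<Sum>g\<in>G. \<integral>\<^sup>+x. ennreal ((smoothed i l \<rho> (\<zeta> g) x)\<^sup>2) \<partial>lborel) \<le> ennreal (C * \<rho> powr \<beta>)"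
      by simp
  qed
qed

end

section \<open>The exceptional set\<close>

definition mollified :: "nat \<Rightarrow> complex \<Rightarrow> complex \<Rightarrow> real" where
  "mollified j z x = (\<integral>y. 4 ^ j * mollifier (2 ^ j * (x - y)) \<partial>nu z)"

definition increment_energy :: "nat \<Rightarrow> complex \<Rightarrow> ennreal" where
  "increment_energy j z = (\<integral>\<^sup>+x. ennreal ((mollified (Suc j) z x - mollified j z x)\<^sup>2) \<partial>lborel)"

text \<open>Decay is known only from some level on, so the sequence of mollifications starts at
  \<open>J\<close>; its first member is still bounded, by \<open>4 ^ J * B\<close>. The lower bound
  on open sets comes from exchanging the integrals and applying Fatou's lemma over
  \<open>nu z\<close>.\<close>

lemma has_L2_density_nu_if_increments_decay:
  assumes z: "cmod z < 1" and q: "0 < q" "q < 1"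
    and decay: "\<And>j. J \<le> j \<Longrightarrow> increment_energy j z \<le> ennreal (q ^ j)"
  shows "has_L2_density (nu z)"
proof -
  interpret N: prob_space "nu z" by (rule prob_space_nu)
  interpret P: pair_sigma_finite lborel "nu z" ..
  obtain B where B: "\<And>w. mollifier w \<le> B" using mollifier_bounded by blast
  let ?k = "\<lambda>j x y. 4 ^ j * mollifier (2 ^ j * (x - y)) :: real"
  have k0: "0 \<le> ?k j x y" for j x y by (simp add: mollifier_nonneg)
  have kc: "continuous_on UNIV (\<lambda>w. ?k j (fst w) (snd w))" for j
    by (intro continuous_intros continuous_on_compose2[OF mollifier_continuous]) auto
  have km: "(\<lambda>w. ?k j (fst w) (snd w)) \<in> borel_measurable (lborel \<Otimes>\<^sub>M nu z)" for j
  proof -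
    have "sets (lborel \<Otimes>\<^sub>M nu z) = sets (borel \<Otimes>\<^sub>M borel)"
      by (rule sets_pair_measure_cong) simp_all
    also have "\<dots> = sets (borel :: (complex \<times> complex) measure)" by (simp only: borel_prod)
    finally have "borel_measurable (lborel \<Otimes>\<^sub>M nu z) = borel_measurable (borel :: (complex \<times> complex) measure)"
      by (rule measurable_cong_sets) (rule refl)
    then show ?thesis using borel_measurable_continuous_onI[OF kc] by blast
  qed
  have kmy: "?k j x \<in> borel_measurable (nu z)" and kmx: "(\<lambda>x. ?k j x y) \<in> borel_measurable borel" for j x y
  proof -
    have "continuous_on UNIV (?k j x)" "continuous_on UNIV (\<lambda>x. ?k j x y)"
      by (intro continuous_intros continuous_on_compose2[OF mollifier_continuous]; simp)+
    then show "?k j x \<in> borel_measurable (nu z)" "(\<lambda>x. ?k j x y) \<in> borel_measurable borel"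
      using borel_measurable_continuous_onI by (auto simp: measurable_cong_sets[OF sets_nu refl])
  qed
  have ki: "integrable (nu z) (?k j x)" for j x
    by (rule N.integrable_const_bound[where B = "4 ^ j * B"])
       (use B mollifier_nonneg kmy in \<open>auto simp: mult_left_mono\<close>)
  have en: "ennreal (mollified j z x) = (\<integral>\<^sup>+y. ennreal (?k j x y) \<partial>nu z)" for j x
    unfolding mollified_def by (rule nn_integral_eq_integral[OF ki, symmetric]) (use k0 in simp)
  have one: "(\<integral>\<^sup>+x. ennreal (?k j x y) \<partial>lborel) = 1" for j y
  proof -
    have c: "1 / 2 ^ j \<noteq> (0::real)" by simp
    have e: "2 ^ j * (y + (1 / 2 ^ j) *\<^sub>R w - y) = w" for w :: complex
      by (simp add: scaleR_conv_of_real)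
    have "(\<integral>\<^sup>+x. ennreal (?k j x y) \<partial>lborel)
        = ennreal ((1 / 2 ^ j)\<^sup>2) * (\<integral>\<^sup>+w. ennreal (4 ^ j) * ennreal (mollifier w) \<partial>lborel)"
    proof -
      have "(\<lambda>x. ennreal (?k j x y)) \<in> borel_measurable borel" using kmx[of j y] by simp
      from nn_integral_lborel_affine[OF this c, of y]
      have "(\<integral>\<^sup>+x. ennreal (?k j x y) \<partial>lborel) = ennreal (\<bar>1 / 2 ^ j\<bar> ^ DIM(complex))
          * (\<integral>\<^sup>+w. ennreal (4 ^ j * mollifier w) \<partial>lborel)" by (simp only: e)
      also have "(\<integral>\<^sup>+w. ennreal (4 ^ j * mollifier w) \<partial>lborel) = (\<integral>\<^sup>+w. ennreal (4 ^ j) * ennreal (mollifier w) \<partial>lborel)"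
        by (intro nn_integral_cong ennreal_mult) (simp_all add: mollifier_nonneg)
      also have "\<bar>1 / 2 ^ j\<bar> ^ DIM(complex) = (1 / 2 ^ j :: real)\<^sup>2" by (simp only: DIM_complex power2_abs)
      finally show ?thesis .
    qed
    also have "(\<integral>\<^sup>+w. ennreal (4 ^ j) * ennreal (mollifier w) \<partial>lborel) = ennreal (4 ^ j) * 1"
      using borel_measurable_continuous_onI[OF mollifier_continuous]
      by (subst nn_integral_cmult) (simp_all add: nn_integral_mollifier)
    also have "ennreal ((1 / 2 ^ j)\<^sup>2) * (ennreal (4 ^ j) * 1) = ennreal ((1 / 2 ^ j)\<^sup>2 * 4 ^ j)"
      by (simp add: ennreal_mult del: ennreal_power)
    also have "(1 / 2 ^ j)\<^sup>2 * 4 ^ j = (1 :: real)"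
      by (simp add: power_divide power2_eq_square flip: power_mult_distrib)
    finally show ?thesis by simp
  qed
  have swap: "(\<integral>\<^sup>+x. ennreal (mollified j z x) * indicator U x \<partial>lborel)
      = (\<integral>\<^sup>+y. \<integral>\<^sup>+x. ennreal (?k j x y) * indicator U x \<partial>lborel \<partial>nu z)"
    and swap_m: "(\<lambda>y. \<integral>\<^sup>+x. ennreal (?k j x y) * indicator U x \<partial>lborel) \<in> borel_measurable (nu z)"
    if U: "U \<in> sets borel" for U j
  proof -
    have m: "(\<lambda>(x, y). ennreal (?k j x y) * indicator U x) \<in> borel_measurable (lborel \<Otimes>\<^sub>M nu z)"
    proof -
      have "(\<lambda>w. ennreal (?k j (fst w) (snd w))) \<in> borel_measurable (lborel \<Otimes>\<^sub>M nu z)"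
        using km by simp
      moreover have "(\<lambda>w. indicator U (fst w)) \<in> borel_measurable (lborel \<Otimes>\<^sub>M nu z)"
        by (rule measurable_compose[OF measurable_fst]) (use U in simp)
      ultimately show ?thesis
        unfolding case_prod_unfold by (rule borel_measurable_times_ennreal)
    qed
    have "(\<integral>\<^sup>+x. ennreal (mollified j z x) * indicator U x \<partial>lborel)
        = (\<integral>\<^sup>+x. \<integral>\<^sup>+y. ennreal (?k j x y) * indicator U x \<partial>nu z \<partial>lborel)"
      unfolding en using kmy by (intro nn_integral_cong nn_integral_multc[symmetric]) simp
    also have "\<dots> = (\<integral>\<^sup>+y. \<integral>\<^sup>+x. ennreal (?k j x y) * indicator U x \<partial>lborel \<partial>nu z)"
      using P.Fubini'[OF m] by simp
    finally show "(\<integral>\<^sup>+x. ennreal (mollified j z x) * indicator U x \<partial>lborel)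
      = (\<integral>\<^sup>+y. \<integral>\<^sup>+x. ennreal (?k j x y) * indicator U x \<partial>lborel \<partial>nu z)" .
    show "(\<lambda>y. \<integral>\<^sup>+x. ennreal (?k j x y) * indicator U x \<partial>lborel) \<in> borel_measurable (nu z)"
      using lborel.borel_measurable_nn_integral[OF measurable_pair_swap[OF m]] by simp
  qed
  show ?thesis
  proof (rule has_L2_density_if_increments_decay[where f = "\<lambda>j. mollified (j + J) z" and q = q and C = "q ^ J"
      and L = "1 / (1 - cmod z) + 2" and B = "4 ^ J * B"])
    show "prob_space (nu z)" by (rule prob_space_nu)
    show "mollified (j + J) z \<in> borel_measurable borel" for j
    proof -
      have "(\<lambda>(x, y). ?k (j + J) x y) \<in> borel_measurable (lborel \<Otimes>\<^sub>M nu z)"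
        using km[of "j + J"] by (simp add: case_prod_unfold)
      from N.borel_measurable_lebesgue_integral[OF this] show ?thesis by (simp add: mollified_def[abs_def])
    qed
    show "0 \<le> mollified (j + J) z x" for j x
      unfolding mollified_def by (intro integral_nonneg_AE) (use k0 in simp)
    show "mollified (j + J) z x = 0" if x: "1 / (1 - cmod z) + 2 < cmod x" for j x
    proof -
      have "AE y in nu z. ?k (j + J) x y = 0"
        using AE_nu_bounded[OF z]
      proof (rule eventually_mono)
        fix y assume y: "cmod y \<le> 1 / (1 - cmod z)"
        have "2 < cmod (x - y)" using x y norm_triangle_ineq2[of x y] by linarith
        also have "\<dots> \<le> 2 ^ (j + J) * cmod (x - y)" by (simp add: mult_left_le one_le_power mult_le_cancel_right1)
        finally show "?k (j + J) x y = 0" using mollifier_eq_0[of "2 ^ (j + J) * (x - y)"] by (simp add: norm_mult norm_power)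
      qed
      then show ?thesis unfolding mollified_def by (rule integral_eq_zero_AE)
    qed
    show "mollified (0 + J) z x \<le> 4 ^ J * B" for x
    proof -
      have "(\<integral>y. ?k J x y \<partial>nu z) \<le> (\<integral>y. 4 ^ J * B \<partial>nu z)"
        by (rule integral_mono[OF ki]) (use B in \<open>auto simp: mult_left_mono\<close>)
      then show ?thesis by (simp add: mollified_def N.prob_space)
    qed
    show "(\<integral>\<^sup>+x. ennreal (mollified (j + J) z x) \<partial>lborel) \<le> 1" for j
      using swap[of UNIV "j + J"] one[of "j + J"] N.emeasure_space_1 by simp
    show "emeasure (nu z) U \<le> liminf (\<lambda>j. \<integral>\<^sup>+x. ennreal (mollified (j + J) z x) * indicator U x \<partial>lborel)"
      if U: "open U" for U
    proof -
      have Ub: "U \<in> sets borel" using U by simp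
      let ?g = "\<lambda>j y. \<integral>\<^sup>+x. ennreal (?k (j + J) x y) * indicator U x \<partial>lborel"
      have "emeasure (nu z) U = (\<integral>\<^sup>+y. indicator U y \<partial>nu z)" using Ub by simp
      also have "\<dots> \<le> (\<integral>\<^sup>+y. liminf (\<lambda>j. ?g j y) \<partial>nu z)"
      proof (rule nn_integral_mono)
        fix y
        show "indicator U y \<le> liminf (\<lambda>j. ?g j y)"
        proof (cases "y \<in> U")
          case True
          then obtain e where e: "0 < e" "ball y e \<subseteq> U" using U open_contains_ball by blast
          \<comment> \<open>The kernel centred at \<open>y\<close> lives within radius
            \<open>2 * (1/2) ^ j\<close>, hence eventually inside \<open>U\<close>, and then its
            full mass 1 counts.\<close>
          have "(\<lambda>j. 2 * (1/2::real) ^ j) \<longlonglongrightarrow> 2 * 0"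
            by (intro tendsto_intros LIMSEQ_power_zero) auto
          then have "\<forall>\<^sub>F j in sequentially. 2 * (1/2) ^ j < e" using e by (intro order_tendstoD) auto
          then have "\<forall>\<^sub>F j in sequentially. 1 \<le> ?g j y"
          proof (rule eventually_mono)
            fix j assume j: "2 * (1/2) ^ j < e"
            have "(\<integral>\<^sup>+x. ennreal (?k (j + J) x y) \<partial>lborel) = ?g j y"
            proof (rule nn_integral_cong)
              fix x
              show "ennreal (?k (j + J) x y) = ennreal (?k (j + J) x y) * indicator U x"
              proof (cases "x \<in> U")
                case False
                then have "e \<le> cmod (x - y)" using e(2) by (auto simp: dist_norm norm_minus_commute not_less subset_eq)
                then have "2 * (1/2) ^ j < cmod (x - y)" using j by linarith
                then have "2 < 2 ^ j * cmod (x - y)" by (simp add: power_one_over field_simps)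
                also have "\<dots> \<le> 2 ^ (j + J) * cmod (x - y)" by (intro mult_right_mono power_increasing) auto
                finally have "mollifier (2 ^ (j + J) * (x - y)) = 0"
                  by (intro mollifier_eq_0) (simp add: norm_mult norm_power)
                then show ?thesis by simp
              qed simp
            qed
            then show "1 \<le> ?g j y" using one[of "j + J" y] by simp
          qed
          then show ?thesis using True by (simp add: Liminf_bounded)
        qed simp
      qed
      also have "\<dots> \<le> liminf (\<lambda>j. \<integral>\<^sup>+y. ?g j y \<partial>nu z)"
        by (rule nn_integral_liminf) (rule swap_m[OF Ub])
      finally show ?thesis by (simp only: swap[OF Ub])
    qed
    show "(\<integral>\<^sup>+x. ennreal ((mollified (Suc j + J) z x - mollified (j + J) z x)\<^sup>2) \<partial>lborel) \<le> ennreal (q ^ J * q ^ j)" for j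
      using decay[of "j + J"] by (simp add: increment_energy_def power_add mult.commute)
  qed (use q in auto)
qed

section \<open>Elementary geometry of the grid\<close>

lemma finite_grid_indices:
  assumes "0 < h" "\<And>g. g \<in> G \<Longrightarrow> \<exists>z\<in>grid_square h g. cmod z \<le> R"
  shows "finite G"
proof (rule finite_subset)
  show "G \<subseteq> {-\<lceil>R / h + 1\<rceil>..\<lceil>R / h + 1\<rceil>} \<times> {-\<lceil>R / h + 1\<rceil>..\<lceil>R / h + 1\<rceil>}"
  proof
    fix g assume "g \<in> G"
    then obtain z where z: "z \<in> grid_square h g" "cmod z \<le> R" using assms(2) by blast
    have b: "m \<in> {-\<lceil>R / h + 1\<rceil>..\<lceil>R / h + 1\<rceil>}" if "t \<in> {h * real_of_int m..<h * real_of_int m + h}" "\<bar>t\<bar> \<le> R" for t m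
    proof -
      have "h * real_of_int m \<le> R" "- R \<le> h * real_of_int m + h" using that by auto
      then have "real_of_int m \<le> R / h" "- (R / h) - 1 \<le> real_of_int m"
        using assms(1) by (auto simp: field_simps)
      then show ?thesis by (simp only: atLeastAtMost_iff) linarith
    qed
    have "\<bar>Re z\<bar> \<le> R" "\<bar>Im z\<bar> \<le> R" using z(2) abs_Re_le_cmod[of z] abs_Im_le_cmod[of z] by linarith+
    then have "fst g \<in> {-\<lceil>R / h + 1\<rceil>..\<lceil>R / h + 1\<rceil>}" "snd g \<in> {-\<lceil>R / h + 1\<rceil>..\<lceil>R / h + 1\<rceil>}"
      using z(1) b unfolding grid_square_def by blast+
    then show "g \<in> {-\<lceil>R / h + 1\<rceil>..\<lceil>R / h + 1\<rceil>} \<times> {-\<lceil>R / h + 1\<rceil>..\<lceil>R / h + 1\<rceil>}"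
      by (cases g) auto
  qed
qed simp

lemma grid_square_diameter:
  assumes "0 < h"
  shows "bounded (grid_square h g) \<and> diameter (grid_square h g) \<le> 4 * h"
proof -
  have sub: "grid_square h g \<subseteq> cball (Complex (h * fst g) (h * snd g)) (2 * h)"
  proof
    fix z assume "z \<in> grid_square h g"
    then have "\<bar>Re (z - Complex (h * fst g) (h * snd g))\<bar> \<le> h" "\<bar>Im (z - Complex (h * fst g) (h * snd g))\<bar> \<le> h"
      unfolding grid_square_def by auto
    then have "cmod (z - Complex (h * fst g) (h * snd g)) \<le> 2 * h"
      using cmod_le[of "z - Complex (h * fst g) (h * snd g)"] by linarith
    then show "z \<in> cball (Complex (h * fst g) (h * snd g)) (2 * h)"
      by (simp add: dist_norm norm_minus_commute)
  qed
  have "diameter (grid_square h g) \<le> diameter (cball (Complex (h * fst g) (h * snd g)) (2 * h))"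
    by (rule diameter_subset[OF sub]) simp
  then show ?thesis using assms bounded_subset[OF bounded_cball sub] by (simp add: diameter_cball)
qed

lemma grid_square_floor: "0 < h \<Longrightarrow> z \<in> grid_square h (\<lfloor>Re z / h\<rfloor>, \<lfloor>Im z / h\<rfloor>)"
proof -
  assume h: "0 < h"
  have "t \<in> {h * real_of_int \<lfloor>t / h\<rfloor>..<h * real_of_int \<lfloor>t / h\<rfloor> + h}" for t
  proof -
    have "real_of_int \<lfloor>t / h\<rfloor> \<le> t / h" "t / h < real_of_int \<lfloor>t / h\<rfloor> + 1" by linarith+
    then have "real_of_int \<lfloor>t / h\<rfloor> * h \<le> t" "t < (real_of_int \<lfloor>t / h\<rfloor> + 1) * h"
      using h by (simp_all only: pos_le_divide_eq pos_divide_less_eq)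
    then show ?thesis by (simp add: distrib_left mult.commute)
  qed
  then show ?thesis unfolding grid_square_def by simp
qed

section \<open>Counting the squares of large energy\<close>

context transversal_disc
begin

text \<open>The origin of the exponent: normalizing a kernel of scale \<open>2^-j\<close> in the
  plane costs \<open>4 ^ j\<close>, hence \<open>16 ^ j\<close> in the energy, and the sum over
  samples gains \<open>2 powr (- \<beta> * j)\<close>. The increment splits into the horizontal and
  the vertical kernel, each of order one.\<close>

lemma increment_energy_sum_le:
  assumes \<beta>: "0 \<le> \<beta>" "\<beta> \<le> 3" "1 < 2 * r powr \<beta>"
  obtains C where "0 \<le> C" "\<And>j G \<zeta>. 8 * (1/2) ^ j \<le> \<eta> \<Longrightarrow> finite G \<Longrightarrow>
    (\<And>g. g \<in> G \<Longrightarrow> \<zeta> g \<in> grid_square ((1/2) ^ j) g \<and> cmod (\<zeta> g - z0) \<le> \<eta> / 4) \<Longrightarrow>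
    (\<Sum>g\<in>G. increment_energy j (\<zeta> g)) \<le> ennreal (C * (2 powr (4 - \<beta>)) ^ j)"
proof -
  interpret H: oscillation scale_step bump z0 \<eta> r \<delta> M
    by (rule oscillation.intro[OF horizontal.smooth_kernel_axioms transversal_disc_axioms])
  interpret V: oscillation dilated_bump scale_step z0 \<eta> r \<delta> M
    by (rule oscillation.intro[OF vertical.smooth_kernel_axioms transversal_disc_axioms])
  obtain CH where CH: "0 \<le> CH" "\<And>\<rho> G \<zeta>. 0 < \<rho> \<Longrightarrow> \<rho> \<le> 1 \<Longrightarrow> 8 * \<rho> \<le> \<eta> \<Longrightarrow> finite G \<Longrightarrow>
    (\<And>g. g \<in> G \<Longrightarrow> \<zeta> g \<in> grid_square \<rho> g \<and> cmod (\<zeta> g - z0) \<le> \<eta> / 4) \<Longrightarrow>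
    (\<Sum>g\<in>G. \<integral>\<^sup>+x. ennreal ((H.smoothed 1 0 \<rho> (\<zeta> g) x)\<^sup>2) \<partial>lborel) \<le> ennreal (CH * \<rho> powr \<beta>)"
    by (rule H.smoothed_grid_sum_le[OF \<beta>, of 1 0]) auto
  obtain CV where CV: "0 \<le> CV" "\<And>\<rho> G \<zeta>. 0 < \<rho> \<Longrightarrow> \<rho> \<le> 1 \<Longrightarrow> 8 * \<rho> \<le> \<eta> \<Longrightarrow> finite G \<Longrightarrow>
    (\<And>g. g \<in> G \<Longrightarrow> \<zeta> g \<in> grid_square \<rho> g \<and> cmod (\<zeta> g - z0) \<le> \<eta> / 4) \<Longrightarrow>
    (\<Sum>g\<in>G. \<integral>\<^sup>+x. ennreal ((V.smoothed 0 1 \<rho> (\<zeta> g) x)\<^sup>2) \<partial>lborel) \<le> ennreal (CV * \<rho> powr \<beta>)"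
    by (rule V.smoothed_grid_sum_le[OF \<beta>, of 0 1]) auto
  have inc: "mollified (Suc j) z x - mollified j z x
      = 4 ^ j * (H.smoothed 1 0 ((1/2) ^ j) z x + V.smoothed 0 1 ((1/2) ^ j) z x)" for j z x
  proof -
    interpret N: prob_space "nu z" by (rule prob_space_nu)
    have arg: "2 ^ j * (x - y) = (x - y) / of_real ((1/2) ^ j)" for y
      by (simp add: power_one_over)
    obtain B where B: "\<And>w. mollifier w \<le> B" using mollifier_bounded by blast
    have mi: "integrable (nu z) (\<lambda>y. 4 ^ m * mollifier (2 ^ m * (x - y)))" for m
    proof (rule N.integrable_const_bound[where B = "4 ^ m * B"])
      have "continuous_on UNIV (\<lambda>y. 4 ^ m * mollifier (2 ^ m * (x - y)))"
        by (intro continuous_intros continuous_on_compose2[OF mollifier_continuous]) auto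
      then show "(\<lambda>y. 4 ^ m * mollifier (2 ^ m * (x - y))) \<in> borel_measurable (nu z)"
        using borel_measurable_continuous_onI by (auto simp: measurable_cong_sets[OF sets_nu refl])
    qed (use B mollifier_nonneg in \<open>auto simp: mult_left_mono\<close>)
    have Ki: "integrable (nu z) (\<lambda>y. horizontal.K 1 0 (2 ^ j * (x - y)))" "integrable (nu z) (\<lambda>y. vertical.K 0 1 (2 ^ j * (x - y)))"
    proof -
      obtain b where b: "\<And>i l w. i \<le> 3 \<Longrightarrow> l \<le> 3 \<Longrightarrow> \<bar>horizontal.K i l w\<bar> \<le> b" using horizontal.K_bounded by blast
      obtain b' where b': "\<And>i l w. i \<le> 3 \<Longrightarrow> l \<le> 3 \<Longrightarrow> \<bar>vertical.K i l w\<bar> \<le> b'" using vertical.K_bounded by blast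
      have c: "continuous_on UNIV (\<lambda>y. horizontal.K 1 0 (2 ^ j * (x - y)))" "continuous_on UNIV (\<lambda>y. vertical.K 0 1 (2 ^ j * (x - y)))"
        by (rule continuous_on_compose2[OF horizontal.K_continuous, of _ _ UNIV] continuous_on_compose2[OF vertical.K_continuous, of _ _ UNIV],
            simp_all add: continuous_intros)+
      show "integrable (nu z) (\<lambda>y. horizontal.K 1 0 (2 ^ j * (x - y)))"
        by (rule N.integrable_const_bound[where B = b])
           (use b borel_measurable_continuous_onI[OF c(1)] in \<open>auto simp: measurable_cong_sets[OF sets_nu refl]\<close>)
      show "integrable (nu z) (\<lambda>y. vertical.K 0 1 (2 ^ j * (x - y)))"
        by (rule N.integrable_const_bound[where B = b'])
           (use b' borel_measurable_continuous_onI[OF c(2)] in \<open>auto simp: measurable_cong_sets[OF sets_nu refl]\<close>)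
    qed
    have "mollified (Suc j) z x - mollified j z x
        = (\<integral>y. 4 ^ Suc j * mollifier (2 ^ Suc j * (x - y)) - 4 ^ j * mollifier (2 ^ j * (x - y)) \<partial>nu z)"
      unfolding mollified_def by (rule Bochner_Integration.integral_diff[OF mi mi, symmetric])
    also have "\<dots> = (\<integral>y. 4 ^ j * (horizontal.K 1 0 (2 ^ j * (x - y)) + vertical.K 0 1 (2 ^ j * (x - y))) \<partial>nu z)"
      unfolding mollifier_dilation[symmetric] by (simp add: algebra_simps)
    also have "\<dots> = 4 ^ j * ((\<integral>y. horizontal.K 1 0 (2 ^ j * (x - y)) \<partial>nu z) + (\<integral>y. vertical.K 0 1 (2 ^ j * (x - y)) \<partial>nu z))"
      using Ki by simp
    finally show ?thesis unfolding H.smoothed_def V.smoothed_def arg .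
  qed
  show ?thesis
  proof (rule that)
    show "0 \<le> 2 * (CH + CV)" using CH(1) CV(1) by simp
    fix j and G :: "(int \<times> int) set" and \<zeta>
    assume j: "8 * (1/2) ^ j \<le> \<eta>" and G: "finite G"
      and \<zeta>: "\<And>g. g \<in> G \<Longrightarrow> \<zeta> g \<in> grid_square ((1/2) ^ j) g \<and> cmod (\<zeta> g - z0) \<le> \<eta> / 4"
    define \<rho> :: real where "\<rho> = (1/2) ^ j"
    have \<rho>: "0 < \<rho>" "\<rho> \<le> 1" "8 * \<rho> \<le> \<eta>" using j by (simp_all add: \<rho>_def power_le_one)
    have \<zeta>': "\<zeta> g \<in> grid_square \<rho> g \<and> cmod (\<zeta> g - z0) \<le> \<eta> / 4" if "g \<in> G" for g
      using \<zeta>[OF that] by (simp add: \<rho>_def)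
    have one: "cmod (\<zeta> g) < 1" if "g \<in> G" for g
      using \<zeta>[OF that] pos by (intro lt_1) (simp add: dist_norm norm_minus_commute)
    have sm: "H.smoothed 1 0 \<rho> (\<zeta> g) \<in> borel_measurable lborel" "V.smoothed 0 1 \<rho> (\<zeta> g) \<in> borel_measurable lborel"
      if g: "g \<in> G" for g
    proof -
      have "(\<lambda>x. H.averaged_kernel 1 0 (\<lambda>_ _. 1) \<rho> n (\<zeta> g) x) \<in> borel_measurable lborel"
        "(\<lambda>x. V.averaged_kernel 0 1 (\<lambda>_ _. 1) \<rho> n (\<zeta> g) x) \<in> borel_measurable lborel" for n
        using H.averaged_kernel_continuous(2)[of 1 0 \<rho> "\<lambda>_ _. 1" n "\<zeta> g"]
          V.averaged_kernel_continuous(2)[of 0 1 \<rho> "\<lambda>_ _. 1" n "\<zeta> g"] \<rho>(1)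
        by (simp_all add: borel_measurable_continuous_onI)
      note am = this
      show "H.smoothed 1 0 \<rho> (\<zeta> g) \<in> borel_measurable lborel"
        by (rule borel_measurable_LIMSEQ_metric[OF am(1) H.averaged_kernel_tendsto[OF _ _ \<rho>(1) one[OF g]]]) simp_all
      show "V.smoothed 0 1 \<rho> (\<zeta> g) \<in> borel_measurable lborel"
        by (rule borel_measurable_LIMSEQ_metric[OF am(2) V.averaged_kernel_tendsto[OF _ _ \<rho>(1) one[OF g]]]) simp_all
    qed
    have energy: "increment_energy j (\<zeta> g) \<le> ennreal (2 * 16 ^ j)
        * ((\<integral>\<^sup>+x. ennreal ((H.smoothed 1 0 \<rho> (\<zeta> g) x)\<^sup>2) \<partial>lborel) + (\<integral>\<^sup>+x. ennreal ((V.smoothed 0 1 \<rho> (\<zeta> g) x)\<^sup>2) \<partial>lborel))"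
      if g: "g \<in> G" for g
    proof -
      have "increment_energy j (\<zeta> g) \<le> (\<integral>\<^sup>+x. ennreal (2 * 16 ^ j)
          * (ennreal ((H.smoothed 1 0 \<rho> (\<zeta> g) x)\<^sup>2) + ennreal ((V.smoothed 0 1 \<rho> (\<zeta> g) x)\<^sup>2)) \<partial>lborel)"
        unfolding increment_energy_def
      proof (rule nn_integral_mono)
        fix x
        let ?a = "H.smoothed 1 0 \<rho> (\<zeta> g) x" and ?b = "V.smoothed 0 1 \<rho> (\<zeta> g) x"
        have "(16::real) ^ j = (4 ^ j)\<^sup>2" by (simp add: power2_eq_square flip: power_mult_distrib)
        then have "(mollified (Suc j) (\<zeta> g) x - mollified j (\<zeta> g) x)\<^sup>2 = 16 ^ j * (?a + ?b)\<^sup>2"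
          unfolding inc \<rho>_def[symmetric] by (simp add: power_mult_distrib)
        also have "\<dots> \<le> 16 ^ j * (2 * (?a\<^sup>2 + ?b\<^sup>2))"
        proof (rule mult_left_mono)
          show "(?a + ?b)\<^sup>2 \<le> 2 * (?a\<^sup>2 + ?b\<^sup>2)"
            using sum_squares_bound[of ?a ?b] by (simp add: power2_sum)
        qed simp
        finally have "ennreal ((mollified (Suc j) (\<zeta> g) x - mollified j (\<zeta> g) x)\<^sup>2) \<le> ennreal (2 * 16 ^ j * (?a\<^sup>2 + ?b\<^sup>2))"
          by (intro ennreal_leI) (simp only: mult.assoc mult.left_commute)
        also have "\<dots> = ennreal (2 * 16 ^ j) * (ennreal (?a\<^sup>2) + ennreal (?b\<^sup>2))"
          by (subst ennreal_mult) (simp_all add: ennreal_plus)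
        finally show "ennreal ((mollified (Suc j) (\<zeta> g) x - mollified j (\<zeta> g) x)\<^sup>2)
            \<le> ennreal (2 * 16 ^ j) * (ennreal (?a\<^sup>2) + ennreal (?b\<^sup>2))" .
      qed
      also have "\<dots> = ennreal (2 * 16 ^ j)
        * ((\<integral>\<^sup>+x. ennreal ((H.smoothed 1 0 \<rho> (\<zeta> g) x)\<^sup>2) \<partial>lborel) + (\<integral>\<^sup>+x. ennreal ((V.smoothed 0 1 \<rho> (\<zeta> g) x)\<^sup>2) \<partial>lborel))"
        using sm[OF g] by (subst nn_integral_cmult) (simp_all add: nn_integral_add)
      finally show ?thesis .
    qed
    have "(\<Sum>g\<in>G. increment_energy j (\<zeta> g)) \<le> (\<Sum>g\<in>G. ennreal (2 * 16 ^ j)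
        * ((\<integral>\<^sup>+x. ennreal ((H.smoothed 1 0 \<rho> (\<zeta> g) x)\<^sup>2) \<partial>lborel) + (\<integral>\<^sup>+x. ennreal ((V.smoothed 0 1 \<rho> (\<zeta> g) x)\<^sup>2) \<partial>lborel)))"
      by (rule sum_mono[OF energy])
    also have "\<dots> = ennreal (2 * 16 ^ j)
        * ((\<Sum>g\<in>G. \<integral>\<^sup>+x. ennreal ((H.smoothed 1 0 \<rho> (\<zeta> g) x)\<^sup>2) \<partial>lborel)
          + (\<Sum>g\<in>G. \<integral>\<^sup>+x. ennreal ((V.smoothed 0 1 \<rho> (\<zeta> g) x)\<^sup>2) \<partial>lborel))"
      by (simp only: sum_distrib_left[symmetric] sum.distrib)
    also have "\<dots> \<le> ennreal (2 * 16 ^ j) * (ennreal (CH * \<rho> powr \<beta>) + ennreal (CV * \<rho> powr \<beta>))"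
      by (intro mult_left_mono add_mono CH(2)[OF \<rho> G \<zeta>'] CV(2)[OF \<rho> G \<zeta>']) auto
    also have "\<dots> = ennreal (2 * 16 ^ j * ((CH + CV) * \<rho> powr \<beta>))"
    proof -
      have "ennreal (CH * \<rho> powr \<beta>) + ennreal (CV * \<rho> powr \<beta>) = ennreal ((CH + CV) * \<rho> powr \<beta>)"
        using CH(1) CV(1) by (simp add: distrib_right flip: ennreal_plus)
      moreover have "ennreal (2 * 16 ^ j * ((CH + CV) * \<rho> powr \<beta>)) = ennreal (2 * 16 ^ j) * ennreal ((CH + CV) * \<rho> powr \<beta>)"
        using CH(1) CV(1) by (intro ennreal_mult) simp_all
      ultimately show ?thesis by (simp only:)
    qed
    also have "2 * 16 ^ j * ((CH + CV) * \<rho> powr \<beta>) = 2 * (CH + CV) * (2 powr (4 - \<beta>)) ^ j"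
    proof -
      have "(16::real) ^ j = (2 powr 4) ^ j" by (simp add: powr_numeral)
      also have "\<dots> = 2 powr (real j * 4)" by (subst powr_power) simp_all
      finally have a: "(16::real) ^ j = 2 powr (real j * 4)" .
      have "\<rho> = 2 powr (- real j)" by (simp add: \<rho>_def powr_minus_divide powr_realpow power_one_over)
      then have b: "\<rho> powr \<beta> = 2 powr (- real j * \<beta>)" by (simp only: powr_powr)
      have "(2 powr (4 - \<beta>)) ^ j = 2 powr (real j * (4 - \<beta>))" by (subst powr_power) simp_all
      also have "real j * (4 - \<beta>) = real j * 4 + - real j * \<beta>" by (simp add: right_diff_distrib)
      finally have "(2 powr (4 - \<beta>)) ^ j = 16 ^ j * \<rho> powr \<beta>" by (simp only: a b powr_add)
      moreover have "2 * 16 ^ j * ((CH + CV) * \<rho> powr \<beta>) = 2 * (CH + CV) * (16 ^ j * \<rho> powr \<beta>)"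
        by (simp only: mult.assoc mult.left_commute)
      ultimately show ?thesis by (simp only:)
    qed
    finally show "(\<Sum>g\<in>G. increment_energy j (\<zeta> g)) \<le> ennreal (2 * (CH + CV) * (2 powr (4 - \<beta>)) ^ j)" .
  qed
qed

lemma hausdorff_null_exceptional:
  assumes \<beta>: "0 \<le> \<beta>" "\<beta> \<le> 3" "1 < 2 * r powr \<beta>" and s: "4 - \<beta> < s"
  shows "hausdorff_measure s {z \<in> ball z0 (\<eta> / 4). \<not> has_L2_density (nu z)} = 0"
proof -
  obtain C where C: "0 \<le> C" "\<And>j G \<zeta>. 8 * (1/2) ^ j \<le> \<eta> \<Longrightarrow> finite G \<Longrightarrow>
    (\<And>g. g \<in> G \<Longrightarrow> \<zeta> g \<in> grid_square ((1/2) ^ j) g \<and> cmod (\<zeta> g - z0) \<le> \<eta> / 4) \<Longrightarrow>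
    (\<Sum>g\<in>G. increment_energy j (\<zeta> g)) \<le> ennreal (C * (2 powr (4 - \<beta>)) ^ j)"
    by (rule increment_energy_sum_le[OF \<beta>]) blast
  \<comment> \<open>Half of the room between \<open>4 - \<beta>\<close> and \<open>s\<close> is
    spent on the energy threshold \<open>\<theta> ^ j\<close>; the number of squares then grows with
    ratio \<open>x = 2 powr ((4 - \<beta> + s) / 2)\<close>, still below
    \<open>2 powr s\<close>.\<close>
  define \<theta> :: real where "\<theta> = 2 powr (- (s - (4 - \<beta>)) / 2)"
  have "\<theta> < 2 powr 0" unfolding \<theta>_def using s by (intro powr_less_mono) auto
  then have \<theta>: "0 < \<theta>" "\<theta> < 1" by (simp_all add: \<theta>_def)
  define bad where "bad j = {z \<in> ball z0 (\<eta> / 4). ennreal (\<theta> ^ j) < increment_energy j z}" for j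
  define G where "G j = {g. grid_square ((1/2) ^ j) g \<inter> bad j \<noteq> {}}" for j
  define Q where "Q j = grid_square ((1/2) ^ j) ` G j" for j
  have "(\<lambda>j. 8 * (1/2::real) ^ j) \<longlonglongrightarrow> 8 * 0" by (intro tendsto_intros LIMSEQ_power_zero) auto
  then have "\<forall>\<^sub>F j in sequentially. 8 * (1/2) ^ j < \<eta>" using pos by (intro order_tendstoD) auto
  then obtain J where J: "\<And>j. J \<le> j \<Longrightarrow> 8 * (1/2) ^ j < \<eta>" unfolding eventually_sequentially by blast
  have inball: "z \<in> ball z0 (2 * \<eta>)" if "z \<in> ball z0 (\<eta> / 4)" for z using that pos by simp
  have finG: "finite (G j)" for j
  proof (rule finite_grid_indices[where h = "(1/2) ^ j" and R = 1])
    fix g assume "g \<in> G j"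
    then obtain z where "z \<in> grid_square ((1/2) ^ j) g" "z \<in> ball z0 (\<eta> / 4)" by (auto simp: G_def bad_def)
    then show "\<exists>z\<in>grid_square ((1/2) ^ j) g. cmod z \<le> 1" using lt_1[OF inball] less_imp_le by blast
  qed simp
  define x where "x = 2 powr (4 - \<beta>) / \<theta>"
  have x: "x = 2 powr ((4 - \<beta> + s) / 2)"
    unfolding x_def \<theta>_def by (simp add: field_simps flip: powr_diff)
  show ?thesis
  proof (rule hausdorff_null_limsup[where Q = Q and J = J and D = 4 and C = C and x = x])
    fix z assume z: "z \<in> {z \<in> ball z0 (\<eta> / 4). \<not> has_L2_density (nu z)}"
    show "\<exists>\<^sub>\<infinity>j. z \<in> \<Union>(Q j)"
    proof (rule ccontr)
      assume "\<not> (\<exists>\<^sub>\<infinity>j. z \<in> \<Union>(Q j))"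
      then obtain m where m: "\<And>j. m \<le> j \<Longrightarrow> z \<notin> \<Union>(Q j)" unfolding INFM_nat_le by blast
      have "increment_energy j z \<le> ennreal (\<theta> ^ j)" if "m \<le> j" for j
      proof (rule ccontr)
        assume "\<not> increment_energy j z \<le> ennreal (\<theta> ^ j)"
        then have "z \<in> bad j" using z by (simp add: bad_def not_le)
        moreover have "z \<in> grid_square ((1/2) ^ j) (\<lfloor>Re z / (1/2) ^ j\<rfloor>, \<lfloor>Im z / (1/2) ^ j\<rfloor>)"
          by (rule grid_square_floor) simp
        ultimately have "z \<in> \<Union>(Q j)" unfolding Q_def G_def by blast
        then show False using m[OF that] by blast
      qed
      then have "has_L2_density (nu z)"
        using has_L2_density_nu_if_increments_decay[OF lt_1[OF inball] \<theta>] z by blast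
      then show False using z by blast
    qed
  next
    fix j A assume "A \<in> Q j"
    then show "bounded A \<and> diameter A \<le> 4 * (1/2) ^ j"
      unfolding Q_def using grid_square_diameter[of "(1/2) ^ j"] by auto
  next
    fix j assume j: "J \<le> j"
    \<comment> \<open>A Chebyshev count: the samples may be chosen freely, so in every bad square
      one takes a point whose energy exceeds the threshold.\<close>
    have "\<forall>g\<in>G j. \<exists>z. z \<in> grid_square ((1/2) ^ j) g \<and> z \<in> bad j" unfolding G_def by blast
    then obtain \<zeta> where \<zeta>: "\<And>g. g \<in> G j \<Longrightarrow> \<zeta> g \<in> grid_square ((1/2) ^ j) g \<and> \<zeta> g \<in> bad j" by metis
    have "ennreal (card (G j) * \<theta> ^ j) = (\<Sum>g\<in>G j. ennreal (\<theta> ^ j))"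
      by (simp add: ennreal_mult' ennreal_of_nat_eq_real_of_nat)
    also have "\<dots> \<le> (\<Sum>g\<in>G j. increment_energy j (\<zeta> g))"
      using \<zeta> by (intro sum_mono) (simp add: bad_def less_imp_le)
    also have "\<dots> \<le> ennreal (C * (2 powr (4 - \<beta>)) ^ j)"
      using \<zeta> by (intro C(2) finG less_imp_le[OF J[OF j]])
        (simp add: bad_def dist_norm norm_minus_commute less_imp_le)
    finally have "card (G j) * \<theta> ^ j \<le> C * (2 powr (4 - \<beta>)) ^ j" using C(1) by simp
    then have "card (G j) \<le> C * x ^ j" using \<theta> by (simp add: x_def power_divide field_simps)
    moreover have "card (Q j) \<le> card (G j)" unfolding Q_def by (rule card_image_le[OF finG])
    ultimately show "real (card (Q j)) \<le> C * x ^ j" by linarith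
    show "finite (Q j)" unfolding Q_def using finG by simp
  next
    have "\<beta> < 4" using \<beta> by simp
    then show "0 < s" using s by linarith
    show "x < 2 powr s" unfolding x using s by (intro powr_less_mono) auto
    show "0 \<le> x" by (simp add: x)
  qed simp
qed

end

section \<open>From transversal discs to the annulus\<close>

lemma poly_derivatives_bounded:
  assumes R: "0 < R" "R < 1"
  obtains M where "0 < M" "\<And>p z. (\<And>i. cmod (coeff p i) \<le> 1) \<Longrightarrow> cmod z \<le> R \<Longrightarrow> cmod (poly p z) \<le> M \<and>
    cmod (poly (pderiv p) z) \<le> M \<and> cmod (poly (pderiv (pderiv p)) z) \<le> M \<and>
    cmod (poly (pderiv (pderiv (pderiv p))) z) \<le> M"
proof -
  \<comment> \<open>The third derivative is the worst of the four: its coefficients are at most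
    \<open>(i + 1) (i + 2) (i + 3) \<le> 6 (i + 1)^3\<close>.\<close>
  define M where "M = (\<Sum>k. 6 * (real (Suc k) ^ 3 * R ^ k))"
  have sm: "summable (\<lambda>k. 6 * (real (Suc k) ^ 3 * R ^ k))"
    by (intro summable_mult summable_cubic_geometric R)
  have bd: "cmod (poly q z) \<le> M" if q: "\<And>i. cmod (coeff q i) \<le> 6 * real (Suc i) ^ 3" and z: "cmod z \<le> R" for q z
  proof -
    have "cmod (poly q z) \<le> (\<Sum>i\<le>degree q. cmod (coeff q i * z ^ i))"
      unfolding poly_altdef by (rule norm_sum)
    also have "\<dots> \<le> (\<Sum>i\<le>degree q. 6 * (real (Suc i) ^ 3 * R ^ i))"
    proof (rule sum_mono)
      fix i
      have "cmod (coeff q i) * cmod z ^ i \<le> (6 * real (Suc i) ^ 3) * R ^ i"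
        using q z by (intro mult_mono power_mono) auto
      then show "cmod (coeff q i * z ^ i) \<le> 6 * (real (Suc i) ^ 3 * R ^ i)"
        by (simp only: norm_mult norm_power mult.assoc)
    qed
    also have "\<dots> \<le> M" unfolding M_def using R by (intro sum_le_suminf sm) auto
    finally show ?thesis .
  qed
  have p3: "1 \<le> real (Suc i) ^ 3" for i by (intro one_le_power) simp
  show ?thesis
  proof (rule that)
    have "6 * (real (Suc 0) ^ 3 * R ^ 0) \<le> M"
      unfolding M_def using sum_le_suminf[OF sm, of "{0}"] R by simp
    then show "0 < M" by simp
    fix p :: "complex poly" and z
    assume c: "\<And>i. cmod (coeff p i) \<le> 1" and z: "cmod z \<le> R"
    have c0: "cmod (coeff p i) \<le> 6 * real (Suc i) ^ 3" for i using c[of i] p3[of i] by linarith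
    have c1': "cmod (coeff (pderiv p) i) \<le> real (Suc i)" for i
      using mult_left_mono[OF c[of "Suc i"], of "real (Suc i)"] by (simp add: coeff_pderiv norm_mult del: of_nat_Suc)
    have c2': "cmod (coeff (pderiv (pderiv p)) i) \<le> real (Suc i) * real (Suc (Suc i))" for i
      using mult_left_mono[OF c1'[of "Suc i"], of "real (Suc i)"] by (simp add: coeff_pderiv[of "pderiv p"] norm_mult del: of_nat_Suc)
    have c3': "cmod (coeff (pderiv (pderiv (pderiv p))) i) \<le> real (Suc i) * (real (Suc (Suc i)) * real (Suc (Suc (Suc i))))" for i
      using mult_left_mono[OF c2'[of "Suc i"], of "real (Suc i)"] by (simp add: coeff_pderiv[of "pderiv (pderiv p)"] norm_mult del: of_nat_Suc)
    have c1: "cmod (coeff (pderiv p) i) \<le> 6 * real (Suc i) ^ 3" for i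
      using c1'[of i] self_le_power[of "real (Suc i)" 3] p3[of i] by simp
    have c2: "cmod (coeff (pderiv (pderiv p)) i) \<le> 6 * real (Suc i) ^ 3" for i
    proof -
      have "real (Suc (Suc i)) \<le> 2 * (real (Suc i) * real (Suc i))" by (simp add: algebra_simps)
      from mult_left_mono[OF this, of "real (Suc i)"]
      have "real (Suc i) * real (Suc (Suc i)) \<le> 2 * real (Suc i) ^ 3"
        by (simp only: power3_eq_cube mult.assoc mult.left_commute[of _ 2] of_nat_0_le_iff)
      then show ?thesis using c2'[of i] p3[of i] by linarith
    qed
    have c3: "cmod (coeff (pderiv (pderiv (pderiv p))) i) \<le> 6 * real (Suc i) ^ 3" for i
    proof -
      have "real (Suc (Suc i)) * real (Suc (Suc (Suc i))) \<le> (2 * real (Suc i)) * (3 * real (Suc i))"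
        by (intro mult_mono) auto
      from mult_left_mono[OF this, of "real (Suc i)"]
      have "real (Suc i) * (real (Suc (Suc i)) * real (Suc (Suc (Suc i)))) \<le> real (Suc i) * ((2 * real (Suc i)) * (3 * real (Suc i)))"
        by (simp only: of_nat_0_le_iff)
      also have "\<dots> = 6 * real (Suc i) ^ 3" by algebra
      finally show ?thesis using c3'[of i] by linarith
    qed
    show "cmod (poly p z) \<le> M \<and> cmod (poly (pderiv p) z) \<le> M \<and> cmod (poly (pderiv (pderiv p)) z) \<le> M \<and>
        cmod (poly (pderiv (pderiv (pderiv p))) z) \<le> M"
      by (intro conjI bd c0 c1 c2 c3 z)
  qed
qed

text \<open>The eighth power is \<open>256 / 3125\<close>, and everything follows by comparing
  powers. The bound on the cube is the decisive one: it yields \<open>ln 2 / (- ln r) < 3\<close>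
  for all \<open>r\<close> in question, so the cubic gain of one integration by parts
  suffices.\<close>

lemma critical_radius:
  "0 < 2 * 5 powr (-5/8 :: real)" "2 * 5 powr (-5/8 :: real) < 1"
  "(2 * 5 powr (-5/8 :: real)) ^ 3 < 1 / 2"
proof -
  define c where "c = 2 * 5 powr (-5/8 :: real)"
  have c0: "0 < c" by (simp add: c_def)
  have "(5 powr (-5/8 :: real)) ^ 8 = 5 powr (-5)" by (simp add: powr_power)
  also have "\<dots> = 1 / 5 ^ 5" by (simp add: powr_minus_divide flip: powr_numeral)
  finally have c8: "c ^ 8 = 256 / 3125" by (simp add: c_def power_mult_distrib)
  show "0 < 2 * 5 powr (-5/8 :: real)" by simp
  show "2 * 5 powr (-5/8 :: real) < 1"
    unfolding c_def[symmetric]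
  proof (rule ccontr)
    assume "\<not> c < 1"
    then have "1 \<le> c ^ 8" by (intro one_le_power) simp
    then show False using c8 by simp
  qed
  show "(2 * 5 powr (-5/8 :: real)) ^ 3 < 1 / 2"
    unfolding c_def[symmetric]
  proof (rule ccontr)
    assume "\<not> c ^ 3 < 1 / 2"
    then have "(1/2) ^ 8 \<le> (c ^ 3) ^ 8" by (intro power_mono) auto
    also have "\<dots> = (c ^ 8) ^ 3" by (simp flip: power_mult)
    finally show False unfolding c8 by (simp add: power_divide)
  qed
qed

lemma transversal_disc_exists:
  assumes im: "Im z0 \<noteq> 0" and z0: "r < cmod z0" "cmod z0 < 2 * 5 powr (-5/8)" and r: "0 < r"
  obtains \<eta> \<delta> M where "transversal_disc z0 \<eta> r \<delta> M"
proof -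
  obtain \<eta>1 \<delta> where t: "0 < \<eta>1" "0 < \<delta>"
    "\<And>z f. cmod (z - z0) < \<eta>1 \<Longrightarrow> f \<in> sign_quotients \<Longrightarrow> cmod (poly f z) < \<delta> \<Longrightarrow> \<delta> < cmod (poly (pderiv f) z)"
    by (rule transversality[OF im z0(2)]) blast
  have z1: "cmod z0 < 1" using z0(2) critical_radius(2) by linarith
  define R where "R = (1 + cmod z0) / 2"
  have R: "0 < R" "R < 1" "cmod z0 < R" using z1 norm_ge_zero[of z0] unfolding R_def by (simp_all add: field_simps add_pos_nonneg)
  obtain M where M: "0 < M" "\<And>p z. (\<And>i. cmod (coeff p i) \<le> 1) \<Longrightarrow> cmod z \<le> R \<Longrightarrow> cmod (poly p z) \<le> M \<and>
    cmod (poly (pderiv p) z) \<le> M \<and> cmod (poly (pderiv (pderiv p)) z) \<le> M \<and>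
    cmod (poly (pderiv (pderiv (pderiv p))) z) \<le> M"
    by (rule poly_derivatives_bounded[OF R(1,2)]) blast
  \<comment> \<open>The doubled disc must stay within reach of transversality and between the radii
    \<open>r\<close> and \<open>R\<close>; the quotient \<open>\<delta> / (8 * M)\<close> is the
    condition \<open>small\<close> of the locale.\<close>
  define \<eta> where "\<eta> = min (min (\<eta>1 / 2) (\<delta> / (8 * M))) (min ((cmod z0 - r) / 2) ((R - cmod z0) / 2))"
  have \<eta>: "0 < \<eta>" "2 * \<eta> \<le> \<eta>1" "\<eta> \<le> \<delta> / (8 * M)" "2 * \<eta> \<le> cmod z0 - r" "2 * \<eta> \<le> R - cmod z0"
  proof -
    have "\<eta> \<le> \<eta>1 / 2" "\<eta> \<le> \<delta> / (8 * M)" "\<eta> \<le> (cmod z0 - r) / 2" "\<eta> \<le> (R - cmod z0) / 2"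
      unfolding \<eta>_def by (meson min.cobounded1 min.cobounded2 order_trans)+
    then show "2 * \<eta> \<le> \<eta>1" "\<eta> \<le> \<delta> / (8 * M)" "2 * \<eta> \<le> cmod z0 - r" "2 * \<eta> \<le> R - cmod z0"
      by (simp_all add: le_divide_eq mult.commute)
    show "0 < \<eta>" using t(1,2) M(1) z0 R unfolding \<eta>_def by (simp only: min_less_iff_conj) simp
  qed
  have near: "r \<le> cmod z" "cmod z \<le> R" "cmod (z - z0) < \<eta>1" if "z \<in> ball z0 (2 * \<eta>)" for z
  proof -
    have d: "cmod (z - z0) < 2 * \<eta>" using that by (simp add: dist_norm norm_minus_commute)
    then show "cmod (z - z0) < \<eta>1" using \<eta> by linarith
    show "r \<le> cmod z" "cmod z \<le> R"
      using d \<eta> norm_triangle_ineq2[of z z0] norm_triangle_ineq2[of z0 z] by (simp_all add: norm_minus_commute)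
  qed
  have "transversal_disc z0 \<eta> r \<delta> M"
  proof
    show "8 * \<eta> * M \<le> \<delta>" using \<eta>(3) M(1) by (simp add: field_simps)
    show "cmod z < 1" if "z \<in> ball z0 (2 * \<eta>)" for z using near[OF that] R by linarith
  qed (use t M near \<eta> r in auto)
  then show ?thesis using that by blast
qed

text \<open>The exponent \<alpha> solves \<open>2 * r powr \<alpha> = 1\<close>, so each smaller
  \<beta> satisfies the strict summability condition. The discs come without a uniform radius, in
  particular near the real axis; Lindelof's theorem extracts countably many, and the real segment is
  added, which is null because \<open>s > 1\<close>.\<close>

lemma hausdorff_null_exceptional_annulus:
  assumes r: "2 powr (-1/2) < r" "r < R" "R < 2 * 5 powr (-5/8)" and s: "4 - ln 2 / (- ln r) < s"
  shows "hausdorff_measure s {z. r < cmod z \<and> cmod z < R \<and> \<not> has_L2_density (nu z)} = 0"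
proof -
  define \<alpha> where "\<alpha> = ln 2 / (- ln r)"
  have r0: "0 < r" using r(1) powr_gt_zero[of 2 "-1/2"] by linarith
  have r1: "r < 1" using r critical_radius(2) by linarith
  have \<alpha>0: "0 < \<alpha>" unfolding \<alpha>_def using r0 r1 by (intro divide_pos_pos) auto
  have r\<alpha>: "r powr \<alpha> = 1 / 2"
  proof -
    have "r powr \<alpha> = exp (- ln 2)" using r0 r1 by (simp add: \<alpha>_def powr_def)
    then show ?thesis by (simp add: exp_minus inverse_eq_divide)
  qed
  have \<alpha>3: "\<alpha> < 3"
  proof (rule ccontr)
    assume "\<not> \<alpha> < 3"
    then have "r powr \<alpha> \<le> r powr 3" using r0 r1 by (intro powr_mono') auto
    also have "\<dots> = r ^ 3" using r0 by (simp add: powr_numeral)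
    also have "\<dots> \<le> (2 * 5 powr (-5/8)) ^ 3" using r r0 by (intro power_mono) auto
    also have "\<dots> < 1 / 2" by (rule critical_radius(3))
    finally show False using r\<alpha> by simp
  qed
  have s1: "1 < s" using s \<alpha>3 unfolding \<alpha>_def[symmetric] by linarith
  \<comment> \<open>The midpoint between \<open>4 - s\<close> and \<alpha>, replaced by 0 when a
    large \<open>s\<close> makes it negative.\<close>
  define \<beta> where "\<beta> = max 0 ((\<alpha> + 4 - s) / 2)"
  have \<beta>: "0 \<le> \<beta>" "\<beta> < \<alpha>" "4 - \<beta> < s"
  proof -
    have "4 - \<alpha> < s" using s by (simp only: \<alpha>_def)
    then have "(\<alpha> + 4 - s) / 2 < \<alpha>" "4 - s < (\<alpha> + 4 - s) / 2" by (simp_all add: field_simps)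
    moreover have "(\<alpha> + 4 - s) / 2 \<le> \<beta>" "0 \<le> \<beta>" unfolding \<beta>_def by (rule max.cobounded2 max.cobounded1)+
    ultimately show "0 \<le> \<beta>" "\<beta> < \<alpha>" "4 - \<beta> < s"
      using \<alpha>0 unfolding \<beta>_def by (simp_all only: max_less_iff_conj)
  qed
  have "r powr \<alpha> < r powr \<beta>" using r0 r1 \<beta> by (intro powr_less_mono') auto
  then have r\<beta>: "1 < 2 * r powr \<beta>" using r\<alpha> by simp
  define A where "A = {z0. r < cmod z0 \<and> cmod z0 < R \<and> Im z0 \<noteq> 0}"
  have "\<exists>e>0. hausdorff_measure s {z \<in> ball z0 e. \<not> has_L2_density (nu z)} = 0" if z0: "z0 \<in> A" for z0
  proof -
    obtain \<eta> \<delta> M where "transversal_disc z0 \<eta> r \<delta> M"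
      by (rule transversal_disc_exists[of z0 r]) (use z0 r r0 in \<open>auto simp: A_def\<close>)
    then interpret transversal_disc z0 \<eta> r \<delta> M .
    show ?thesis
      using hausdorff_null_exceptional[OF \<beta>(1) _ r\<beta> \<beta>(3)] \<beta> \<alpha>3 pos by (intro exI[of _ "\<eta> / 4"]) auto
  qed
  then obtain e where e: "\<And>z0. z0 \<in> A \<Longrightarrow> 0 < e z0"
    "\<And>z0. z0 \<in> A \<Longrightarrow> hausdorff_measure s {z \<in> ball z0 (e z0). \<not> has_L2_density (nu z)} = 0"
    by metis
  obtain F where F: "F \<subseteq> (\<lambda>z0. ball z0 (e z0)) ` A" "countable F" "\<Union>F = \<Union>((\<lambda>z0. ball z0 (e z0)) ` A)"
    by (rule Lindelof[of "(\<lambda>z0. ball z0 (e z0)) ` A"]) auto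
  have 1: "hausdorff_measure s (\<Union>B\<in>F. {z \<in> B. \<not> has_L2_density (nu z)}) = 0"
    by (rule hausdorff_null_UN[OF F(2)]) (use F(1) e(2) in blast)
  have 2: "hausdorff_measure s {z::complex. Im z = 0 \<and> cmod z < 1} = 0"
    by (rule hausdorff_null_real_segment[OF s1])
  have "hausdorff_measure s (\<Union>b\<in>UNIV. if b then \<Union>B\<in>F. {z \<in> B. \<not> has_L2_density (nu z)} else {z. Im z = 0 \<and> cmod z < 1}) = 0"
    by (rule hausdorff_null_UN) (use 1 2 in auto)
  then show ?thesis
  proof (rule hausdorff_null_subset)
    show "{z. r < cmod z \<and> cmod z < R \<and> \<not> has_L2_density (nu z)}
        \<subseteq> (\<Union>b\<in>UNIV. if b then \<Union>B\<in>F. {z \<in> B. \<not> has_L2_density (nu z)} else {z. Im z = 0 \<and> cmod z < 1})"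
    proof
      fix z assume z: "z \<in> {z. r < cmod z \<and> cmod z < R \<and> \<not> has_L2_density (nu z)}"
      show "z \<in> (\<Union>b\<in>UNIV. if b then \<Union>B\<in>F. {z \<in> B. \<not> has_L2_density (nu z)} else {z. Im z = 0 \<and> cmod z < 1})"
      proof (cases "Im z = 0")
        case True
        then have "z \<in> {z. Im z = 0 \<and> cmod z < 1}" using z r critical_radius(2) by auto
        then show ?thesis by (intro UN_I[of False]) auto
      next
        case False
        then have "z \<in> A" using z by (simp add: A_def)
        then have "z \<in> \<Union>((\<lambda>z0. ball z0 (e z0)) ` A)" using e(1) by (intro UN_I[of z]) auto
        then have "z \<in> \<Union>F" using F(3) by blast
        then show ?thesis using z by (intro UN_I[of True]) auto
      qed
    qed
  qed
qed

section \<open>Assembling the two statements\<close>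

lemma sphere_null_sets_lborel: "sphere (0::complex) t \<in> null_sets lborel"
proof -
  have "negligible (sphere (0::complex) t)" by (rule negligible_sphere)
  then have "sphere (0::complex) t \<in> null_sets lebesgue" by (simp add: negligible_iff_null_sets)
  then show ?thesis by (simp add: null_sets_completion_iff)
qed

text \<open>The quotient is the similarity dimension of two copies contracted by \<open>r\<close>.
  Above 2 it makes the exceptional dimension less than 2, hence the area zero; at most 4 it makes
  the claimed dimension bound nonnegative, as \<open>hausdorff_dim_le\<close> demands.\<close>

lemma similarity_dim_bounds:
  fixes r :: real
  assumes "2 powr (-1/2) < r" "r < 2 * 5 powr (-5/8)"
  shows "2 < ln 2 / (- ln r) \<and> ln 2 / (- ln r) \<le> 4"
proof -
  have r0: "0 < r" using assms(1) powr_gt_zero[of 2 "-1/2"] by linarith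
  have r1: "r < 1" using assms critical_radius(2) by linarith
  have "ln (2 powr (-1/2)) < ln r" using assms(1) r0 by (subst ln_less_cancel_iff) auto
  then have low: "- ln r < ln 2 / 2" by (simp add: ln_powr)
  have "r ^ 3 < (2 * 5 powr (-5/8)) ^ 3" using assms(2) r0 by (intro power_strict_mono) auto
  then have "r ^ 3 < 1 / 2" using critical_radius(3) by linarith
  then have "ln (r ^ 3) < ln (1 / 2)" using r0 by (subst ln_less_cancel_iff) auto
  then have up: "ln 2 / 3 < - ln r" using r0 by (simp add: ln_realpow ln_div)
  have n: "0 < - ln r" using r0 r1 by simp
  have l2: "0 < ln (2::real)" by simp
  show ?thesis
  proof
    have "2 * (- ln r) < ln 2" using low by linarith
    then show "2 < ln 2 / (- ln r)" by (simp only: pos_less_divide_eq[OF n])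
    have "ln 2 \<le> 4 * (- ln r)" using up l2 by linarith
    then show "ln 2 / (- ln r) \<le> 4" by (simp only: pos_divide_le_eq[OF n])
  qed
qed

theorem mainTheorem16:
  shows "(AE lam in lborel.
            2 powr (-1/2) \<le> cmod lam \<and> cmod lam \<le> 2 * 5 powr (-5/8) \<longrightarrow>
              has_L2_density (nu lam) \<and> emeasure lborel (A_set lam) > 0)
       \<and> (\<forall>r R :: real. 2 powr (-1/2) < r \<and> r < R \<and> R < 2 * 5 powr (-5/8) \<longrightarrow>
            hausdorff_dim {lam :: complex. r < cmod lam \<and> cmod lam < R \<and> \<not> has_L2_density (nu lam)}
              \<le> ereal (4 - ln 2 / (- ln r)))"
proof (intro conjI allI impI)
  fix r R :: real
  assume r: "2 powr (-1/2) < r \<and> r < R \<and> R < 2 * 5 powr (-5/8)"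
  show "hausdorff_dim {lam :: complex. r < cmod lam \<and> cmod lam < R \<and> \<not> has_L2_density (nu lam)}
      \<le> ereal (4 - ln 2 / (- ln r))"
  proof (rule hausdorff_dim_le)
    show "hausdorff_measure s {lam. r < cmod lam \<and> cmod lam < R \<and> \<not> has_L2_density (nu lam)} = 0"
      if "4 - ln 2 / (- ln r) < s" for s
      using hausdorff_null_exceptional_annulus[of r R s] r that by blast
    show "0 \<le> 4 - ln 2 / (- ln r)" using similarity_dim_bounds[of r] r by auto
  qed
next
  define a b :: real where "a = 2 powr (-1/2)" and "b = 2 * 5 powr (-5/8)"
  \<comment> \<open>The dimension bound depends on the inner radius and falls below 2 only strictly
    inside the annulus. Countably many annuli with rational radii exhaust the open annulus; its two
    boundary circles have area zero.\<close>
  define I where "I = {pq :: rat \<times> rat. a < of_rat (fst pq) \<and> of_rat (fst pq) < (of_rat (snd pq) :: real) \<and> of_rat (snd pq) < b}"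
  define E where "E pq = {z. of_rat (fst pq) < cmod z \<and> cmod z < of_rat (snd pq) \<and> \<not> has_L2_density (nu z)}" for pq :: "rat \<times> rat"
  have "\<exists>N\<in>null_sets lborel. E pq \<subseteq> N" if "pq \<in> I" for pq
  proof (rule hausdorff_2_null_imp_null_sets)
    have "4 - ln 2 / (- ln (real_of_rat (fst pq))) < 2"
      using similarity_dim_bounds[of "of_rat (fst pq)"] that unfolding I_def a_def b_def by auto
    then show "hausdorff_measure 2 (E pq) = 0"
      unfolding E_def using that
      by (intro hausdorff_null_exceptional_annulus) (auto simp: I_def a_def b_def)
  qed
  then obtain N where N: "\<And>pq. pq \<in> I \<Longrightarrow> N pq \<in> null_sets lborel \<and> E pq \<subseteq> N pq" by metis
  have null: "(\<Union>pq\<in>I. N pq) \<union> sphere 0 a \<union> sphere 0 b \<in> null_sets lborel"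
    by (intro null_sets.Un null_sets_UN' sphere_null_sets_lborel) (use N in auto)
  show "AE lam in lborel. 2 powr (-1/2) \<le> cmod lam \<and> cmod lam \<le> 2 * 5 powr (-5/8) \<longrightarrow>
      has_L2_density (nu lam) \<and> emeasure lborel (A_set lam) > 0"
  proof (rule AE_I'[OF null], rule subsetI, rule ccontr)
    fix z
    assume "z \<in> {z \<in> space lborel. \<not> (2 powr (-1/2) \<le> cmod z \<and> cmod z \<le> 2 * 5 powr (-5/8) \<longrightarrow>
        has_L2_density (nu z) \<and> emeasure lborel (A_set z) > 0)}"
    then have z: "2 powr (-1/2) \<le> cmod z" "cmod z \<le> 2 * 5 powr (-5/8)"
      and n: "\<not> (has_L2_density (nu z) \<and> emeasure lborel (A_set z) > 0)" by blast+
    assume "z \<notin> (\<Union>pq\<in>I. N pq) \<union> sphere 0 a \<union> sphere 0 b"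
    then have out: "z \<notin> sphere 0 a" "z \<notin> sphere 0 b" "z \<notin> (\<Union>pq\<in>I. N pq)" by blast+
    have "a < cmod z" "cmod z < b" using z out by (auto simp: a_def b_def)
    then obtain p q where pq: "a < of_rat p" "of_rat p < cmod z" "cmod z < of_rat q" "of_rat q < b"
      using of_rat_dense by metis
    have "cmod z < 1" using z critical_radius(2) by linarith
    then have "\<not> has_L2_density (nu z)" using n emeasure_A_set_pos by blast
    then have "z \<in> E (p, q)" using pq by (simp add: E_def)
    moreover have "(p, q) \<in> I" using pq by (auto simp: I_def)
    ultimately show False using N out by blast
  qed
qed

end
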